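(* Let $\Omega\subset\mathbb{C}$ be a Jordan domain satisfying $\operatorname{diam}_I(\Omega)=\infty$. Then there is a homeomorphic parametrization $\varphi:\partial\mathbb{D}\to\partial\Omega$ of the boundary Jordan curve such that $\varphi$ does not have a homeomorphic $W^{1,1}$-extension.
   Context: $\mathbb{D}$ is the open unit disk in $\mathbb{C}$. A Jordan domain is the bounded (interior) domain $\Omega$ bounded by a Jordan curve, i.e. by the image of a homeomorphic embedding of $\partial\mathbb{D}$ into $\mathbb{C}$. A homeomorphic parametrization of $\partial\Omega$ is a homeomorphism $\varphi:\partial\mathbb{D}\to\partial\Omega$. A homeomorphic $W^{1,1}$-extension of $\varphi$ is a homeomorphism $\Phi:\overline{\mathbb{D}}\to\overline{\Omega}$ with $\Phi|_{\partial\mathbb{D}}=\varphi$ and $\Phi|_{\mathbb{D}}\in W^{1,1}(\mathbb{D},\mathbb{C})$. For $x,y\in\overline{\Omega}$, the internal distance is $d_I(x,y)=\inf_{\gamma}\ell(\gamma)$, the infimum of Euclidean lengths over all rectifiable curves $\gamma$ in $\Omega$ connecting $x$ and $y$ (lying in $\Omega$ except possibly for the endpoints, when these are on $\partial\Omega$), with $\inf\emptyset=\infty$. The internal diameter is $\operatorname{diam}_I(\Omega)=\sup_{x,y\in\partial\Omega}d_I(x,y)\in[0,\infty]$. *)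

theory Defs
  imports "HOL-Analysis.Analysis"
begin

definition Jordan_curve_set :: "complex set \<Rightarrow> bool" where
  "Jordan_curve_set J \<longleftrightarrow> (\<exists>f g. homeomorphism (sphere (0::complex) 1) J f g)"

definition Jordan_domain :: "complex set \<Rightarrow> bool" where
  "Jordan_domain \<Omega> \<longleftrightarrow> (\<exists>J. Jordan_curve_set J \<and> \<Omega> = inside J)"

text \<open>Total variation over \<open>[0,1]\<close>. The list \<open>ts\<close> holds partition points; repeated points
  contribute nothing, and lists that do not contain 0 and 1 do not change the supremum.\<close>

definition path_length :: "(real \<Rightarrow> 'a::metric_space) \<Rightarrow> ennreal" where
  "path_length \<gamma> = (SUP ts \<in> {ts. sorted ts \<and> set ts \<subseteq> {0..1}}.
      ennreal (\<Sum>i<length ts - 1. dist (\<gamma> (ts ! i)) (\<gamma> (ts ! Suc i))))"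

definition rectifiable :: "(real \<Rightarrow> 'a::metric_space) \<Rightarrow> bool" where
  "rectifiable \<gamma> \<longleftrightarrow> path \<gamma> \<and> path_length \<gamma> < \<infinity>"

text \<open>The endpoints are the only points of the curve that may lie outside \<open>\<Omega>\<close>. The constant
  curve at a boundary point is admitted, so that \<open>d\<^sub>I(x,x) = 0\<close> there too. The infimum is taken
  in \<^typ>\<open>ennreal\<close>, hence is \<open>\<infinity>\<close> over the empty set.\<close>

definition internal_dist :: "complex set \<Rightarrow> complex \<Rightarrow> complex \<Rightarrow> ennreal" where
  "internal_dist \<Omega> x y = (INF \<gamma> \<in> {\<gamma>. rectifiable \<gamma> \<and> pathstart \<gamma> = x \<and> pathfinish \<gamma> = y \<and>
      path_image \<gamma> \<subseteq> \<Omega> \<union> {x, y}}. path_length \<gamma>)"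

definition internal_diameter :: "complex set \<Rightarrow> ennreal" where
  "internal_diameter \<Omega> = (SUP x \<in> frontier \<Omega>. SUP y \<in> frontier \<Omega>. internal_dist \<Omega> x y)"

primrec Ck :: "nat \<Rightarrow> ('a::euclidean_space \<Rightarrow> real) \<Rightarrow> bool" where
  "Ck 0 \<eta> \<longleftrightarrow> continuous_on UNIV \<eta>"
| "Ck (Suc k) \<eta> \<longleftrightarrow> (\<forall>x. \<eta> differentiable (at x)) \<and>
     (\<forall>v. Ck k (\<lambda>x. frechet_derivative \<eta> (at x) v))"

definition test_function :: "'a::euclidean_space set \<Rightarrow> ('a \<Rightarrow> real) \<Rightarrow> bool" where
  "test_function U \<eta> \<longleftrightarrow> (\<forall>k. Ck k \<eta>) \<and>
     compact (closure {x. \<eta> x \<noteq> 0}) \<and> closure {x. \<eta> x \<noteq> 0} \<subseteq> U"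

text \<open>\<open>g\<close> is the weak partial derivative of \<open>f\<close> in direction \<open>b\<close>; only meaningful when
  \<open>f\<close> and \<open>g\<close> are locally integrable on \<open>U\<close>, since otherwise the Bochner integral
  defaults to 0.\<close>

definition weak_partial_derivative ::
  "'a::euclidean_space set \<Rightarrow> 'a \<Rightarrow> ('a \<Rightarrow> 'b::euclidean_space) \<Rightarrow> ('a \<Rightarrow> 'b) \<Rightarrow> bool" where
  "weak_partial_derivative U b f g \<longleftrightarrow> (\<forall>\<eta>. test_function U \<eta> \<longrightarrow>
     (LINT x:U|lebesgue. frechet_derivative \<eta> (at x) b *\<^sub>R f x) =
     - (LINT x:U|lebesgue. \<eta> x *\<^sub>R g x))"

definition sobolev_W11 :: "'a::euclidean_space set \<Rightarrow> ('a \<Rightarrow> 'b::euclidean_space) \<Rightarrow> bool" where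
  "sobolev_W11 U f \<longleftrightarrow> f absolutely_integrable_on U \<and>
     (\<forall>b\<in>Basis. \<exists>g. g absolutely_integrable_on U \<and> weak_partial_derivative U b f g)"

definition boundary_parametrization :: "complex set \<Rightarrow> (complex \<Rightarrow> complex) \<Rightarrow> bool" where
  "boundary_parametrization \<Omega> \<phi> \<longleftrightarrow> (\<exists>\<psi>. homeomorphism (sphere 0 1) (frontier \<Omega>) \<phi> \<psi>)"

definition homeomorphic_W11_extension ::
  "complex set \<Rightarrow> (complex \<Rightarrow> complex) \<Rightarrow> (complex \<Rightarrow> complex) \<Rightarrow> bool" where
  "homeomorphic_W11_extension \<Omega> \<phi> \<Phi> \<longleftrightarrow>
     (\<exists>\<Psi>. homeomorphism (cball 0 1) (closure \<Omega>) \<Phi> \<Psi>) \<and>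
     (\<forall>z\<in>sphere 0 1. \<Phi> z = \<phi> z) \<and>
     sobolev_W11 (ball 0 1) \<Phi>"

end

theory Submission
  imports Defs
begin

text \<open>
  Suppose that every boundary parametrization has a homeomorphic \<open>W\<^sup>1\<^sup>,\<^sup>1\<close>-extension. A single
  extension already identifies the closure of \<open>\<Omega>\<close> with the closed disk, so that the
  Schoenflies theorem is not needed. Fix \<open>z\<close> in \<open>\<Omega>\<close>, and call a boundary point \<open>x\<close> \<open>K\<close>-far if
  all points of \<open>\<Omega>\<close> near \<open>x\<close> have internal distance more than \<open>K\<close> from \<open>z\<close>.

  If \<open>x\<close> is not \<open>K\<close>-far, then its internal distance from \<open>z\<close> is at most \<open>2K + 11\<close>: small
  circles around \<open>x\<close> contain arcs \<open>A\<^sub>j\<close> in \<open>\<Omega>\<close> that separate \<open>z\<close> from \<open>x\<close>, one behind the other, so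
  the internal distances from \<open>z\<close> to \<open>A\<^sub>j\<close> increase and are bounded by \<open>K\<close>. Almost shortest
  curves from \<open>A\<^sub>j\<close> to \<open>A\<^sub>j\<^sub>+\<^sub>1\<close>, joined along the short arcs \<open>A\<^sub>j\<close>, form a curve of finite length
  ending at \<open>x\<close>. Hence infinite internal diameter forces \<open>K\<close>-far boundary points for all \<open>K\<close>, and
  being \<open>K\<close>-far is an open condition.

  For a \<open>W\<^sup>1\<^sup>,\<^sup>1\<close>-extension \<open>\<Phi>\<close>, the images of almost all vertical segments have finite length,
  and this length is an integrable function of the abscissa. A parametrization that spends
  an interval of length \<open>2\<^sup>-\<^sup>n/8\<close> on \<open>8n2\<^sup>n\<close>-far points makes the integral at least \<open>n - O(1)\<close> for
  every \<open>n\<close>.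
\<close>

section \<open>Lengths of curves\<close>

text \<open>Curves of length at most K whose ends approach x have limits only in the closure of
  \<Omega>, where they may touch the frontier midway. This is the obstacle behind the bound 2K + 11:
  the arcs A_j replace the limit by a concatenation of curves that stay in \<Omega>. Lengths of
  vertical segments are controlled only for almost every abscissa, so a single boundary point,
  however far, contradicts nothing; openness of farness supplies whole intervals. The far points for
  different K may be scattered over the circle, but they accumulate somewhere, and a rotation moves
  the accumulation point to \<i>. All the intervals then lie on a short arc on top of the disk,
  which the vertical segments reach. The intervals may be arbitrarily short, so they are stretched
  to lengths 2^-n/8, which have a finite sum; the distance 8n2^n is n divided by this length. The
  weak derivative enters through products of a function of the abscissa and a function of the
  ordinate: by Fubini, varying the first factor leaves a one-dimensional identity on almost every
  vertical line.\<close>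

fun partition_sum :: "(real \<Rightarrow> 'a::metric_space) \<Rightarrow> real list \<Rightarrow> real" where
  "partition_sum p [] = 0"
| "partition_sum p [t] = 0"
| "partition_sum p (s # t # ts) = dist (p s) (p t) + partition_sum p (t # ts)"

lemma sum_dist_eq_partition_sum:
  "(\<Sum>i<length ts - 1. dist (p (ts ! i)) (p (ts ! Suc i))) = partition_sum p ts"
proof (induction p ts rule: partition_sum.induct)
  case (3 p s t ts)
  then show ?case by (simp add: sum.lessThan_Suc_shift del: sum.lessThan_Suc)
qed auto

lemma partition_sum_append: "partition_sum p (xs @ b # ys) = partition_sum p (xs @ [b]) + partition_sum p (b # ys)"
proof (induction p xs rule: partition_sum.induct)
  case (2 p t)
  then show ?case by simp
qed auto

lemma partition_sum_Cons_le: "partition_sum p ys \<le> partition_sum p (b # ys)"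
  by (cases ys) auto

text \<open>The triangle inequality: refining a partition never lowers its sum.\<close>

lemma partition_sum_insert_le: "partition_sum p (xs @ ys) \<le> partition_sum p (xs @ b # ys)"
proof (induction p xs rule: partition_sum.induct)
  case (1 p)
  then show ?case by (simp add: partition_sum_Cons_le)
next
  case (2 p t)
  show ?case
  proof (cases ys)
    case (Cons y zs)
    then show ?thesis by (simp add: dist_triangle)
  qed simp
qed auto

lemma partition_sum_cong: "(\<And>t. t \<in> set ts \<Longrightarrow> p t = q t) \<Longrightarrow> partition_sum p ts = partition_sum q ts"
  by (induction p ts rule: partition_sum.induct) auto

lemma partition_sum_map: "partition_sum p (map f ts) = partition_sum (p \<circ> f) ts"
  by (induction "p \<circ> f" ts rule: partition_sum.induct) auto

lemma partition_sum_rev: "partition_sum p (rev ts) = partition_sum p ts"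
proof (induction p ts rule: partition_sum.induct)
  case (3 p s t ts)
  have "partition_sum p (rev (s # t # ts)) = partition_sum p (rev ts @ t # [s])" by simp
  also have "\<dots> = partition_sum p (rev (t # ts)) + dist (p t) (p s)"
    by (subst partition_sum_append) simp
  finally show ?case using 3 by (simp add: dist_commute)
qed auto

text \<open>An upper bound instead of a value keeps the arithmetic in the reals. The parameter
  interval is explicit so that a curve can be cut without reparametrizing the pieces.\<close>

definition length_le :: "(real \<Rightarrow> 'a::metric_space) \<Rightarrow> real \<Rightarrow> real \<Rightarrow> real \<Rightarrow> bool" where
  "length_le p a b L \<longleftrightarrow> (\<forall>ts. sorted ts \<and> set ts \<subseteq> {a..b} \<longrightarrow> partition_sum p ts \<le> L)"

lemma length_leD: "length_le p a b L \<Longrightarrow> sorted ts \<Longrightarrow> set ts \<subseteq> {a..b} \<Longrightarrow> partition_sum p ts \<le> L"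
  by (simp add: length_le_def)

lemma path_length_le_iff:
  assumes "0 \<le> L" shows "path_length p \<le> ennreal L \<longleftrightarrow> length_le p 0 1 L"
  using assms unfolding path_length_def length_le_def sum_dist_eq_partition_sum by (auto simp: SUP_le_iff)

lemma length_le_nonneg: "length_le p a b L \<Longrightarrow> 0 \<le> L"
  using length_leD[of p a b L "[]"] by simp

lemma length_le_mono: "length_le p a b L \<Longrightarrow> L \<le> L' \<Longrightarrow> length_le p a b L'"
  unfolding length_le_def by (blast intro: order_trans)

lemma length_le_dist:
  assumes "length_le p a b L" "a \<le> s" "s \<le> t" "t \<le> b"
  shows "dist (p s) (p t) \<le> L"
  using length_leD[OF assms(1), of "[s,t]"] assms(2-4) by simp

lemma length_le_reparam:
  assumes "length_le p a b L" "\<And>t. t \<in> {c..d} \<Longrightarrow> f t \<in> {a..b}"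
    and "\<And>s t. s \<in> {c..d} \<Longrightarrow> t \<in> {c..d} \<Longrightarrow> s \<le> t \<Longrightarrow> f s \<le> f t"
    and "\<And>t. t \<in> {c..d} \<Longrightarrow> q t = p (f t)"
  shows "length_le q c d L"
  unfolding length_le_def
proof safe
  fix ts :: "real list" assume ts: "sorted ts" "set ts \<subseteq> {c..d}"
  have "sorted (map f ts)"
    unfolding sorted_map using ts assms(3)
    by (intro sorted_wrt_mono_rel[OF _ ts(1)]) (auto simp: subset_iff)
  then have "partition_sum p (map f ts) \<le> L"
    using assms(2) ts by (intro length_leD[OF assms(1)]) auto
  also have "partition_sum p (map f ts) = partition_sum q ts"
    unfolding partition_sum_map using ts assms(4) by (intro partition_sum_cong) auto
  finally show "partition_sum q ts \<le> L" .
qed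

lemma length_le_reparam_anti:
  assumes "length_le p a b L" "\<And>t. t \<in> {c..d} \<Longrightarrow> f t \<in> {a..b}"
    and "\<And>s t. s \<in> {c..d} \<Longrightarrow> t \<in> {c..d} \<Longrightarrow> s \<le> t \<Longrightarrow> f t \<le> f s"
    and "\<And>t. t \<in> {c..d} \<Longrightarrow> q t = p (f t)"
  shows "length_le q c d L"
  unfolding length_le_def
proof safe
  fix ts :: "real list" assume ts: "sorted ts" "set ts \<subseteq> {c..d}"
  have "sorted (rev (map f ts))"
    unfolding sorted_wrt_rev sorted_wrt_map using ts assms(3)
    by (intro sorted_wrt_mono_rel[OF _ ts(1)]) (auto simp: subset_iff)
  then have "partition_sum p (rev (map f ts)) \<le> L"
    using assms(2) ts by (intro length_leD[OF assms(1)]) auto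
  also have "partition_sum p (rev (map f ts)) = partition_sum q ts"
    unfolding partition_sum_rev partition_sum_map using ts assms(4) by (intro partition_sum_cong) auto
  finally show "partition_sum q ts \<le> L" .
qed

lemma length_le_cong:
  "length_le p a b L \<Longrightarrow> (\<And>t. t \<in> {a..b} \<Longrightarrow> q t = p t) \<Longrightarrow> length_le q a b L"
  by (rule length_le_reparam[where f="\<lambda>t. t" and a=a and b=b]) auto

text \<open>Inserting the cut point \<open>b\<close> can only raise a partition sum, and afterwards
  the sum splits at \<open>b\<close>.\<close>

lemma length_le_combine:
  assumes "length_le p a b L1" "length_le p b c L2" "a \<le> b" "b \<le> c"
  shows "length_le p a c (L1 + L2)"
  unfolding length_le_def
proof safe
  fix ts :: "real list" assume ts: "sorted ts" "set ts \<subseteq> {a..c}"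
  define xs where "xs = takeWhile (\<lambda>t. t \<le> b) ts"
  define ys where "ys = dropWhile (\<lambda>t. t \<le> b) ts"
  have eq: "ts = xs @ ys" by (simp add: xs_def ys_def)
  have xsb: "\<forall>t\<in>set xs. t \<le> b" by (auto simp: xs_def dest: set_takeWhileD)
  have sor: "sorted xs" "sorted ys" using ts(1) eq by (auto simp: sorted_append)
  have ysb: "\<forall>t\<in>set ys. b \<le> t"
  proof (cases ys)
    case (Cons y zs)
    then have "\<not> y \<le> b" using hd_dropWhile[of "\<lambda>t. t \<le> b" ts] by (simp add: ys_def)
    then show ?thesis using sor(2) Cons by fastforce
  qed simp
  have "partition_sum p ts \<le> partition_sum p (xs @ b # ys)" unfolding eq by (rule partition_sum_insert_le)
  also have "\<dots> = partition_sum p (xs @ [b]) + partition_sum p (b # ys)" by (rule partition_sum_append)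
  also have "\<dots> \<le> L1 + L2"
  proof (rule add_mono)
    show "partition_sum p (xs @ [b]) \<le> L1"
      using assms(3,4) xsb sor ts(2) unfolding eq
      by (intro length_leD[OF assms(1)]) (auto simp: sorted_append subset_iff)
    show "partition_sum p (b # ys) \<le> L2"
      using assms(3,4) ysb sor ts(2) unfolding eq
      by (intro length_leD[OF assms(2)]) (auto simp: subset_iff)
  qed
  finally show "partition_sum p ts \<le> L1 + L2" .
qed

text \<open>The witness is the exact variation \<open>Sup V\<close> of the first piece. A partition
  of each piece, joined through \<open>b\<close>, is a partition of the whole, so what the first
  piece uses up is no longer available to the second.\<close>

lemma length_le_split:
  assumes "length_le p a c L" "a \<le> b" "b \<le> c"
  obtains L1 where "length_le p a b L1" "length_le p b c (L - L1)"
proof -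
  define V where "V = {partition_sum p ts | ts. sorted ts \<and> set ts \<subseteq> {a..b}}"
  have "partition_sum p [] \<in> V" unfolding V_def by (intro CollectI exI[of _ "[]"]) simp
  then have ne: "V \<noteq> {}" by blast
  have key: "partition_sum p xs + partition_sum p ys \<le> L"
    if "sorted xs" "set xs \<subseteq> {a..b}" "sorted ys" "set ys \<subseteq> {b..c}" for xs ys
  proof -
    have "partition_sum p xs + partition_sum p ys \<le> partition_sum p (xs @ [b]) + partition_sum p (b # ys)"
      using partition_sum_insert_le[of p xs "[]" b] partition_sum_Cons_le[of p ys b] by simp
    also have "\<dots> = partition_sum p (xs @ b # ys)" by (rule partition_sum_append[symmetric])
    also have "\<dots> \<le> L"
    proof (rule length_leD[OF assms(1)])
      have "\<forall>x\<in>set xs. a \<le> x \<and> x \<le> b" "\<forall>y\<in>set ys. b \<le> y \<and> y \<le> c"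
        using that by auto
      then show "sorted (xs @ b # ys)" "set (xs @ b # ys) \<subseteq> {a..c}"
        using that assms(2,3) by (auto simp: sorted_append intro: order_trans)
    qed
    finally show ?thesis .
  qed
  have bdd: "bdd_above V"
    using key[of _ "[]"] by (auto simp: V_def intro!: bdd_aboveI[of _ L])
  show ?thesis
  proof
    show "length_le p a b (Sup V)"
      unfolding length_le_def using bdd by (auto simp: V_def intro!: cSup_upper)
    show "length_le p b c (L - Sup V)"
      unfolding length_le_def
    proof safe
      fix ys assume ys: "sorted ys" "set ys \<subseteq> {b..c}"
      have "Sup V \<le> L - partition_sum p ys"
        using ne key[OF _ _ ys] by (intro cSup_least) (auto simp: V_def algebra_simps)
      then show "partition_sum p ys \<le> L - Sup V" by simp
    qed
  qed
qed

text \<open>The increments of the majorant \<open>f\<close> telescope. Below, \<open>f\<close> is a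
  multiple of the parameter for segments and circular arcs, and an indefinite integral for vertical
  lines.\<close>

lemma length_le_lipschitz:
  assumes "\<And>s t. a \<le> s \<Longrightarrow> s \<le> t \<Longrightarrow> t \<le> b \<Longrightarrow> dist (p s) (p t) \<le> f t - f s"
    and "mono_on {a..b} f" "a \<le> b"
  shows "length_le p a b (f b - f a)"
  unfolding length_le_def
proof safe
  fix ts :: "real list" assume ts: "sorted ts" "set ts \<subseteq> {a..b}"
  \<comment> \<open>Starting the telescope at the head of the list is what lets the list induction
    go through.\<close>
  have *: "ts \<noteq> [] \<Longrightarrow> partition_sum p ts \<le> f b - f (hd ts)"
    using ts
  proof (induction ts rule: induct_list012)
    case (2 t)
    then show ?case using assms by (auto intro: mono_onD)
  next
    case (3 s t ts)
    then have "partition_sum p (t # ts) \<le> f b - f t" by auto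
    moreover have "dist (p s) (p t) \<le> f t - f s"
      by (rule assms(1)) (use "3.prems"(2,3) in auto)
    ultimately show ?case by simp
  qed simp
  show "partition_sum p ts \<le> f b - f a"
  proof (cases "ts = []")
    case True
    then show ?thesis using assms by (auto intro: mono_onD)
  next
    case False
    have "hd ts \<in> {a..b}" using hd_in_set[OF False] ts(2) by blast
    then have "f a \<le> f (hd ts)" by (intro mono_onD[OF assms(2)]) auto
    then show ?thesis using *[OF False] by simp
  qed
qed

text \<open>Internal distance at most \<open>L\<close>, with the bound attained by a curve. Since
  \<Omega> is an arbitrary set here, curves ending on the frontier are covered by inserting their
  endpoints into it.\<close>

definition joinable :: "'a::metric_space set \<Rightarrow> real \<Rightarrow> 'a \<Rightarrow> 'a \<Rightarrow> bool" where
  "joinable \<Omega> L x y \<longleftrightarrow> (\<exists>p. path p \<and> path_image p \<subseteq> \<Omega> \<and> pathstart p = x \<and> pathfinish p = y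
     \<and> length_le p 0 1 L)"

lemma joinable_mono: "joinable \<Omega> L x y \<Longrightarrow> \<Omega> \<subseteq> \<Omega>' \<Longrightarrow> L \<le> L' \<Longrightarrow> joinable \<Omega>' L' x y"
  unfolding joinable_def using length_le_mono by blast

lemma joinable_nonneg: "joinable \<Omega> L x y \<Longrightarrow> 0 \<le> L"
  unfolding joinable_def using length_le_nonneg by blast

lemma joinable_interval:
  assumes "continuous_on {a..b} p" "p ` {a..b} \<subseteq> \<Omega>" "a \<le> b" "length_le p a b L"
  shows "joinable \<Omega> L (p a) (p b)"
  unfolding joinable_def
proof (intro exI conjI)
  let ?f = "\<lambda>t. a + t * (b - a)"
  have im: "?f t \<in> {a..b}" if "t \<in> {0..1}" for t
    using that assms(3) mult_left_le_one_le[of "b - a" t] by auto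
  show "path (p \<circ> ?f)" unfolding path_def
    by (intro continuous_on_compose continuous_intros continuous_on_subset[OF assms(1)])
       (use im in auto)
  show "path_image (p \<circ> ?f) \<subseteq> \<Omega>" unfolding path_image_def using im assms(2) by force
  show "pathstart (p \<circ> ?f) = p a" "pathfinish (p \<circ> ?f) = p b"
    by (auto simp: pathstart_def pathfinish_def)
  show "length_le (p \<circ> ?f) 0 1 L"
    using im assms(3) by (intro length_le_reparam[OF assms(4), where f = ?f]) (auto intro!: mult_right_mono)
qed

lemma joinable_sym: "joinable \<Omega> L x y \<Longrightarrow> joinable \<Omega> L y x"
  unfolding joinable_def
proof (elim exE conjE)
  fix p assume p: "path p" "path_image p \<subseteq> \<Omega>" "pathstart p = x" "pathfinish p = y" "length_le p 0 1 L"
  have "length_le (reversepath p) 0 1 L"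
    by (rule length_le_reparam_anti[OF p(5), where f = "\<lambda>t. 1 - t"]) (auto simp: reversepath_def)
  then show "\<exists>p. path p \<and> path_image p \<subseteq> \<Omega> \<and> pathstart p = y \<and> pathfinish p = x \<and> length_le p 0 1 L"
    using p by (intro exI[of _ "reversepath p"]) auto
qed

lemma length_le_joinpaths:
  assumes "length_le p 0 1 L1" "length_le q 0 1 L2" "pathfinish p = pathstart q"
  shows "length_le (p +++ q) 0 1 (L1 + L2)"
proof (rule length_le_combine)
  show "length_le (p +++ q) 0 (1/2) L1"
    by (rule length_le_reparam[OF assms(1), where f = "\<lambda>t. 2 * t"]) (auto simp: joinpaths_def)
  show "length_le (p +++ q) (1/2) 1 L2"
  proof (rule length_le_reparam[OF assms(2), where f = "\<lambda>t. 2 * t - 1"])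
    fix t :: real assume t: "t \<in> {1/2..1}"
    show "(p +++ q) t = q (2 * t - 1)"
    proof (cases "t = 1/2")
      case True
      show ?thesis unfolding True using assms(3) by (simp add: joinpaths_def pathstart_def pathfinish_def)
    qed (use t in \<open>simp add: joinpaths_def\<close>)
  qed auto
qed auto

lemma joinable_trans:
  assumes "joinable \<Omega> L1 x y" "joinable \<Omega> L2 y z"
  shows "joinable \<Omega> (L1 + L2) x z"
proof -
  obtain p q where "path p" "path_image p \<subseteq> \<Omega>" "pathstart p = x" "pathfinish p = y" "length_le p 0 1 L1"
    "path q" "path_image q \<subseteq> \<Omega>" "pathstart q = y" "pathfinish q = z" "length_le q 0 1 L2"
    using assms unfolding joinable_def by blast
  then show ?thesis unfolding joinable_def
    by (intro exI[of _ "p +++ q"]) (auto intro: length_le_joinpaths path_join_imp simp: path_image_join)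
qed

lemma joinable_linepath:
  fixes x y :: "'a::real_normed_vector"
  assumes "closed_segment x y \<subseteq> \<Omega>"
  shows "joinable \<Omega> (dist x y) x y"
  unfolding joinable_def
proof (intro exI conjI)
  have "length_le (linepath x y) 0 1 (1 * dist x y - 0 * dist x y)"
  proof (rule length_le_lipschitz)
    fix s t :: real assume "s \<le> t"
    have "linepath x y s - linepath x y t = (t - s) *\<^sub>R (x - y)"
      by (simp add: linepath_def algebra_simps)
    then have "dist (linepath x y s) (linepath x y t) = \<bar>t - s\<bar> * dist x y"
      by (simp add: dist_norm)
    then show "dist (linepath x y s) (linepath x y t) \<le> t * dist x y - s * dist x y"
      using \<open>s \<le> t\<close> by (simp add: algebra_simps)
  qed (auto intro!: mono_onI mult_right_mono)
  then show "length_le (linepath x y) 0 1 (dist x y)" by simp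
qed (use assms in auto)

lemma joinable_Un_internal_dist:
  assumes "joinable (\<Omega> \<union> {x, y}) L x y" shows "internal_dist \<Omega> x y \<le> ennreal L"
proof -
  obtain p where p: "path p" "path_image p \<subseteq> \<Omega> \<union> {x, y}" "pathstart p = x" "pathfinish p = y" "length_le p 0 1 L"
    using assms unfolding joinable_def by blast
  then have l: "path_length p \<le> ennreal L" using path_length_le_iff length_le_nonneg by blast
  then have "rectifiable p" using p by (auto simp: rectifiable_def intro: le_less_trans)
  then show ?thesis unfolding internal_dist_def using p l by (intro INF_lower2[of p]) auto
qed

text \<open>Nearby points are joined by segments in balls, connectedness makes every distance from
  \<open>z\<close> finite, and a finite subcover makes the bound uniform on
  \<open>K\<close>.\<close>

lemma joinable_bounded_on_compact:
  fixes \<Omega> :: "'a::euclidean_space set"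
  assumes "open \<Omega>" "connected \<Omega>" "compact K" "K \<subseteq> \<Omega>" "z \<in> \<Omega>"
  obtains L where "\<And>q. q \<in> K \<Longrightarrow> joinable \<Omega> L z q"
proof -
  have loc: "\<exists>e>0. ball a e \<subseteq> \<Omega> \<and> (\<forall>b\<in>ball a e. joinable \<Omega> e a b)" if a: "a \<in> \<Omega>" for a
  proof -
    obtain e where e: "e > 0" "ball a e \<subseteq> \<Omega>" using assms(1) a open_contains_ball by blast
    have "joinable \<Omega> e a b" if "b \<in> ball a e" for b
    proof (rule joinable_mono[OF joinable_linepath[of a b \<Omega>]])
      have "closed_segment a b \<subseteq> ball a e"
        using e(1) that by (intro closed_segment_subset) auto
      then show "closed_segment a b \<subseteq> \<Omega>" using e(2) by blast
    qed (use that in auto)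
    then show ?thesis using e by blast
  qed
  have fin: "\<exists>L. joinable \<Omega> L z q" if "q \<in> \<Omega>" for q
  proof (rule connected_equivalence_relation[OF assms(2) assms(5) that, of "\<lambda>x y. \<exists>L. joinable \<Omega> L x y"])
    fix a assume "a \<in> \<Omega>"
    then obtain e where "e > 0" "ball a e \<subseteq> \<Omega>" "\<forall>b\<in>ball a e. joinable \<Omega> e a b" using loc by blast
    then show "\<exists>T. openin (top_of_set \<Omega>) T \<and> a \<in> T \<and> (\<forall>x\<in>T. \<exists>L. joinable \<Omega> L a x)"
      by (intro exI[of _ "ball a e"]) (auto intro!: open_subset)
  next
    fix x y assume "\<exists>L. joinable \<Omega> L x y"
    then show "\<exists>L. joinable \<Omega> L y x" using joinable_sym by metis
  next
    fix x y w assume "\<exists>L. joinable \<Omega> L x y" "\<exists>L. joinable \<Omega> L y w"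
    then show "\<exists>L. joinable \<Omega> L x w" using joinable_trans by metis
  qed
  have "\<forall>a\<in>K. \<exists>e L. e > 0 \<and> (\<forall>b\<in>ball a e. joinable \<Omega> L z b)"
  proof
    fix a assume "a \<in> K"
    then have a: "a \<in> \<Omega>" using assms by auto
    obtain e L where "e > 0" "\<forall>b\<in>ball a e. joinable \<Omega> e a b" "joinable \<Omega> L z a"
      using loc[OF a] fin[OF a] by blast
    then show "\<exists>e L. e > 0 \<and> (\<forall>b\<in>ball a e. joinable \<Omega> L z b)"
      using joinable_trans by (intro exI[of _ e] exI[of _ "L + e"]) blast
  qed
  then obtain e L where eL: "\<And>a. a \<in> K \<Longrightarrow> e a > 0" "\<And>a b. a \<in> K \<Longrightarrow> b \<in> ball a (e a) \<Longrightarrow> joinable \<Omega> (L a) z b"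
    by metis
  have "K \<subseteq> (\<Union>c\<in>K. ball c (e c))" using eL(1) by force
  then obtain D where D: "D \<subseteq> K" "finite D" "K \<subseteq> (\<Union>c\<in>D. ball c (e c))"
    by (rule compactE_image[OF assms(3), of K "\<lambda>a. ball a (e a)", rotated]) auto
  show ?thesis
  proof
    fix q assume "q \<in> K"
    then obtain c where c: "c \<in> D" "q \<in> ball c (e c)" using D by blast
    then have "joinable \<Omega> (L c) z q" using eL D by blast
    moreover have "L c \<le> Max (insert 0 (L ` D))" using c D by simp
    ultimately show "joinable \<Omega> (Max (insert 0 (L ` D))) z q" using joinable_mono by blast
  qed
qed

text \<open>Cutting off with \<open>min s\<close> moves a partition into the interval up to
  \<open>s\<close>. For \<open>s\<close> close to \<open>c\<close> only the points equal to
  \<open>c\<close> move, and there left continuity applies.\<close>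

lemma tendsto_partition_sum_min:
  assumes "continuous (at_left c) p" and ts: "\<And>t. t \<in> set ts \<Longrightarrow> t \<le> (c::real)"
  shows "((\<lambda>s. partition_sum p (map (min s) ts)) \<longlongrightarrow> partition_sum p ts) (at_left c)"
  using ts
proof (induction ts rule: induct_list012)
  case (3 a b ts)
  have *: "((\<lambda>s. p (min s t)) \<longlongrightarrow> p t) (at_left c)" if "t \<le> c" for t
  proof (cases "t = c")
    case True
    have "\<forall>\<^sub>F s in at_left c. p s = p (min s t)"
      unfolding True eventually_at_left_field by (intro exI[of _ "c - 1"]) auto
    then show ?thesis using assms(1) unfolding True continuous_within
      by (rule Lim_transform_eventually[rotated])
  next
    case False
    then have "\<forall>\<^sub>F s in at_left c. p (min s t) = p t"
      unfolding eventually_at_left_field using that by (intro exI[of _ t]) auto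
    then show ?thesis by (rule tendsto_eventually)
  qed
  show ?case using 3 by (auto intro!: tendsto_add tendsto_dist *)
qed auto

lemma length_le_left_limit:
  fixes p :: "real \<Rightarrow> 'a::metric_space"
  assumes "continuous (at_left b) p" "a < b" "\<And>s. a \<le> s \<Longrightarrow> s < b \<Longrightarrow> length_le p a s L"
  shows "length_le p a b L"
  unfolding length_le_def
proof safe
  fix ts :: "real list" assume ts: "sorted ts" "set ts \<subseteq> {a..b}"
  have "((\<lambda>s. partition_sum p (map (min s) ts)) \<longlongrightarrow> partition_sum p ts) (at_left b)"
    using ts by (intro tendsto_partition_sum_min assms(1)) auto
  moreover have "\<forall>\<^sub>F s in at_left b. partition_sum p (map (min s) ts) \<le> L"
    unfolding eventually_at_left_field
  proof (intro exI conjI allI impI)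
    fix s assume s: "a < s" "s < b"
    have "sorted (map (min s) ts)" unfolding sorted_map
      by (rule sorted_wrt_mono_rel[OF _ ts(1)]) auto
    then show "partition_sum p (map (min s) ts) \<le> L"
      using s ts(2) by (intro length_leD[OF assms(3)[of s]]) auto
  qed (rule assms(2))
  ultimately show "partition_sum p ts \<le> L" by (rule tendsto_upperbound) simp
qed

lemma length_le_refl: "length_le p a a 0"
proof -
  have "set ts \<subseteq> {a} \<Longrightarrow> partition_sum p ts = 0" for ts
    by (induction ts rule: induct_list012) auto
  then show ?thesis by (simp add: length_le_def)
qed

text \<open>The curves are concatenated over the half-line and compressed to the unit interval. The
  tails of the series bound the distance of the later curve from \<open>a n\<close>, so it converges
  to \<open>x\<close>; the length passes to the limit by left continuity.\<close>

lemma joinable_sequence_limit: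
  fixes a :: "nat \<Rightarrow> 'a::metric_space"
  assumes join: "\<And>j. joinable \<Omega> (l j) (a j) (a (Suc j))" and l: "summable l" and lim: "a \<longlonglongrightarrow> x"
  shows "joinable (insert x \<Omega>) (suminf l) (a 0) x"
proof -
  obtain p where p: "\<And>j. path (p j)" "\<And>j. path_image (p j) \<subseteq> \<Omega>" "\<And>j. p j 0 = a j"
      "\<And>j. p j 1 = a (Suc j)" "\<And>j. length_le (p j) 0 1 (l j)"
    using join unfolding joinable_def pathstart_def pathfinish_def by metis
  have l0: "l j \<ge> 0" for j using p(5) length_le_nonneg by blast
  \<comment> \<open>Piece \<open>p j\<close> occupies the interval from \<open>j\<close> to
    \<open>j + 1\<close>. At the integers consecutive pieces agree, so \<open>P_eq\<close> holds on
    closed intervals.\<close>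
  define P where "P t = p (nat \<lfloor>t\<rfloor>) (t - of_int \<lfloor>t\<rfloor>)" for t
  have P_eq: "P t = p n (t - real n)" if "t \<in> {real n..real (Suc n)}" for n t
  proof (cases "t = real (Suc n)")
    case True
    then show ?thesis using p(3,4) by (simp add: P_def nat_add_distrib)
  next
    case False
    then have "\<lfloor>t\<rfloor> = int n" using that by (intro floor_unique) auto
    then show ?thesis by (simp add: P_def)
  qed
  have P_len1: "length_le P (real n) (real (Suc n)) (l n)" for n
    by (rule length_le_reparam[OF p(5), where f = "\<lambda>t. t - real n"]) (use P_eq in auto)
  have P_cont1: "continuous_on {real n..real (Suc n)} P" for n
  proof (rule continuous_on_eq)
    show "continuous_on {real n..real (Suc n)} (\<lambda>t. p n (t - real n))"
      by (rule continuous_on_compose2[OF p(1)[of n, unfolded path_def]])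
         (auto intro!: continuous_intros)
  qed (use P_eq in auto)
  have P_len: "length_le P (real n) (real (n + k)) (\<Sum>i<k. l (n + i))" for n k
  proof (induction k)
    case 0
    show ?case using length_le_refl by simp
  next
    case (Suc k)
    show ?case using length_le_combine[OF Suc.IH P_len1[of "n + k"]] by simp
  qed
  have P_cont_n: "continuous_on {0..real n} P" for n
  proof (induction n)
    case (Suc n)
    have "{0..real (Suc n)} = {0..real n} \<union> {real n..real (Suc n)}" by auto
    then show ?case using Suc.IH P_cont1[of n] by (metis closed_real_atLeastAtMost continuous_on_closed_Un)
  qed auto
  have P_cont: "continuous_on {0..} P"
    unfolding continuous_on_eq_continuous_within
  proof
    fix t :: real assume t: "t \<in> {0..}"
    obtain n where n: "t < real n" using reals_Archimedean2 by blast
    have "continuous (at t within {0..real n}) P"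
      using P_cont_n[of n] t n by (simp add: continuous_on_eq_continuous_within)
    also have "at t within {0..real n} = at t within {0..}"
      by (rule at_within_nhd[of _ "{..<real n}"]) (use n in auto)
    finally show "continuous (at t within {0..}) P" .
  qed
  have tail: "dist (a n) (P t) \<le> (\<Sum>i. l (i + n))" if "real n \<le> t" for n t
  proof -
    obtain k where k: "t \<le> real k" using real_arch_simple by blast
    have "dist (P (real n)) (P t) \<le> (\<Sum>i<k. l (n + i))"
      by (rule length_le_dist[OF P_len[of n k]]) (use that k in auto)
    also have "\<dots> \<le> (\<Sum>i. l (i + n))"
      using sum_le_suminf[OF summable_ignore_initial_segment[OF l, of n], of "{..<k}"] l0
      by (simp add: add.commute)
    finally show ?thesis using P_eq[of "real n" n] p(3) by simp
  qed
  have P_lim: "(P \<longlongrightarrow> x) at_top"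
  proof (rule tendstoI)
    fix e :: real assume "e > 0"
    have "(\<lambda>n. \<Sum>i. l (i + n)) \<longlonglongrightarrow> 0" by (rule suminf_exist_split2[OF l])
    then have "\<forall>\<^sub>F n in sequentially. (\<Sum>i. l (i + n)) < e / 2"
      by (rule order_tendstoD) (use \<open>e > 0\<close> in auto)
    moreover have "\<forall>\<^sub>F n in sequentially. dist (a n) x < e / 2"
      using lim \<open>e > 0\<close> by (intro tendstoD) auto
    ultimately have "\<forall>\<^sub>F n in sequentially. (\<Sum>i. l (i + n)) < e / 2 \<and> dist (a n) x < e / 2"
      by (rule eventually_conj)
    then obtain n where n: "(\<Sum>i. l (i + n)) < e / 2" "dist (a n) x < e / 2"
      by (auto simp: eventually_sequentially)
    have "dist (P t) x < e" if "real n \<le> t" for t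
      using dist_triangle3[of "P t" x "a n"] tail[OF that] n by linarith
    then show "\<forall>\<^sub>F t in at_top. dist (P t) x < e" unfolding eventually_at_top_linorder by blast
  qed
  \<comment> \<open>An increasing map of [0,1) onto the half-line.\<close>
  define h :: "real \<Rightarrow> real" where "h t = t / (1 - t)" for t
  define \<gamma> where "\<gamma> t = (if t < 1 then P (h t) else x)" for t
  have h_mono: "h s \<le> h t" if "s \<le> t" "t < 1" for s t
    unfolding h_def using that by (simp add: divide_simps algebra_simps)
  have h_nonneg: "0 \<le> h t" if "0 \<le> t" "t < 1" for t using that by (simp add: h_def)
  have h_top: "filterlim h at_top (at_left 1)"
    unfolding h_def by real_asymp
  have \<gamma>_left: "continuous (at_left 1) \<gamma>"
  proof -
    have "((\<lambda>t. P (h t)) \<longlongrightarrow> x) (at_left 1)" by (rule filterlim_compose[OF P_lim h_top])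
    moreover have "\<forall>\<^sub>F t in at_left 1. P (h t) = \<gamma> t"
      unfolding eventually_at_left_field \<gamma>_def by (intro exI[of _ 0]) auto
    ultimately have "(\<gamma> \<longlongrightarrow> x) (at_left 1)" by (rule Lim_transform_eventually)
    moreover have "\<gamma> 1 = x" by (simp add: \<gamma>_def)
    ultimately show ?thesis by (simp add: continuous_within)
  qed
  have \<gamma>_cont: "continuous_on {0..1} \<gamma>"
    unfolding continuous_on_eq_continuous_within
  proof
    fix t :: real assume t: "t \<in> {0..1}"
    show "continuous (at t within {0..1}) \<gamma>"
    proof (cases "t = 1")
      case True
      have "at (1::real) within {0..1} = at_left 1"
        by (rule at_within_nhd[of _ "{0<..}"]) auto
      then show ?thesis using \<gamma>_left True by simp
    next
      case False
      have "continuous_on {0..<1} (\<lambda>t. P (h t))"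
        by (rule continuous_on_compose2[OF P_cont]) (use h_nonneg in \<open>auto simp: h_def intro!: continuous_intros\<close>)
      then have "continuous_on {0..<1} \<gamma>" by (rule continuous_on_eq) (auto simp: \<gamma>_def)
      then have "continuous (at t within {0..<1}) \<gamma>"
        using t False by (simp add: continuous_on_eq_continuous_within)
      also have "at t within {0..<1} = at t within {0..1}"
        by (rule at_within_nhd[of _ "{..<1}"]) (use t False in auto)
      finally show ?thesis .
    qed
  qed
  have \<gamma>_len: "length_le \<gamma> 0 1 (suminf l)"
  proof (rule length_le_left_limit[OF \<gamma>_left])
    fix s :: real assume s: "0 \<le> s" "s < 1"
    obtain k where k: "h s \<le> real k" using real_arch_simple by blast
    have "length_le P 0 (real k) (\<Sum>i<k. l i)" using P_len[of 0 k] by simp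
    then have "length_le P 0 (real k) (suminf l)"
      by (rule length_le_mono) (use sum_le_suminf[OF l, of "{..<k}"] l0 in auto)
    then show "length_le \<gamma> 0 s (suminf l)"
      by (rule length_le_reparam[where f = h])
         (use s h_mono h_nonneg k in \<open>auto simp: \<gamma>_def intro: order_trans\<close>)
  qed auto
  have im: "P t \<in> \<Omega>" if "0 \<le> t" for t
  proof -
    have "t - of_int \<lfloor>t\<rfloor> \<in> {0..1}" by (auto simp: less_imp_le) linarith
    then show ?thesis using p(2) unfolding P_def path_image_def by blast
  qed
  have "\<gamma> 0 = a 0" using P_eq[of 0 0] p(3) by (simp add: \<gamma>_def h_def)
  then show ?thesis unfolding joinable_def
    using \<gamma>_cont \<gamma>_len im h_nonneg
    by (intro exI[of _ \<gamma>]) (auto simp: path_def path_image_def pathstart_def pathfinish_def \<gamma>_def)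
qed

section \<open>Internal distance to a boundary point\<close>

text \<open>In the plane, a closed set separating two points has a component that already separates
  them. Transported through the homeomorphism of \<Omega> with the plane, this applies to the part
  of the circle inside \<Omega>. The component is a connected piece of the circle, and since
  \<open>P\<close> and \<open>N\<close> lie off the circle, separating one point of each separates
  the two sets.\<close>

lemma separating_circle_arc:
  fixes \<Omega> :: "complex set"
  assumes hom: "\<Omega> homeomorphic (UNIV :: complex set)"
    and P: "connected P" "P \<subseteq> \<Omega>" "P \<inter> cball x r = {}" "P \<noteq> {}"
    and N: "connected N" "N \<subseteq> \<Omega>" "N \<subseteq> ball x r" "N \<noteq> {}"
  obtains A where "A \<subseteq> \<Omega>" "A \<subseteq> sphere x r" "connected A"
    "\<And>T. \<lbrakk>connected T; T \<subseteq> \<Omega>; T \<inter> P \<noteq> {}; T \<inter> N \<noteq> {}\<rbrakk> \<Longrightarrow> T \<inter> A \<noteq> {}"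
proof -
  obtain f g :: "complex \<Rightarrow> complex" where fg: "homeomorphism \<Omega> UNIV f g"
    using hom unfolding homeomorphic_def by blast
  note cont = homeomorphism_cont1[OF fg] homeomorphism_cont2[OF fg]
  have gf: "g (f z) = z" if "z \<in> \<Omega>" for z using fg that by (simp add: homeomorphism_def)
  have fgz: "f (g z) = z" and gO: "g z \<in> \<Omega>" for z using fg by (auto simp: homeomorphism_def)
  define S where "S = g -` sphere x r"
  have S: "closed S"
    unfolding S_def by (intro closed_vimage) (use cont(2) in auto)
  obtain p q where p: "p \<in> P" and q: "q \<in> N" using P(4) N(4) by blast
  \<comment> \<open>The circle separates its inside from its outside: a connected set containing
    \<open>q\<close> inside and \<open>p\<close> outside meets it.\<close>
  have "\<not> connected_component (- S) (f p) (f q)"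
  proof
    assume "connected_component (- S) (f p) (f q)"
    then obtain T where T: "connected T" "T \<subseteq> - S" "f p \<in> T" "f q \<in> T"
      by (auto simp: connected_component_def)
    have "connected (g ` T)"
      by (rule connected_continuous_image[OF continuous_on_subset[OF cont(2)] T(1)]) auto
    moreover have "q \<in> g ` T" "p \<in> g ` T"
      using imageI[OF T(3), of g] imageI[OF T(4), of g] p q P(2) N(2) by (auto simp: gf subset_iff)
    moreover have "q \<in> cball x r" "p \<notin> cball x r" using p q P(3) N(3) by auto
    ultimately have "g ` T \<inter> frontier (cball x r) \<noteq> {}"
      by (intro connected_Int_frontier) auto
    then show False using T(2) by (auto simp: S_def)
  qed
  then obtain C where C: "C \<in> components S" "\<not> connected_component (- C) (f p) (f q)"
    by (rule separation_by_component_closed_pointwise[OF S])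
  have CS: "C \<subseteq> S" "connected C" using C(1) in_components_subset in_components_connected by auto
  show ?thesis
  proof
    show "g ` C \<subseteq> \<Omega>" using gO by blast
    show "g ` C \<subseteq> sphere x r" using CS by (auto simp: S_def)
    show "connected (g ` C)"
      by (rule connected_continuous_image[OF continuous_on_subset[OF cont(2)] CS(2)]) auto
    fix T assume T: "connected T" "T \<subseteq> \<Omega>" "T \<inter> P \<noteq> {}" "T \<inter> N \<noteq> {}"
    show "T \<inter> g ` C \<noteq> {}"
    proof
      assume 0: "T \<inter> g ` C = {}"
      \<comment> \<open>If \<open>T\<close> missed the component, this union would connect
        \<open>p\<close> to \<open>q\<close> off it.\<close>
      have con: "connected (P \<union> T \<union> N)"
        using T P(1) N(1) by (intro connected_Un) auto
      have "g c \<in> sphere x r" if "c \<in> C" for c using CS that by (auto simp: S_def)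
      then have "g c \<notin> P \<union> T \<union> N" if "c \<in> C" for c
        using P(3) N(3) 0 that by fastforce
      then have "f ` (P \<union> T \<union> N) \<subseteq> - C"
        using gf P(2) N(2) T(2) by fastforce
      moreover have "connected (f ` (P \<union> T \<union> N))"
        using P(2) N(2) T(2)
        by (intro connected_continuous_image[OF continuous_on_subset[OF cont(1)] con]) auto
      ultimately show False using C(2) p q unfolding connected_component_def by blast
    qed
  qed
qed

text \<open>The chord has length 2|sin w|, where w is half the angle, and |sin w| \<le> |w|.\<close>

lemma norm_cis_diff_le: "norm (cis y - cis z) \<le> \<bar>y - z\<bar>"
proof -
  define w where "w = (y - z) / 2"
  have yz: "y - z = 2 * w" by (simp add: w_def)
  have "cis y - cis z = cis z * (cis (y - z) - 1)" by (simp add: algebra_simps cis_mult)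
  then have "(norm (cis y - cis z))\<^sup>2 = (norm (cis (y - z) - 1))\<^sup>2" by (simp add: norm_mult)
  also have "\<dots> = (cos (2 * w) - 1)\<^sup>2 + (sin (2 * w))\<^sup>2" unfolding yz by (simp add: cmod_power2)
  also have "\<dots> = 2 - 2 * cos (2 * w)"
    using sin_cos_squared_add[of "2 * w"] by (simp add: power2_diff)
  also have "\<dots> = (2 * sin w)\<^sup>2" unfolding cos_double_sin by (simp add: power_mult_distrib)
  also have "\<dots> \<le> (y - z)\<^sup>2"
    using abs_sin_x_le_abs_x[of w] unfolding w_def by (intro abs_le_square_iff[THEN iffD1]) simp
  finally have "\<bar>norm (cis y - cis z)\<bar> \<le> \<bar>y - z\<bar>" by (simp only: abs_le_square_iff)
  then show ?thesis by simp
qed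

text \<open>Two points of a circle bound two arcs, and the one lying in \<open>A\<close> has to be
  found. If \<open>A\<close> misses a point, the branch cut of the argument is placed there; the
  argument is then continuous on \<open>A\<close>, its image is an interval, and the arc between the
  two arguments stays in \<open>A\<close>. If \<open>A\<close> is the whole circle, any cut will
  do.\<close>

lemma joinable_circle_arc:
  fixes x :: complex
  assumes A: "connected A" "A \<subseteq> sphere x r" "a \<in> A" "b \<in> A" and r: "r > 0"
  shows "joinable A (2 * pi * r) a b"
proof -
  obtain u :: complex where u: "norm u = 1" "A = sphere x r \<or> x - of_real r * u \<notin> A"
  proof (cases "A = sphere x r")
    case True
    then show ?thesis using that[of 1] by simp
  next
    case False
    then obtain v where v: "v \<in> sphere x r" "v \<notin> A" using A by blast
    show ?thesis
      by (rule that[of "(x - v) / of_real r"]) (use v r in \<open>auto simp: norm_divide dist_norm\<close>)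
  qed
  have u0: "u \<noteq> 0" using u by auto
  define c where "c t = x + of_real r * u * cis t" for t
  define \<theta> where "\<theta> z = Arg ((z - x) / (of_real r * u))" for z
  have c_\<theta>: "c (\<theta> z) = z" if "z \<in> sphere x r" for z
  proof -
    have "norm ((z - x) / (of_real r * u)) = 1"
      using that r u(1) by (simp add: norm_divide norm_mult dist_norm norm_minus_commute)
    then have "cis (\<theta> z) = (z - x) / (of_real r * u)"
      unfolding \<theta>_def by (metis cis_Arg div_by_1 norm_zero of_real_1 sgn_eq zero_neq_one)
    then show ?thesis using r u0 by (simp add: c_def)
  qed
  have arc: "c t \<in> A" if t: "t \<in> closed_segment (\<theta> a) (\<theta> b)" for t
  proof (cases "A = sphere x r")
    case True
    then show ?thesis using r u(1) by (simp add: c_def dist_norm norm_mult)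
  next
    case False
    then have nin: "x - of_real r * u \<notin> A" using u by simp
    have "continuous_on A \<theta>"
      unfolding \<theta>_def
    proof (intro continuous_on_compose2[OF continuous_on_Arg] continuous_intros)
      show "(\<lambda>z. (z - x) / (complex_of_real r * u)) ` A \<subseteq> - \<real>\<^sub>\<le>\<^sub>0"
      proof (clarsimp)
        fix z assume z: "z \<in> A" "(z - x) / (complex_of_real r * u) \<in> \<real>\<^sub>\<le>\<^sub>0"
        then obtain s where s: "s \<le> 0" "(z - x) / (complex_of_real r * u) = of_real s"
          by (auto elim!: nonpos_Reals_cases)
        have "norm ((z - x) / (of_real r * u)) = 1"
          using z A(2) r u(1) by (auto simp: norm_divide norm_mult dist_norm norm_minus_commute)
        then have "s = -1" using s by simp
        then have "z = x - of_real r * u" using s(2) r u0 by (simp add: field_simps)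
        then show False using nin z by simp
      qed
    qed (use r u0 in auto)
    then have "connected (\<theta> ` A)" using A(1) connected_continuous_image by blast
    then have "closed_segment (\<theta> a) (\<theta> b) \<subseteq> \<theta> ` A"
      using A(3,4) by (intro closed_segment_subset) (auto simp flip: is_interval_convex_1 simp add: is_interval_connected_1)
    then show ?thesis using t c_\<theta> A(2) by force
  qed
  have "\<bar>\<theta> b - \<theta> a\<bar> \<le> 2 * pi"
    using Arg_bounded[of "(a - x) / (of_real r * u)"] Arg_bounded[of "(b - x) / (of_real r * u)"]
    unfolding \<theta>_def by linarith
  have main: "joinable A (2 * pi * r) (c s) (c t)"
    if "s \<le> t" "t - s \<le> 2 * pi" "\<And>y. y \<in> {s..t} \<Longrightarrow> c y \<in> A" for s t
  proof (rule joinable_mono)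
    show "joinable A (r * t - r * s) (c s) (c t)"
    proof (rule joinable_interval)
      show "continuous_on {s..t} c" unfolding c_def by (intro continuous_intros)
      show "length_le c s t (r * t - r * s)"
      proof (rule length_le_lipschitz)
        fix y z :: real assume "y \<le> z"
        have "r * norm (cis y - cis z) \<le> r * (z - y)"
          using norm_cis_diff_le[of y z] r \<open>y \<le> z\<close> by simp
        moreover have "dist (c y) (c z) = r * norm (cis y - cis z)"
          using r u(1) by (simp add: c_def dist_norm norm_mult flip: right_diff_distrib)
        ultimately show "dist (c y) (c z) \<le> r * z - r * y" by (simp add: algebra_simps)
      qed (use that r in \<open>auto intro!: mono_onI\<close>)
    qed (use that in auto)
    show "r * t - r * s \<le> 2 * pi * r" using that(2) r by (simp flip: right_diff_distrib)
  qed auto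
  have ab: "c (\<theta> a) = a" "c (\<theta> b) = b" using c_\<theta> A by auto
  show ?thesis
  proof (cases "\<theta> a \<le> \<theta> b")
    case True
    then show ?thesis using main[of "\<theta> a" "\<theta> b"] arc \<open>\<bar>\<theta> b - \<theta> a\<bar> \<le> 2 * pi\<close> ab
      by (simp add: closed_segment_eq_real_ivl)
  next
    case False
    then show ?thesis using main[of "\<theta> b" "\<theta> a"] arc \<open>\<bar>\<theta> b - \<theta> a\<bar> \<le> 2 * pi\<close> ab
      by (intro joinable_sym[of _ _ b a]) (simp add: closed_segment_eq_real_ivl)
  qed
qed

text \<open>The bound is the sum of M + 1 for reaching the first arc almost optimally and M + 10 for
  the chain of arcs: the increments of the distances telescope to at most M, and the errors of the
  steps sum to at most 10.\<close>

lemma joinable_boundary_point: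
  fixes \<Omega> :: "complex set" and \<Phi> :: "complex \<Rightarrow> complex"
  assumes hom: "homeomorphism (cball 0 1) (closure \<Omega>) \<Phi> \<Psi>" and im: "\<Phi> ` ball 0 1 = \<Omega>"
    and w: "norm w = 1"
    and near: "\<And>e. e > 0 \<Longrightarrow> \<exists>q\<in>\<Omega> \<inter> ball (\<Phi> w) e. joinable \<Omega> M (\<Phi> 0) q"
  shows "joinable (insert (\<Phi> w) \<Omega>) (2 * M + 11) (\<Phi> 0) (\<Phi> w)"
proof -
  define x where "x = \<Phi> w"
  define z where "z = \<Phi> 0"
  \<comment> \<open>The intersection of \<Omega> with a disk about \<open>x\<close> may be
    disconnected, even near \<open>x\<close>. The images of half-disk-like convex sets at
    \<open>w\<close> are connected, and by \<open>N_small\<close> and \<open>N_large\<close> they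
    describe the same approach to \<open>x\<close>.\<close>
  define N where "N \<delta> = \<Phi> ` (ball w \<delta> \<inter> ball 0 1)" for \<delta> :: real
  define \<sigma> where "\<sigma> t = \<Phi> (of_real t * w)" for t :: real
  have cont: "continuous_on (cball 0 1) \<Phi>" and cont': "continuous_on (closure \<Omega>) \<Psi>"
    using hom by (auto simp: homeomorphism_def)
  have \<Psi>\<Phi>: "\<Psi> (\<Phi> u) = u" if "u \<in> cball 0 1" for u using hom that by (simp add: homeomorphism_def)
  have z: "z \<in> \<Omega>" using im by (force simp: z_def)
  have wc: "w \<in> cball 0 1" using w by simp
  have xc: "x \<in> closure \<Omega>" unfolding x_def using homeomorphism_image1[OF hom] wc by blast
  have \<Psi>x: "\<Psi> x = w" unfolding x_def by (rule \<Psi>\<Phi>[OF wc])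
  have hom\<Omega>: "\<Omega> homeomorphic (UNIV :: complex set)"
  proof -
    have "homeomorphism (ball 0 1) \<Omega> \<Phi> \<Psi>"
      by (rule homeomorphism_of_subsets[OF hom]) (use im in auto)
    then show ?thesis
      using homeomorphic_ball01_UNIV homeomorphic_sym homeomorphic_trans homeomorphic_def by metis
  qed
  have N_sub: "N \<delta> \<subseteq> \<Omega>" for \<delta> using im by (auto simp: N_def)
  have N_con: "connected (N \<delta>)" for \<delta> unfolding N_def
    by (intro connected_continuous_image continuous_on_subset[OF cont] convex_connected convex_Int) auto
  have \<sigma>_N: "\<sigma> t \<in> N \<delta>" if "0 \<le> t" "t < 1" "1 - t < \<delta>" for t \<delta>
  proof -
    have "w - of_real t * w = of_real (1 - t) * w" by (simp add: algebra_simps)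
    then have "dist w (of_real t * w) < \<delta>" using that w
      by (simp add: dist_norm norm_mult del: of_real_diff)
    then show ?thesis using that w by (auto simp: \<sigma>_def N_def norm_mult intro!: imageI)
  qed
  have \<sigma>_cont: "continuous_on {0..1} \<sigma>" unfolding \<sigma>_def
    by (rule continuous_on_compose2[OF cont]) (use w in \<open>auto simp: norm_mult intro!: continuous_intros\<close>)
  have \<sigma>_\<Omega>: "\<sigma> t \<in> \<Omega>" if "0 \<le> t" "t < 1" for t
    using that w im by (auto simp: \<sigma>_def norm_mult intro!: imageI)
  have \<sigma>_x: "\<sigma> t \<noteq> x" if "0 \<le> t" "t < 1" for t
  proof
    assume "\<sigma> t = x"
    then have "\<Psi> (\<sigma> t) = w" using \<Psi>x by simp
    moreover have "\<Psi> (\<sigma> t) = of_real t * w"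
      unfolding \<sigma>_def by (rule \<Psi>\<Phi>) (use that w in \<open>simp add: norm_mult\<close>)
    ultimately have "norm w = \<bar>t\<bar> * norm w" by (metis norm_mult norm_of_real)
    then show False using w that by simp
  qed
  have N_small: "\<exists>\<delta>>0. N \<delta> \<subseteq> ball x r" if r: "r > 0" for r
  proof -
    obtain \<delta> where \<delta>: "\<delta> > 0" "\<And>u. u \<in> cball 0 1 \<Longrightarrow> dist u w < \<delta> \<Longrightarrow> dist (\<Phi> u) (\<Phi> w) < r"
      using cont wc r unfolding continuous_on_iff by blast
    then have "N \<delta> \<subseteq> ball x r" by (auto simp: N_def x_def dist_commute)
    then show ?thesis using \<delta>(1) by blast
  qed
  have N_large: "\<exists>e>0. \<Omega> \<inter> ball x e \<subseteq> N \<delta>" if \<delta>: "\<delta> > 0" for \<delta>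
  proof -
    obtain e where e: "e > 0" "\<And>u. u \<in> closure \<Omega> \<Longrightarrow> dist u x < e \<Longrightarrow> dist (\<Psi> u) (\<Psi> x) < \<delta>"
      using cont' xc \<delta> unfolding continuous_on_iff by blast
    have "\<Omega> \<inter> ball x e \<subseteq> N \<delta>"
    proof
      fix q assume q: "q \<in> \<Omega> \<inter> ball x e"
      then obtain u where u: "u \<in> ball 0 1" "q = \<Phi> u" using im by blast
      have "q \<in> closure \<Omega>" using q closure_subset by blast
      then have "dist (\<Psi> q) w < \<delta>" using e(2)[of q] q \<Psi>x by (simp add: dist_commute)
      moreover have "\<Psi> q = u" using u \<Psi>\<Phi>[of u] by simp
      ultimately show "q \<in> N \<delta>" using u by (auto simp: N_def dist_commute)
    qed
    then show ?thesis using e(1) by blast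
  qed
  \<comment> \<open>A gate is a circular arc that every connected set leading from \<open>z\<close>
    into \<open>N \<delta>\<close> has to cross.\<close>
  define gate where "gate r \<delta> A \<longleftrightarrow> 0 < r \<and> 0 < \<delta> \<and> A \<subseteq> \<Omega> \<and> A \<subseteq> sphere x r \<and> connected A \<and>
    N \<delta> \<subseteq> ball x r \<and> (\<forall>T. connected T \<and> T \<subseteq> \<Omega> \<and> z \<in> T \<and> T \<inter> N \<delta> \<noteq> {} \<longrightarrow> T \<inter> A \<noteq> {})"
    for r \<delta> :: real and A
  \<comment> \<open>The new arc blocks access not only from \<open>z\<close> but from a whole
    initial part of the radius \<open>\<sigma>\<close>. This is what later forces it to cross the
    remaining part of the radius, close to \<open>x\<close>.\<close>
  have new_gate: "\<exists>r \<delta> A. gate r \<delta> A \<and> r \<le> R \<and> (\<forall>T. connected T \<and> T \<subseteq> \<Omega> \<and> T \<inter> \<sigma> ` {0..s} \<noteq> {} \<and>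
       T \<inter> N \<delta> \<noteq> {} \<longrightarrow> T \<inter> A \<noteq> {})" if s: "0 \<le> s" "s < 1" and R: "R > 0" for s R
  proof -
    have P: "compact (\<sigma> ` {0..s})" "connected (\<sigma> ` {0..s})"
      using s by (auto intro!: compact_continuous_image connected_continuous_image continuous_on_subset[OF \<sigma>_cont])
    have "x \<notin> \<sigma> ` {0..s}" using \<sigma>_x s by force
    then obtain d where d: "d > 0" "\<And>y. y \<in> \<sigma> ` {0..s} \<Longrightarrow> d \<le> dist x y"
      using separate_point_closed[OF compact_imp_closed[OF P(1)]] by blast
    define r where "r = min R (d / 2)"
    have r: "r > 0" "r \<le> R" "r < d" using R d(1) by (auto simp: r_def)
    obtain \<delta> where \<delta>: "\<delta> > 0" "N \<delta> \<subseteq> ball x r" using N_small[OF r(1)] by blast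
    have "\<sigma> (max 0 (1 - \<delta> / 2)) \<in> N \<delta>"
      by (rule \<sigma>_N) (use \<delta>(1) in \<open>auto simp: max_def\<close>)
    then have ne: "N \<delta> \<noteq> {}" by blast
    have "\<sigma> ` {0..s} \<inter> cball x r = {}" using d(2) r(3) by fastforce
    moreover have "\<sigma> ` {0..s} \<subseteq> \<Omega>" "\<sigma> ` {0..s} \<noteq> {}" using \<sigma>_\<Omega> s by auto
    ultimately obtain A where A: "A \<subseteq> \<Omega>" "A \<subseteq> sphere x r" "connected A"
        "\<And>T. \<lbrakk>connected T; T \<subseteq> \<Omega>; T \<inter> \<sigma> ` {0..s} \<noteq> {}; T \<inter> N \<delta> \<noteq> {}\<rbrakk> \<Longrightarrow> T \<inter> A \<noteq> {}"
      using separating_circle_arc[OF hom\<Omega> P(2) _ _ _ N_con N_sub \<delta>(2) ne] by metis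
    have "z = \<sigma> 0" by (simp add: z_def \<sigma>_def)
    then have "z \<in> \<sigma> ` {0..s}" using s by auto
    then have "gate r \<delta> A" unfolding gate_def using r \<delta> A by blast
    then show ?thesis using r(2) A(4) by blast
  qed
  have "\<exists>f. \<forall>n. ((case f n of (r, \<delta>, A) \<Rightarrow> gate r \<delta> A \<and> r \<le> (1/2) ^ n)) \<and>
     (\<forall>T. connected T \<and> T \<subseteq> \<Omega> \<and> z \<in> T \<and> T \<inter> snd (snd (f (Suc n))) \<noteq> {} \<longrightarrow> T \<inter> snd (snd (f n)) \<noteq> {})"
    (is "\<exists>f. \<forall>n. ?Q f n")
  proof (rule dependent_nat_choice)
    show "\<exists>y. case y of (r, \<delta>, A) \<Rightarrow> gate r \<delta> A \<and> r \<le> (1/2) ^ 0"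
      using new_gate[of 0 1] by auto
  next
    fix y :: "real \<times> real \<times> complex set" and n
    assume y: "case y of (r, \<delta>, A) \<Rightarrow> gate r \<delta> A \<and> r \<le> (1/2) ^ n"
    obtain r \<delta> A where yy: "y = (r, \<delta>, A)" by (cases y)
    have g: "gate r \<delta> A" "r \<le> (1/2) ^ n" using y yy by auto
    then have r: "r > 0" "\<delta> > 0" by (auto simp: gate_def)
    \<comment> \<open>Close enough to 1 that the radius beyond \<open>s\<close> runs inside
      \<open>N \<delta>\<close>.\<close>
    define s where "s = max 0 (1 - \<delta> / 2)"
    have s: "0 \<le> s" "s < 1" "1 - s < \<delta>" using r by (auto simp: s_def)
    obtain r' \<delta>' A' where g': "gate r' \<delta>' A'" "r' \<le> r / 2"
      and cross: "\<And>T. connected T \<Longrightarrow> T \<subseteq> \<Omega> \<Longrightarrow> T \<inter> \<sigma> ` {0..s} \<noteq> {} \<Longrightarrow> T \<inter> N \<delta>' \<noteq> {} \<Longrightarrow> T \<inter> A' \<noteq> {}"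
      using new_gate[OF s(1,2), of "r / 2"] r by auto
    define t where "t = max s (1 - \<delta>' / 2)"
    have "\<delta>' > 0" using g' by (simp add: gate_def)
    then have t: "s \<le> t" "t < 1" "1 - t < \<delta>'" using s by (auto simp: t_def)
    \<comment> \<open>The radius between \<open>s\<close> and \<open>t\<close> leads from the
      blocked initial part into \<open>N \<delta>'\<close>, so the new arc crosses it; as this
      stretch runs in \<open>N \<delta>\<close>, the new arc has a point there.\<close>
    have "\<sigma> ` {s..t} \<inter> A' \<noteq> {}"
    proof (rule cross)
      show "connected (\<sigma> ` {s..t})"
        by (rule connected_continuous_image[OF continuous_on_subset[OF \<sigma>_cont]]) (use s t in auto)
      show "\<sigma> ` {s..t} \<subseteq> \<Omega>" using \<sigma>_\<Omega> s t by auto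
      show "\<sigma> ` {s..t} \<inter> \<sigma> ` {0..s} \<noteq> {}" using s t by fastforce
      show "\<sigma> ` {s..t} \<inter> N \<delta>' \<noteq> {}" using \<sigma>_N[of t \<delta>'] s t by fastforce
    qed
    then obtain a' where a': "a' \<in> A'" "a' \<in> N \<delta>" using \<sigma>_N s t by fastforce
    \<comment> \<open>\<open>A'\<close> enters the neighbourhood \<open>N \<delta>\<close> without meeting \<open>A\<close>, so it lies behind \<open>A\<close> as seen from \<open>z\<close>.\<close>
    have disj: "A' \<inter> A = {}"
      using g g' r unfolding gate_def by fastforce
    have "T \<inter> A \<noteq> {}" if T: "connected T" "T \<subseteq> \<Omega>" "z \<in> T" "T \<inter> A' \<noteq> {}" for T
    proof -
      \<comment> \<open>Extending \<open>T\<close> along \<open>A'\<close> produces a connected set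
        reaching \<open>N \<delta>\<close>. The gate \<open>A\<close> must block it, and the
        crossing point cannot lie on \<open>A'\<close>.\<close>
      have "connected (T \<union> A')" using T g' by (intro connected_Un) (auto simp: gate_def)
      moreover have "T \<union> A' \<subseteq> \<Omega>" "z \<in> T \<union> A'" "(T \<union> A') \<inter> N \<delta> \<noteq> {}"
        using T g' a' by (auto simp: gate_def)
      ultimately have "(T \<union> A') \<inter> A \<noteq> {}" using g(1) unfolding gate_def by blast
      then show ?thesis using disj by blast
    qed
    moreover have "r' \<le> (1/2) ^ Suc n" using g(2) g'(2) by simp
    ultimately show "\<exists>y'. (case y' of (r, \<delta>, A) \<Rightarrow> gate r \<delta> A \<and> r \<le> (1/2) ^ Suc n) \<and>
       (\<forall>T. connected T \<and> T \<subseteq> \<Omega> \<and> z \<in> T \<and> T \<inter> snd (snd y') \<noteq> {} \<longrightarrow> T \<inter> snd (snd y) \<noteq> {})"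
      using g'(1) yy by (intro exI[of _ "(r', \<delta>', A')"]) auto
  qed
  then obtain f where f: "\<forall>n. ?Q f n" ..
  define r where "r n = fst (f n)" for n
  define \<delta> where "\<delta> n = fst (snd (f n))" for n
  define A where "A n = snd (snd (f n))" for n
  have g: "gate (r n) (\<delta> n) (A n)" and r_le: "r n \<le> (1/2) ^ n" for n
    using f[rule_format, THEN conjunct1, of n] by (auto simp: r_def \<delta>_def A_def split: prod.splits)
  have order: "T \<inter> A n \<noteq> {}" if "connected T" "T \<subseteq> \<Omega>" "z \<in> T" "T \<inter> A (Suc n) \<noteq> {}" for n T
    using f[rule_format, THEN conjunct2, of n] that unfolding A_def by blast
  have A: "A n \<subseteq> \<Omega>" "A n \<subseteq> sphere x (r n)" "connected (A n)" "r n > 0" "\<delta> n > 0" for n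
    using g[of n] by (auto simp: gate_def)
  have gate_N: "T \<inter> A n \<noteq> {}" if "connected T" "T \<subseteq> \<Omega>" "z \<in> T" "T \<inter> N (\<delta> n) \<noteq> {}" for n T
    using g[of n] that by (auto simp: gate_def)
  define S where "S n = {L. \<exists>a\<in>A n. joinable \<Omega> L z a}" for n
  \<comment> \<open>The internal distance from \<open>z\<close> to the arc
    \<open>A n\<close>.\<close>
  define D where "D n = Inf (S n)" for n
  have S_bdd: "bdd_below (S n)" for n
    by (rule bdd_belowI[of _ 0]) (auto simp: S_def joinable_nonneg)
  have split: "\<exists>\<tau>\<in>{0..1}. p \<tau> \<in> A n \<and> (\<exists>L1. joinable \<Omega> L1 z (p \<tau>) \<and> joinable \<Omega> (L - L1) (p \<tau>) (p 1))"
    if p: "path p" "path_image p \<subseteq> \<Omega>" "p 0 = z" "length_le p 0 1 L" "path_image p \<inter> A n \<noteq> {}" for p n L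
  proof -
    obtain \<tau> where \<tau>: "\<tau> \<in> {0..1}" "p \<tau> \<in> A n" using p(5) unfolding path_image_def by blast
    obtain L1 where L1: "length_le p 0 \<tau> L1" "length_le p \<tau> 1 (L - L1)"
      using length_le_split[OF p(4), of \<tau>] \<tau>(1) by auto
    have pc: "continuous_on {0..1} p" "p ` {0..1} \<subseteq> \<Omega>" using p by (auto simp: path_def path_image_def)
    have "joinable \<Omega> L1 (p 0) (p \<tau>)" "joinable \<Omega> (L - L1) (p \<tau>) (p 1)"
      using \<tau>(1) pc L1
      by (auto intro!: joinable_interval continuous_on_subset[OF pc(1)])
    then show ?thesis using \<tau> p(3) by blast
  qed
  \<comment> \<open>A curve of length at most \<open>M\<close> to a point of
    \<open>N (\<delta> n)\<close> passes the gate; its initial piece gives the bound.\<close>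
  have M_S: "\<exists>L\<in>S n. L \<le> M" for n
  proof -
    obtain e where e: "e > 0" "\<Omega> \<inter> ball x e \<subseteq> N (\<delta> n)" using N_large A(5) by blast
    then obtain q where q: "q \<in> N (\<delta> n)" "joinable \<Omega> M z q"
      using near[OF e(1)] unfolding x_def z_def by blast
    then obtain p where p: "path p" "path_image p \<subseteq> \<Omega>" "pathstart p = z" "pathfinish p = q" "length_le p 0 1 M"
      unfolding joinable_def by blast
    have "path_image p \<inter> A n \<noteq> {}"
    proof (rule gate_N)
      show "z \<in> path_image p" using p(3) pathstart_in_path_image by blast
      show "path_image p \<inter> N (\<delta> n) \<noteq> {}" using p(4) q(1) pathfinish_in_path_image by blast
    qed (use p connected_path_image in auto)
    then obtain \<tau> L1 where "p \<tau> \<in> A n" "joinable \<Omega> L1 z (p \<tau>)" "joinable \<Omega> (M - L1) (p \<tau>) (p 1)"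
      using split[OF p(1,2) _ p(5), of n] p(3) by (auto simp: pathstart_def)
    then show ?thesis using joinable_nonneg[of \<Omega> "M - L1"] by (auto simp: S_def intro!: bexI[of _ L1])
  qed
  have D_le: "D n \<le> L" if "L \<in> S n" for n L
    unfolding D_def using that S_bdd by (intro cInf_lower) auto
  have D_M: "D n \<le> M" for n using M_S[of n] D_le by force
  have D_0: "0 \<le> D n" for n
    unfolding D_def using M_S[of n] by (intro cInf_greatest) (auto simp: S_def joinable_nonneg)
  \<comment> \<open>Cut an almost shortest curve from \<open>z\<close> to \<open>A (Suc n)\<close>
    where it crosses \<open>A n\<close>. The first piece has length at least \<open>D n\<close>,
    which leaves only the increment of \<open>D\<close> plus the slack for the second.\<close>
  have "\<exists>a b. a \<in> A n \<and> b \<in> A (Suc n) \<and> joinable \<Omega> (M + 1) z a \<and>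
      joinable \<Omega> (D (Suc n) - D n + (1/2) ^ n) a b" for n
  proof -
    have "S (Suc n) \<noteq> {}" using M_S by blast
    then obtain L where L: "L \<in> S (Suc n)" "L < D (Suc n) + (1/2) ^ n"
      using cInf_lessD[of "S (Suc n)" "D (Suc n) + (1/2) ^ n"] by (auto simp: D_def)
    then obtain p where p: "path p" "path_image p \<subseteq> \<Omega>" "pathstart p = z" "pathfinish p \<in> A (Suc n)" "length_le p 0 1 L"
      unfolding joinable_def S_def by blast
    have "path_image p \<inter> A n \<noteq> {}"
    proof (rule order)
      show "z \<in> path_image p" using p(3) pathstart_in_path_image by blast
      show "path_image p \<inter> A (Suc n) \<noteq> {}" using p(4) pathfinish_in_path_image by blast
    qed (use p connected_path_image in auto)
    then obtain \<tau> L1 where \<tau>: "p \<tau> \<in> A n" "joinable \<Omega> L1 z (p \<tau>)" "joinable \<Omega> (L - L1) (p \<tau>) (p 1)"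
      using split[OF p(1,2) _ p(5), of n] p(3) by (auto simp: pathstart_def)
    have "D n \<le> L1" using \<tau> by (intro D_le) (auto simp: S_def)
    moreover have "L1 \<le> L" using joinable_nonneg[OF \<tau>(3)] by simp
    moreover have "(1/2::real) ^ n \<le> 1" by (simp add: power_le_one)
    ultimately have "joinable \<Omega> (M + 1) z (p \<tau>)" "joinable \<Omega> (D (Suc n) - D n + (1/2) ^ n) (p \<tau>) (p 1)"
      using L(2) D_M[of "Suc n"]
      by (auto intro!: joinable_mono[OF \<tau>(2)] joinable_mono[OF \<tau>(3)])
    then show ?thesis using \<tau>(1) p(4) unfolding pathfinish_def by blast
  qed
  then obtain a b where ab: "\<And>n. a n \<in> A n" "\<And>n. b n \<in> A (Suc n)" "\<And>n. joinable \<Omega> (M + 1) z (a n)"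
      "\<And>n. joinable \<Omega> (D (Suc n) - D n + (1/2) ^ n) (a n) (b n)"
    by metis
  \<comment> \<open>The factor 5 is 1 for the slack of the almost shortest curve and 4 > pi for the
    passage along the arc from \<open>b n\<close> to \<open>a (Suc n)\<close>, whose radius is at
    most half of (1/2)^n.\<close>
  define l where "l n = D (Suc n) - D n + 5 * (1/2) ^ n" for n
  have join: "joinable \<Omega> (l n) (a n) (a (Suc n))" for n
  proof (rule joinable_mono)
    have "joinable (A (Suc n)) (2 * pi * r (Suc n)) (b n) (a (Suc n))"
      using A ab by (intro joinable_circle_arc) auto
    then have "joinable \<Omega> (2 * pi * r (Suc n)) (b n) (a (Suc n))"
      using A(1) by (rule joinable_mono) auto
    then show "joinable \<Omega> (D (Suc n) - D n + (1/2) ^ n + 2 * pi * r (Suc n)) (a n) (a (Suc n))"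
      using ab(4) joinable_trans by blast
    have "2 * pi * r (Suc n) \<le> 2 * pi * (1/2) ^ Suc n"
      using r_le[of "Suc n"] by (intro mult_left_mono) auto
    also have "\<dots> = pi * (1/2) ^ n" by simp
    also have "\<dots> \<le> 4 * (1/2) ^ n" using pi_less_4 by (intro mult_right_mono) auto
    finally show "D (Suc n) - D n + (1/2) ^ n + 2 * pi * r (Suc n) \<le> l n" by (simp add: l_def)
  qed auto
  have l0: "0 \<le> l n" for n using join joinable_nonneg by blast
  have l_sum: "(\<Sum>i<n. l i) \<le> M + 10" for n
  proof -
    have "(\<Sum>i<n. l i) = D n - D 0 + 5 * (\<Sum>i<n. (1/2) ^ i)"
      by (simp add: l_def sum.distrib sum_lessThan_telescope sum_distrib_left)
    also have "(\<Sum>i<n. (1/2::real) ^ i) \<le> 2" by (simp add: sum_gp_strict)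
    finally show ?thesis using D_M[of n] D_0[of 0] by simp
  qed
  have sm: "summable l" by (rule summableI_nonneg_bounded[OF l0 l_sum])
  have "suminf l \<le> M + 10" by (rule suminf_le_const[OF sm l_sum])
  moreover have "a \<longlonglongrightarrow> x"
  proof (rule metric_tendsto_imp_tendsto)
    show "(\<lambda>n. (1/2::real) ^ n) \<longlonglongrightarrow> 0" by (rule LIMSEQ_power_zero) simp
    have "dist (a n) x \<le> dist ((1/2::real) ^ n) 0" for n
      using A(2)[of n] ab(1)[of n] r_le[of n] by (auto simp: dist_commute)
    then show "\<forall>\<^sub>F n in sequentially. dist (a n) x \<le> dist ((1/2::real) ^ n) 0" by simp
  qed
  ultimately have "joinable (insert x \<Omega>) (M + 10) (a 0) x"
    by (intro joinable_mono[OF joinable_sequence_limit[OF join sm]]) auto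
  moreover have "joinable (insert x \<Omega>) (M + 1) z (a 0)"
    by (rule joinable_mono[OF ab(3)]) auto
  ultimately have "joinable (insert x \<Omega>) ((M + 1) + (M + 10)) z x" using joinable_trans by blast
  then show ?thesis by (simp add: x_def z_def)
qed

section \<open>Smooth test functions\<close>

text \<open>Class C^n on the line. Quantifying the derivative existentially lets the closure
  properties be proved with explicit derivatives; \<open>Ck\<close> is reached only for products of
  two such functions.\<close>

primrec nderivable :: "nat \<Rightarrow> (real \<Rightarrow> real) \<Rightarrow> bool" where
  "nderivable 0 u \<longleftrightarrow> continuous_on UNIV u"
| "nderivable (Suc n) u \<longleftrightarrow> (\<exists>u'. (\<forall>t. (u has_real_derivative u' t) (at t)) \<and> nderivable n u')"

lemma nderivable_SucI:
  "(\<And>t. (u has_real_derivative u' t) (at t)) \<Longrightarrow> nderivable n u' \<Longrightarrow> nderivable (Suc n) u"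
  by auto

lemma nderivable_SucE:
  assumes "nderivable (Suc n) u"
  obtains u' where "\<forall>t. (u has_real_derivative u' t) (at t)" "nderivable n u'"
  using assms by auto

declare nderivable.simps(2) [simp del]

lemma nderivable_Suc_imp: "nderivable (Suc n) u \<Longrightarrow> nderivable n u"
proof (induction n arbitrary: u)
  case 0
  then obtain u' where u': "\<forall>t. (u has_real_derivative u' t) (at t)" by (rule nderivable_SucE)
  show ?case
    unfolding nderivable.simps by (rule DERIV_continuous_on[OF has_field_derivative_at_within[OF u'[rule_format]]])
next
  case (Suc n)
  from Suc.prems obtain u' where "\<forall>t. (u has_real_derivative u' t) (at t)" "nderivable (Suc n) u'"
    by (rule nderivable_SucE)
  then show ?case using Suc.IH by (intro nderivable_SucI) blast+
qed

lemma nderivable_const: "nderivable n (\<lambda>_. c)"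
  by (induction n arbitrary: c) (auto intro: nderivable_SucI[of _ "\<lambda>_. 0"])

lemma nderivable_add: "nderivable n u \<Longrightarrow> nderivable n v \<Longrightarrow> nderivable n (\<lambda>t. u t + v t)"
proof (induction n arbitrary: u v)
  case (Suc n)
  from Suc.prems(1) obtain u' where u': "\<forall>t. (u has_real_derivative u' t) (at t)" "nderivable n u'"
    by (rule nderivable_SucE)
  from Suc.prems(2) obtain v' where v': "\<forall>t. (v has_real_derivative v' t) (at t)" "nderivable n v'"
    by (rule nderivable_SucE)
  note d = u'[rule_format] v'[rule_format]
  then show ?case using Suc.IH
    by (intro nderivable_SucI[of _ "\<lambda>t. u' t + v' t"]) (auto intro!: DERIV_add)
qed (auto intro: continuous_intros)

lemma nderivable_mult: "nderivable n u \<Longrightarrow> nderivable n v \<Longrightarrow> nderivable n (\<lambda>t. u t * v t)"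
proof (induction n arbitrary: u v)
  case (Suc n)
  from Suc.prems(1) obtain u' where u': "\<forall>t. (u has_real_derivative u' t) (at t)" "nderivable n u'"
    by (rule nderivable_SucE)
  from Suc.prems(2) obtain v' where v': "\<forall>t. (v has_real_derivative v' t) (at t)" "nderivable n v'"
    by (rule nderivable_SucE)
  note d = u'[rule_format] v'[rule_format]
  have "nderivable n u" "nderivable n v" using Suc.prems nderivable_Suc_imp by auto
  then have "nderivable n (\<lambda>t. u' t * v t + v' t * u t)"
    using d Suc.IH by (intro nderivable_add) auto
  then show ?case using d
    by (intro nderivable_SucI[of _ "\<lambda>t. u' t * v t + v' t * u t"]) (auto intro!: DERIV_mult)
qed (auto intro: continuous_intros)

lemma nderivable_affine: "nderivable n u \<Longrightarrow> nderivable n (\<lambda>t. u (c * t + d))"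
proof (induction n arbitrary: u)
  case 0
  then show ?case by (auto intro!: continuous_on_compose2[of UNIV u] continuous_intros)
next
  case (Suc n)
  from Suc.prems obtain u' where u': "\<forall>t. (u has_real_derivative u' t) (at t)" "nderivable n u'" by (rule nderivable_SucE)
  note d = u'[rule_format]
  have "((\<lambda>t. u (c * t + d)) has_real_derivative u' (c * t + d) * c) (at t)" for t
    by (rule DERIV_chain2[OF d(1)]) (auto intro!: derivative_eq_intros)
  moreover have "nderivable n (\<lambda>t. u' (c * t + d) * c)"
    by (intro nderivable_mult nderivable_const Suc.IH d)
  ultimately show ?case by (rule nderivable_SucI)
qed

definition smooth_real :: "(real \<Rightarrow> real) \<Rightarrow> bool" where
  "smooth_real u \<longleftrightarrow> (\<forall>n. nderivable n u)"

lemma smooth_real_const: "smooth_real (\<lambda>_. c)"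
  and smooth_real_add: "smooth_real u \<Longrightarrow> smooth_real v \<Longrightarrow> smooth_real (\<lambda>t. u t + v t)"
  and smooth_real_mult: "smooth_real u \<Longrightarrow> smooth_real v \<Longrightarrow> smooth_real (\<lambda>t. u t * v t)"
  and smooth_real_affine: "smooth_real u \<Longrightarrow> smooth_real (\<lambda>t. u (c * t + d))"
  by (auto simp: smooth_real_def nderivable_const nderivable_add nderivable_mult nderivable_affine)

lemma smooth_real_continuous: "smooth_real u \<Longrightarrow> continuous_on UNIV u"
  by (auto simp: smooth_real_def dest: spec[of _ 0])

lemma smooth_real_antiderivative:
  assumes "\<And>t. (u has_real_derivative u' t) (at t)" "smooth_real u'"
  shows "smooth_real u"
  unfolding smooth_real_def
proof
  fix n
  have "nderivable (Suc n) u" using assms by (intro nderivable_SucI) (auto simp: smooth_real_def)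
  then show "nderivable n u" by (rule nderivable_Suc_imp)
qed

lemma smooth_real_derivative:
  assumes "\<And>t. (u has_real_derivative u' t) (at t)" "smooth_real u"
  shows "smooth_real u'"
  unfolding smooth_real_def
proof
  fix n
  have "nderivable (Suc n) u" using assms by (simp add: smooth_real_def)
  then obtain v where v: "\<forall>t. (u has_real_derivative v t) (at t)" "nderivable n v"
    by (rule nderivable_SucE)
  have "v = u'" using DERIV_unique[OF v(1)[rule_format] assms(1)] by blast
  then show "nderivable n u'" using v by simp
qed

text \<open>The powers in the denominator make the family closed under differentiation up to linear
  combinations, so smoothness follows by induction on the order for all \<open>k\<close>
  simultaneously.\<close>

definition flat :: "nat \<Rightarrow> real \<Rightarrow> real" where
  "flat k t = (if t > 0 then exp (- 1 / t) / t ^ k else 0)"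

lemma tendsto_flat_right: "(flat k \<longlongrightarrow> 0) (at_right 0)"
proof -
  have "((\<lambda>t::real. inverse t ^ k / exp (inverse t)) \<longlongrightarrow> 0) (at_right 0)"
    by (rule filterlim_compose[OF tendsto_power_div_exp_0 filterlim_inverse_at_top_right])
  moreover have "\<forall>\<^sub>F t in at_right 0. inverse t ^ k / exp (inverse t) = flat k t"
    unfolding eventually_at_right_field
    by (intro exI[of _ 1]) (auto simp: flat_def exp_minus field_simps)
  ultimately show ?thesis by (rule Lim_transform_eventually)
qed

lemma flat_has_derivative:
  "(flat k has_real_derivative flat (k + 2) t + (- real k) * flat (k + 1) t) (at t)"
proof (cases t "0::real" rule: linorder_cases)
  case less
  have "((\<lambda>_. 0) has_real_derivative 0) (at t)" by simp
  then have "(flat k has_real_derivative 0) (at t)"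
    by (rule has_field_derivative_transform_within_open[where S = "{..<0}"])
       (use less in \<open>auto simp: flat_def\<close>)
  then show ?thesis using less by (simp add: flat_def)
next
  case equal
  have "((\<lambda>h. (flat k (0 + h) - flat k 0) / h) \<longlongrightarrow> 0) (at 0)"
    unfolding filterlim_at_split
  proof
    show "((\<lambda>h. (flat k (0 + h) - flat k 0) / h) \<longlongrightarrow> 0) (at_left 0)"
    proof (rule tendsto_eventually)
      show "\<forall>\<^sub>F h in at_left 0. (flat k (0 + h) - flat k 0) / h = 0"
        unfolding eventually_at_left_field by (intro exI[of _ "-1"]) (auto simp: flat_def)
    qed
    \<comment> \<open>The right difference quotient at 0 is again a member of the family, so it
      tends to 0.\<close>
    have "\<forall>\<^sub>F h in at_right 0. flat (k + 1) h = (flat k (0 + h) - flat k 0) / h"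
      unfolding eventually_at_right_field by (intro exI[of _ 1]) (auto simp: flat_def)
    then show "((\<lambda>h. (flat k (0 + h) - flat k 0) / h) \<longlongrightarrow> 0) (at_right 0)"
      by (rule Lim_transform_eventually[OF tendsto_flat_right])
  qed
  then show ?thesis using equal by (simp add: DERIV_def flat_def)
next
  case greater
  have "((\<lambda>t. exp (- 1 / t) / t ^ k) has_real_derivative
      exp (- 1 / t) / t ^ (k + 2) + (- real k) * (exp (- 1 / t) / t ^ (k + 1))) (at t)"
    using greater
    apply (auto intro!: derivative_eq_intros)
    apply (cases k; simp add: field_simps power2_eq_square)
    done
  then have "(flat k has_real_derivative
      exp (- 1 / t) / t ^ (k + 2) + (- real k) * (exp (- 1 / t) / t ^ (k + 1))) (at t)"
    by (rule has_field_derivative_transform_within_open[where S = "{0<..}"])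
       (use greater in \<open>auto simp: flat_def\<close>)
  then show ?thesis using greater by (simp add: flat_def)
qed

lemma smooth_real_flat: "smooth_real (flat k)"
  unfolding smooth_real_def
proof
  fix n show "nderivable n (flat k)"
  proof (induction n arbitrary: k)
    case 0
    show ?case unfolding nderivable.simps
      by (rule DERIV_continuous_on[OF has_field_derivative_at_within[OF flat_has_derivative]])
  next
    case (Suc n)
    show ?case
      by (rule nderivable_SucI[OF flat_has_derivative]) (intro nderivable_add nderivable_mult nderivable_const Suc)
  qed
qed

text \<open>\<open>B\<close> is the normalized antiderivative of the bump
  \<open>flat 0 t * flat 0 (1 - t)\<close>. Differences of rescaled copies of \<open>B\<close> are
  cutoff functions, and rescaled copies of \<open>\<beta>\<close> are approximate
  identities.\<close>

lemma smooth_step_exists: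
  "\<exists>B \<beta>. smooth_real B \<and> (\<forall>t. (B has_real_derivative \<beta> t) (at t)) \<and> (\<forall>t. 0 \<le> \<beta> t) \<and>
    (\<forall>t\<le>0. B t = 0) \<and> (\<forall>t\<ge>1. B t = 1) \<and> (\<forall>t. t \<notin> {0..1} \<longrightarrow> \<beta> t = 0) \<and> (\<forall>t. 0 \<le> B t \<and> B t \<le> 1)"
proof -
  define b where "b t = flat 0 t * flat 0 ((-1) * t + 1)" for t
  have b: "smooth_real b"
    unfolding b_def by (intro smooth_real_mult smooth_real_flat smooth_real_affine[OF smooth_real_flat])
  have b0: "0 \<le> b t" and bz: "t \<notin> {0<..<1} \<Longrightarrow> b t = 0" and bp: "t \<in> {0<..<1} \<Longrightarrow> b t > 0" for t
    by (auto simp: b_def flat_def)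
  have "isCont b t" for t
    using smooth_real_continuous[OF b] by (simp add: continuous_on_eq_continuous_at)
  then obtain F where F: "\<And>t. (F has_real_derivative b t) (at t)"
    using einterval_antiderivative[of "-\<infinity>" "\<infinity>" b] by (auto simp: has_real_derivative_iff_has_vector_derivative)
  have mono: "F s \<le> F t" if "s \<le> t" for s t
    using DERIV_nonneg_imp_nondecreasing[OF that, of F] F b0 by blast
  obtain \<xi> where "0 < \<xi>" "\<xi> < 1" "F 1 - F 0 = (1 - 0) * b \<xi>"
    using MVT2[of 0 1 F b] F by auto
  then have pos: "F 1 - F 0 > 0" using bp[of \<xi>] by simp
  have const: "F s = F t" if st: "s < t" "\<And>r. s < r \<Longrightarrow> r < t \<Longrightarrow> b r = 0" for s t
  proof -
    obtain r where "s < r" "r < t" "F t - F s = (t - s) * b r" using MVT2[OF st(1), of F b] F by blast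
    then show ?thesis using st(2) by simp
  qed
  have F0: "F t = F 0" if "t \<le> 0" for t
    using const[of t 0] bz that by (cases "t = 0") force+
  have F1: "F t = F 1" if "1 \<le> t" for t
    using const[of 1 t] bz that by (cases "t = 1") force+
  define B where "B t = (F t + (- F 0)) * (1 / (F 1 - F 0))" for t
  show ?thesis
  proof (rule exI[of _ B], rule exI[of _ "\<lambda>t. b t * (1 / (F 1 - F 0))"], intro conjI allI impI)
    have "smooth_real F" using F b by (rule smooth_real_antiderivative)
    then show "smooth_real B"
      unfolding B_def by (intro smooth_real_mult smooth_real_add smooth_real_const)
    show "(B has_real_derivative b t * (1 / (F 1 - F 0))) (at t)" for t
      unfolding B_def using pos by (auto intro!: derivative_eq_intros F)
    show "B t = 0" if "t \<le> 0" for t using F0[OF that] by (simp add: B_def)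
    show "B t = 1" if "1 \<le> t" for t
      unfolding B_def F1[OF that] using pos by (simp add: field_simps)
    show "0 \<le> B t" "B t \<le> 1" for t
    proof -
      have "F 0 \<le> F t" using F0[of t] mono[of 0 t] by (cases "t \<le> 0") auto
      moreover have "F t \<le> F 1" using F1[of t] mono[of t 1] by (cases "1 \<le> t") auto
      ultimately show "0 \<le> B t" "B t \<le> 1" using pos by (auto simp: B_def)
    qed
  qed (use b0 bz pos in auto)
qed

section \<open>Test functions of product form\<close>

lemma Ck_add: "Ck k f \<Longrightarrow> Ck k g \<Longrightarrow> Ck k (\<lambda>x. f x + g x)"
proof (induction k arbitrary: f g)
  case (Suc k)
  have D: "((\<lambda>x. f x + g x) has_derivative
      (\<lambda>v. frechet_derivative f (at x) v + frechet_derivative g (at x) v)) (at x)" for x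
    using Suc.prems by (intro has_derivative_add) (auto simp: frechet_derivative_works)
  have "frechet_derivative (\<lambda>x. f x + g x) (at x) v =
      frechet_derivative f (at x) v + frechet_derivative g (at x) v" for x v
    using frechet_derivative_at[OF D[of x]] by metis
  moreover have "(\<lambda>x. f x + g x) differentiable (at x)" for x using D unfolding differentiable_def by blast
  ultimately show ?case using Suc by simp
qed (auto intro: continuous_intros)

lemma Ck_cmult: "Ck k f \<Longrightarrow> Ck k (\<lambda>x. c * f x)"
proof (induction k arbitrary: f)
  case (Suc k)
  have "frechet_derivative (\<lambda>x. c * f x) (at x) v = c * frechet_derivative f (at x) v" for x v
  proof -
    have "(f has_derivative frechet_derivative f (at x)) (at x)"
      using Suc.prems by (simp add: frechet_derivative_works)
    then have "((\<lambda>x. c * f x) has_derivative (\<lambda>v. c * frechet_derivative f (at x) v)) (at x)"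
      by (rule has_derivative_mult_right)
    from frechet_derivative_at[OF this] show ?thesis by metis
  qed
  then show ?case using Suc by auto
qed (auto intro: continuous_intros)

lemma has_derivative_product_Re_Im:
  assumes "\<And>t. (u has_real_derivative u' t) (at t)" "\<And>t. (v has_real_derivative v' t) (at t)"
  shows "((\<lambda>z. u (Re z) * v (Im z)) has_derivative
    (\<lambda>w. Re w * (u' (Re z) * v (Im z)) + Im w * (u (Re z) * v' (Im z)))) (at z)"
proof -
  have "((\<lambda>z. u (Re z)) has_derivative (\<lambda>w. u' (Re z) * Re w)) (at z)"
    using has_derivative_compose[OF has_derivative_Re[OF has_derivative_ident], of u "\<lambda>h. u' (Re z) * h" z UNIV]
      assms(1)[of "Re z"] by (simp add: has_field_derivative_def)
  moreover have "((\<lambda>z. v (Im z)) has_derivative (\<lambda>w. v' (Im z) * Im w)) (at z)"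
    using has_derivative_compose[OF has_derivative_Im[OF has_derivative_ident], of v "\<lambda>h. v' (Im z) * h" z UNIV]
      assms(2)[of "Im z"] by (simp add: has_field_derivative_def)
  ultimately have "((\<lambda>z. u (Re z) * v (Im z)) has_derivative
      (\<lambda>w. u (Re z) * (v' (Im z) * Im w) + u' (Re z) * Re w * v (Im z))) (at z)"
    by (rule has_derivative_mult)
  then show ?thesis by (simp add: algebra_simps)
qed

text \<open>A directional derivative is a linear combination of products of the same form, so the
  induction must range over both factors.\<close>

lemma Ck_product_Re_Im:
  "nderivable k u \<Longrightarrow> nderivable k v \<Longrightarrow> Ck k (\<lambda>z. u (Re z) * v (Im z))"
proof (induction k arbitrary: u v)
  case 0
  then show ?case
    by (auto intro!: continuous_intros continuous_on_compose2[of UNIV u] continuous_on_compose2[of UNIV v])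
next
  case (Suc k)
  from Suc.prems(1) obtain u' where u': "\<forall>t. (u has_real_derivative u' t) (at t)" "nderivable k u'"
    by (rule nderivable_SucE)
  from Suc.prems(2) obtain v' where v': "\<forall>t. (v has_real_derivative v' t) (at t)" "nderivable k v'"
    by (rule nderivable_SucE)
  note d = u'[rule_format] v'[rule_format]
  have uv: "nderivable k u" "nderivable k v" using Suc.prems nderivable_Suc_imp by auto
  note D = has_derivative_product_Re_Im[OF d(1,3)]
  have "frechet_derivative (\<lambda>z. u (Re z) * v (Im z)) (at z) w =
      Re w * (u' (Re z) * v (Im z)) + Im w * (u (Re z) * v' (Im z))" for z w
    using frechet_derivative_at[OF D[of z]] by metis
  moreover have "Ck k (\<lambda>z. Re w * (u' (Re z) * v (Im z)) + Im w * (u (Re z) * v' (Im z)))" for w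
    by (intro Ck_add Ck_cmult Suc.IH d uv)
  moreover have "(\<lambda>z. u (Re z) * v (Im z)) differentiable (at z)" for z
    using D unfolding differentiable_def by blast
  ultimately show ?case by simp
qed

lemma test_function_product_Re_Im:
  assumes "smooth_real u" "smooth_real v" "\<And>t. t \<notin> {a..b} \<Longrightarrow> u t = 0" "\<And>t. t \<notin> {c..d} \<Longrightarrow> v t = 0"
    and "cbox (Complex a c) (Complex b d) \<subseteq> U"
  shows "test_function U (\<lambda>z. u (Re z) * v (Im z))"
proof -
  let ?S = "{z. u (Re z) * v (Im z) \<noteq> 0}"
  have "?S \<subseteq> cbox (Complex a c) (Complex b d)"
    using assms(3,4) by (fastforce simp: in_cbox_complex_iff)
  then have cl: "closure ?S \<subseteq> cbox (Complex a c) (Complex b d)" by (rule closure_minimal) (rule closed_cbox)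
  then have "compact (closure ?S)" using bounded_subset[OF bounded_cbox] by (auto simp: compact_eq_bounded_closed)
  then show ?thesis unfolding test_function_def
    using cl assms Ck_product_Re_Im by (auto simp: smooth_real_def)
qed

section \<open>Absolute continuity on vertical lines\<close>

lemma lborel_complex_eq:
  "(lborel :: complex measure) = distr (lborel \<Otimes>\<^sub>M lborel) borel (\<lambda>(x, y). Complex x y)"
proof (rule lborel_eqI)
  have [measurable]: "(\<lambda>(x, y). Complex x y) \<in> borel_measurable (lborel \<Otimes>\<^sub>M lborel)"
    by (simp add: borel_prod[symmetric] case_prod_beta' borel_measurable_complex_iff)
  fix l u :: complex assume le: "\<And>b. b \<in> Basis \<Longrightarrow> l \<bullet> b \<le> u \<bullet> b"
  have le': "Re l \<le> Re u" "Im l \<le> Im u" using le[of 1] le[of \<i>] by (auto simp: Basis_complex_def)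
  have "(\<lambda>(x, y). Complex x y) -` box l u \<inter> space (lborel \<Otimes>\<^sub>M lborel) = {Re l<..<Re u} \<times> {Im l<..<Im u}"
    by (auto simp: in_box_complex_iff space_pair_measure)
  then have "emeasure (distr (lborel \<Otimes>\<^sub>M lborel) borel (\<lambda>(x, y). Complex x y)) (box l u) =
      emeasure (lborel \<Otimes>\<^sub>M lborel) ({Re l<..<Re u} \<times> {Im l<..<Im u})"
    by (simp add: emeasure_distr)
  also have "\<dots> = ennreal (Re u - Re l) * ennreal (Im u - Im l)"
    using le' by (subst lborel.emeasure_pair_measure_Times) auto
  also have "\<dots> = ennreal (\<Prod>b\<in>Basis. (u - l) \<bullet> b)"
    using le' by (simp add: Basis_complex_def ennreal_mult)
  finally show "emeasure (distr (lborel \<Otimes>\<^sub>M lborel) borel (\<lambda>(x, y). Complex x y)) (box l u) =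
      ennreal (\<Prod>b\<in>Basis. (u - l) \<bullet> b)" .
qed simp

lemma integrable_complex_pair:
  fixes h :: "complex \<Rightarrow> 'b::{banach, second_countable_topology}"
  assumes "integrable lborel h"
  shows "integrable (lborel \<Otimes>\<^sub>M lborel) (\<lambda>p. h (Complex (fst p) (snd p)))"
    and "(LINT z|lborel. h z) = (LINT x|lborel. (LINT y|lborel. h (Complex x y)))"
proof -
  have meas: "(\<lambda>(x, y). Complex x y) \<in> measurable (lborel \<Otimes>\<^sub>M lborel) borel"
    by (simp add: borel_prod[symmetric] case_prod_beta' borel_measurable_complex_iff)
  have h: "h \<in> borel_measurable borel" using borel_measurable_integrable[OF assms] by simp
  have "integrable (distr (lborel \<Otimes>\<^sub>M lborel) borel (\<lambda>(x, y). Complex x y)) h"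
    using assms by (simp add: lborel_complex_eq)
  then show i: "integrable (lborel \<Otimes>\<^sub>M lborel) (\<lambda>p. h (Complex (fst p) (snd p)))"
    unfolding integrable_distr_eq[OF meas h] by (simp add: case_prod_beta')
  have "(LINT z|lborel. h z) = integral\<^sup>L (lborel \<Otimes>\<^sub>M lborel) (\<lambda>p. h (Complex (fst p) (snd p)))"
    by (subst lborel_complex_eq) (subst integral_distr[OF meas h], simp add: case_prod_beta')
  also have "\<dots> = (LINT x|lborel. (LINT y|lborel. h (Complex x y)))"
    using lborel_pair.integral_fst'[OF i] by simp
  finally show "(LINT z|lborel. h z) = (LINT x|lborel. (LINT y|lborel. h (Complex x y)))" .
qed

text \<open>Open intervals are stable under intersection, and the Borel sets with vanishing integral
  are closed under complements, by \<open>f0\<close>, and under disjoint countable unions.\<close>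

lemma AE_eq_0_if_integral_intervals_eq_0:
  fixes f :: "real \<Rightarrow> 'b::{banach, second_countable_topology}"
  assumes f: "integrable lborel f" and f0: "(LINT x|lborel. f x) = 0"
    and ivl: "\<And>a b. (LINT x:{a<..<b}|lborel. f x) = 0"
  shows "AE x in lborel. f x = 0"
proof (rule sigma_finite_measure.density_zero[OF lborel.sigma_finite_measure_axioms f])
  fix A :: "real set" assume "A \<in> sets lborel"
  have si: "set_integrable lborel A f" if "A \<in> sets borel" for A
    using f that unfolding set_integrable_def by (intro integrable_mult_indicator) auto
  have sets: "sigma_sets UNIV (range (\<lambda>(a, b). {a<..<b})) = sets (borel :: real measure)"
  proof -
    have eq: "(\<lambda>(a, b). {a<..<b :: real}) = (\<lambda>(a, b). box a b)" by (auto simp: fun_eq_iff)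
    show ?thesis unfolding eq borel_eq_box by (rule sets_measure_of[symmetric]) simp
  qed
  have A: "A \<in> sigma_sets UNIV (range (\<lambda>(a, b). {a<..<b}))"
    using \<open>A \<in> sets lborel\<close> sets by simp
  show "(LINT x:A|lborel. f x) = 0"
  proof (rule sigma_sets_induct_disjoint[OF _ _ A])
    show "Int_stable (range (\<lambda>(a, b). {a<..<b :: real}))"
      by (auto simp: Int_stable_def intro!: rev_image_eqI)
  next
    fix A assume A: "A \<in> sigma_sets UNIV (range (\<lambda>(a, b). {a<..<b :: real}))" "(LINT x:A|lborel. f x) = 0"
    have Ab: "A \<in> sets borel" using A(1) sets by auto
    have "(LINT x:A \<union> (UNIV - A)|lborel. f x) = (LINT x:A|lborel. f x) + (LINT x:UNIV - A|lborel. f x)"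
      using Ab by (intro set_integral_Un si) auto
    moreover have "A \<union> (UNIV - A) = UNIV" by auto
    ultimately show "(LINT x:UNIV - A|lborel. f x) = 0" using A(2) f0 by (simp add: set_lebesgue_integral_def)
  next
    fix A :: "nat \<Rightarrow> real set"
    assume A: "disjoint_family A" "range A \<subseteq> sigma_sets UNIV (range (\<lambda>(a, b). {a<..<b :: real}))"
      "\<And>i. (LINT x:A i|lborel. f x) = 0"
    have Ab: "A i \<in> sets borel" for i using A(2) sets by auto
    have "(LINT x:(\<Union>i. A i)|lborel. f x) = (\<Sum>i. LINT x:A i|lborel. f x)"
      using A(1) Ab by (intro lebesgue_integral_countable_add si) (auto simp: disjoint_family_on_def)
    then show "(LINT x:\<Union> (range A)|lborel. f x) = 0" using A(3) by simp
  next
    show "(LINT x:{}|lborel. f x) = 0" by (simp add: set_lebesgue_integral_def)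
  qed (auto simp: ivl)
qed

lemma integrable_bounded_scaleR:
  fixes f :: "'a \<Rightarrow> 'b::{banach, second_countable_topology}"
  assumes "integrable M f" "u \<in> borel_measurable M" "\<And>x. \<bar>u x\<bar> \<le> K"
  shows "integrable M (\<lambda>x. u x *\<^sub>R f x)"
proof (rule Bochner_Integration.integrable_bound)
  show "integrable M (\<lambda>x. K * norm (f x))" using assms(1) by simp
  show "AE x in M. norm (u x *\<^sub>R f x) \<le> norm (K * norm (f x))"
    using assms(3) by (intro AE_I2) (auto simp: abs_mult intro!: mult_right_mono order_trans[OF assms(3)])
qed (use assms in measurable)

lemma bounded_real_of_vanishing_outside:
  fixes u :: "real \<Rightarrow> real"
  assumes "continuous_on UNIV u" "\<And>t. t \<notin> {a..b} \<Longrightarrow> u t = 0"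
  obtains K where "\<And>t. \<bar>u t\<bar> \<le> K"
proof -
  have "bounded (u ` {a..b})"
    by (intro compact_imp_bounded compact_continuous_image continuous_on_subset[OF assms(1)]) auto
  then obtain K where K: "\<forall>t\<in>{a..b}. \<bar>u t\<bar> \<le> K" unfolding bounded_iff by fastforce
  show ?thesis
  proof (rule that)
    show "\<bar>u t\<bar> \<le> max K 0" for t using assms(2)[of t] K by (cases "t \<in> {a..b}") force+
  qed
qed

text \<open>The shift \<open>d\<close> chooses the side: the kernel lies to the right of
  \<open>a\<close> for d = 0 and to the left for d = 1. Kernels at the two ends of an interval can
  therefore both be placed inside it.\<close>

lemma approximate_identity:
  fixes f :: "real \<Rightarrow> complex"
  assumes B: "\<And>t. (B has_real_derivative \<beta> t) (at t)" "continuous_on UNIV \<beta>" "\<And>t. 0 \<le> \<beta> t"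
      "\<And>t. t \<notin> {0..1} \<Longrightarrow> \<beta> t = 0" "B 1 - B 0 = 1"
    and f: "integrable lborel f" "isCont f a" and d: "0 \<le> d" "d \<le> 1"
  shows "(\<lambda>n. LINT y|lborel. (real n * \<beta> (real n * (y - a) + d)) *\<^sub>R f y) \<longlonglongrightarrow> f a"
proof (rule LIMSEQ_I)
  fix e :: real assume e: "e > 0"
  obtain \<delta> where \<delta>: "\<delta> > 0" "\<And>y. \<bar>y - a\<bar> < \<delta> \<Longrightarrow> norm (f y - f a) < e / 2"
    using f(2) e unfolding continuous_at_eps_delta dist_norm real_norm_def
    by (metis half_gt_zero)
  obtain N :: nat where N: "1 / \<delta> < real N" using reals_Archimedean2 by blast
  have [measurable]: "\<beta> \<in> borel_measurable borel" using B(2) borel_measurable_continuous_onI by blast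
  obtain K where K: "\<And>t. \<bar>\<beta> t\<bar> \<le> K" using bounded_real_of_vanishing_outside[OF B(2,4)] by metis
  have int\<beta>: "has_bochner_integral lborel \<beta> 1"
  proof -
    have "has_bochner_integral lborel (\<lambda>x. indicator {0..1} x *\<^sub>R \<beta> x) (B 1 - B 0)"
      using B(1,2) by (intro has_bochner_integral_FTC_Icc) 
        (auto simp: has_real_derivative_iff_has_vector_derivative intro: has_vector_derivative_at_within continuous_on_subset)
    moreover have "(\<lambda>x. indicator {0..1} x *\<^sub>R \<beta> x) = \<beta>" using B(4) by (force simp: indicator_def)
    ultimately show ?thesis using B(5) by simp
  qed
  show "\<exists>N. \<forall>n\<ge>N. norm ((LINT y|lborel. (real n * \<beta> (real n * (y - a) + d)) *\<^sub>R f y) - f a) < e"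
  proof (intro exI allI impI)
    fix n assume n: "N \<le> n"
    then have n\<delta>: "1 / \<delta> < real n" using N by linarith
    have "0 < 1 / \<delta>" using \<delta>(1) by simp
    then have n0: "real n > 0" using n\<delta> by linarith
    have n1: "1 / real n < \<delta>" using n\<delta> \<delta>(1) n0 by (simp add: field_simps)
    define k where "k y = real n * \<beta> (real n * (y - a) + d)" for y
    have [measurable]: "k \<in> borel_measurable borel" unfolding k_def by measurable
    have k0: "0 \<le> k y" for y using B(3) by (simp add: k_def)
    have k_supp: "k y = 0" if "\<not> \<bar>y - a\<bar> < \<delta>" for y
    proof -
      have "real n * (y - a) + d \<notin> {0..1}"
      proof
        assume "real n * (y - a) + d \<in> {0..1}"
        then have "\<bar>real n * (y - a)\<bar> \<le> 1" using d by auto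
        then have "real n * \<bar>y - a\<bar> \<le> 1" by (simp add: abs_mult)
        then have "\<bar>y - a\<bar> \<le> 1 / real n" using n0 by (simp add: pos_le_divide_eq mult.commute)
        then show False using that n1 by linarith
      qed
      then show ?thesis using B(4) by (simp add: k_def)
    qed
    have k_int: "has_bochner_integral lborel k 1"
    proof -
      have "has_bochner_integral lborel (\<lambda>y. \<beta> ((d - real n * a) + real n * y)) (1 /\<^sub>R \<bar>real n\<bar>)"
        using int\<beta> n0 by (subst lborel_has_bochner_integral_real_affine_iff[symmetric]) auto
      then have "has_bochner_integral lborel (\<lambda>y. real n *\<^sub>R \<beta> ((d - real n * a) + real n * y)) (real n *\<^sub>R (1 /\<^sub>R \<bar>real n\<bar>))"
        by (intro has_bochner_integral_scaleR_right)
      then show ?thesis using n0 by (simp add: k_def[abs_def] algebra_simps)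
    qed
    have k_f: "integrable lborel (\<lambda>y. k y *\<^sub>R f y)"
    proof (rule integrable_bounded_scaleR[OF f(1)])
      show "\<bar>k y\<bar> \<le> real n * K" for y
        using K n0 unfolding k_def abs_mult by (intro mult_mono) auto
    qed simp
    have ki: "integrable lborel k" "integral\<^sup>L lborel k = 1"
      using k_int has_bochner_integral_iff by auto
    have "(LINT y|lborel. k y *\<^sub>R f y) - f a = (LINT y|lborel. k y *\<^sub>R (f y - f a))"
      using k_f ki by (simp add: scaleR_diff_right)
    also have "norm \<dots> \<le> (LINT y|lborel. k y * (e / 2))"
    proof (rule order_trans[OF integral_norm_bound], rule integral_mono)
      show "integrable lborel (\<lambda>y. norm (k y *\<^sub>R (f y - f a)))" using k_f ki by (simp add: scaleR_diff_right)
      show "integrable lborel (\<lambda>y. k y * (e / 2))" using ki by simp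
      show "norm (k y *\<^sub>R (f y - f a)) \<le> k y * (e / 2)" for y
        using \<delta>(2)[of y] k_supp[of y] k0[of y]
        by (cases "\<bar>y - a\<bar> < \<delta>") (auto simp del: times_divide_eq_right intro!: mult_left_mono)
    qed
    also have "\<dots> = e / 2" using ki by simp
    finally show "norm ((LINT y|lborel. (real n * \<beta> (real n * (y - a) + d)) *\<^sub>R f y) - f a) < e"
      using e by (simp add: k_def)
  qed
qed

section \<open>From the weak derivative to the length of vertical segments\<close>

lemma completion_ex_borel_measurable_complex:
  fixes g :: "'a \<Rightarrow> complex"
  assumes "g \<in> borel_measurable (completion M)"
  shows "\<exists>g'\<in>borel_measurable M. AE x in M. g x = g' x"
proof -
  have "(\<lambda>x. Re (g x)) \<in> borel_measurable (completion M)" "(\<lambda>x. Im (g x)) \<in> borel_measurable (completion M)"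
    using assms by (auto simp: borel_measurable_complex_iff)
  then obtain u v where uv: "u \<in> borel_measurable M" "AE x in M. Re (g x) = u x"
      "v \<in> borel_measurable M" "AE x in M. Im (g x) = v x"
    using completion_ex_borel_measurable_real by metis
  show ?thesis
  proof
    show "(\<lambda>x. Complex (u x) (v x)) \<in> borel_measurable M"
      using uv by (simp add: borel_measurable_complex_iff)
    show "AE x in M. g x = Complex (u x) (v x)"
      using uv(2,4) by eventually_elim (simp add: complex_eq_iff)
  qed
qed

text \<open>Fubini needs functions on the whole plane and Borel measurability: \<open>f\<close> is
  the extension of \<open>\<Phi>\<close> by zero, and \<open>g'\<close> is a Borel representative of
  the extension of \<open>g\<close>. After integrating in the ordinate, \<open>\<alpha>\<close> is a
  free one-dimensional test function.\<close>

lemma weak_derivative_product_test: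
  fixes \<Phi> g f g' :: "complex \<Rightarrow> complex"
  assumes weak: "weak_partial_derivative U \<i> \<Phi> g"
    and f: "integrable lborel f" "\<And>z. f z = indicator U z *\<^sub>R \<Phi> z"
    and g': "integrable lborel g'" "AE z in lborel. indicator U z *\<^sub>R g z = g' z"
    and gm: "set_borel_measurable lebesgue U g"
    and \<alpha>: "smooth_real \<alpha>" "\<And>t. t \<notin> {a..b} \<Longrightarrow> \<alpha> t = 0"
    and H: "smooth_real H" "\<And>t. t \<notin> {c..d} \<Longrightarrow> H t = 0" "\<And>t. (H has_real_derivative H' t) (at t)"
    and sub: "cbox (Complex a c) (Complex b d) \<subseteq> U"
  shows "(LINT x|lborel. \<alpha> x *\<^sub>R (LINT y|lborel. H' y *\<^sub>R f (Complex x y) + H y *\<^sub>R g' (Complex x y))) = 0"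
proof -
  let ?\<eta> = "\<lambda>z. \<alpha> (Re z) * H (Im z)"
  obtain \<alpha>' where \<alpha>': "\<And>t. (\<alpha> has_real_derivative \<alpha>' t) (at t)"
    using \<alpha>(1) unfolding smooth_real_def by (metis nderivable.simps(2))
  have D: "frechet_derivative ?\<eta> (at z) \<i> = \<alpha> (Re z) * H' (Im z)" for z
    unfolding frechet_derivative_at[OF has_derivative_product_Re_Im[of \<alpha> \<alpha>' H H' z, OF \<alpha>' H(3)], symmetric]
    by simp
  have smH': "smooth_real H'" using H(3,1) by (rule smooth_real_derivative)
  note cont = smooth_real_continuous[OF \<alpha>(1)] smooth_real_continuous[OF H(1)] smooth_real_continuous[OF smH']
  note [measurable] = cont[THEN borel_measurable_continuous_onI]
  have [measurable]: "f \<in> borel_measurable borel" "g' \<in> borel_measurable borel"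
    using f(1) g'(1) borel_measurable_integrable by force+
  have H'0: "H' t = 0" if "t \<notin> {c..d}" for t
  proof -
    have "open (- {c..d})" by (intro open_Compl) auto
    then have "(H has_real_derivative 0) (at t)"
      by (rule has_field_derivative_transform_within_open[where f = "\<lambda>_. 0", rotated 1]) (use that H(2) in auto)
    then show ?thesis using H(3) DERIV_unique by blast
  qed
  obtain K1 where K1: "\<And>t. \<bar>\<alpha> t\<bar> \<le> K1" using bounded_real_of_vanishing_outside[OF cont(1) \<alpha>(2)] by metis
  obtain K2 where K2: "\<And>t. \<bar>H t\<bar> \<le> K2" using bounded_real_of_vanishing_outside[OF cont(2) H(2)] by metis
  obtain K3 where K3: "\<And>t. \<bar>H' t\<bar> \<le> K3" using bounded_real_of_vanishing_outside[OF cont(3) H'0] by metis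
  have i1: "integrable lborel (\<lambda>z. (\<alpha> (Re z) * H' (Im z)) *\<^sub>R f z)"
    by (rule integrable_bounded_scaleR[OF f(1), where K = "K1 * K3"])
       (auto simp: abs_mult intro!: mult_mono K1 K3 order_trans[OF abs_ge_zero K1])
  have i2: "integrable lborel (\<lambda>z. ?\<eta> z *\<^sub>R g' z)"
    by (rule integrable_bounded_scaleR[OF g'(1), where K = "K1 * K2"])
       (auto simp: abs_mult intro!: mult_mono K1 K2 order_trans[OF abs_ge_zero K1])
  have "(LINT z:U|lebesgue. frechet_derivative ?\<eta> (at z) \<i> *\<^sub>R \<Phi> z) =
      (LINT z|lebesgue. (\<alpha> (Re z) * H' (Im z)) *\<^sub>R f z)"
    unfolding set_lebesgue_integral_def D by (intro Bochner_Integration.integral_cong) (auto simp: f(2))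
  also have "\<dots> = (LINT z|lborel. (\<alpha> (Re z) * H' (Im z)) *\<^sub>R f z)"
    by (rule integral_completion) measurable
  finally have e1: "(LINT z:U|lebesgue. frechet_derivative ?\<eta> (at z) \<i> *\<^sub>R \<Phi> z) = \<dots>" .
  have "(LINT z:U|lebesgue. ?\<eta> z *\<^sub>R g z) = (LINT z|lebesgue. ?\<eta> z *\<^sub>R (indicator U z *\<^sub>R g z))"
    unfolding set_lebesgue_integral_def by (intro Bochner_Integration.integral_cong) auto
  also have "\<dots> = (LINT z|lebesgue. ?\<eta> z *\<^sub>R g' z)"
  proof (rule integral_cong_AE)
    have [measurable]: "(\<lambda>z. indicator U z *\<^sub>R g z) \<in> borel_measurable lebesgue"
      using gm by (simp add: set_borel_measurable_def)
    have m: "?\<eta> \<in> borel_measurable lebesgue" by (intro measurable_completion) measurable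
    show "(\<lambda>z. ?\<eta> z *\<^sub>R (indicator U z *\<^sub>R g z)) \<in> borel_measurable lebesgue"
      using m by measurable
    show "(\<lambda>z. ?\<eta> z *\<^sub>R g' z) \<in> borel_measurable lebesgue"
      by (intro measurable_completion) measurable
    show "AE z in lebesgue. ?\<eta> z *\<^sub>R (indicator U z *\<^sub>R g z) = ?\<eta> z *\<^sub>R g' z"
      using AE_completion[OF g'(2)] by eventually_elim simp
  qed
  also have "\<dots> = (LINT z|lborel. ?\<eta> z *\<^sub>R g' z)"
    by (rule integral_completion) measurable
  finally have e2: "(LINT z:U|lebesgue. ?\<eta> z *\<^sub>R g z) = \<dots>" .
  have "test_function U ?\<eta>" by (rule test_function_product_Re_Im[OF \<alpha>(1) H(1) \<alpha>(2) H(2) sub])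
  then have "(LINT z|lborel. (\<alpha> (Re z) * H' (Im z)) *\<^sub>R f z) = - (LINT z|lborel. ?\<eta> z *\<^sub>R g' z)"
    using weak e1 e2 unfolding weak_partial_derivative_def by metis
  then have "0 = (LINT z|lborel. (\<alpha> (Re z) * H' (Im z)) *\<^sub>R f z + ?\<eta> z *\<^sub>R g' z)"
    using i1 i2 by simp
  also have "\<dots> = (LINT x|lborel. (LINT y|lborel. (\<alpha> x * H' y) *\<^sub>R f (Complex x y) + (\<alpha> x * H y) *\<^sub>R g' (Complex x y)))"
    using integrable_complex_pair(2)[OF Bochner_Integration.integrable_add[OF i1 i2]] by simp
  also have "\<dots> = (LINT x|lborel. \<alpha> x *\<^sub>R (LINT y|lborel. H' y *\<^sub>R f (Complex x y) + H y *\<^sub>R g' (Complex x y)))"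
    by (simp add: scaleR_add_right flip: integral_scaleR_right scaleR_scaleR)
  finally show ?thesis by simp
qed

text \<open>The fundamental lemma of the calculus of variations on an interval: smooth plateaus
  converge boundedly to indicators of open intervals, which reduces the claim to integrals over
  intervals.\<close>

lemma AE_eq_0_if_test_integrals_eq_0:
  fixes F :: "real \<Rightarrow> complex"
  assumes F: "integrable lborel F"
    and test: "\<And>\<alpha> a b. smooth_real \<alpha> \<Longrightarrow> - c < a \<Longrightarrow> b < c \<Longrightarrow> (\<And>t. t \<notin> {a..b} \<Longrightarrow> \<alpha> t = 0) \<Longrightarrow>
      (LINT x|lborel. \<alpha> x *\<^sub>R F x) = 0"
  shows "AE x in lborel. \<bar>x\<bar> < c \<longrightarrow> F x = 0"
proof -
  obtain B \<beta> :: "real \<Rightarrow> real" where B: "smooth_real B" "\<And>t. t \<le> 0 \<Longrightarrow> B t = 0" "\<And>t. 1 \<le> t \<Longrightarrow> B t = 1"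
      "\<And>t. 0 \<le> B t" "\<And>t. B t \<le> 1"
    using smooth_step_exists by metis
  have Bm [measurable]: "B \<in> borel_measurable borel"
    using smooth_real_continuous[OF B(1)] borel_measurable_continuous_onI by blast
  have Fm [measurable]: "F \<in> borel_measurable borel" using borel_measurable_integrable[OF F] by simp
  have closed_ivl: "(LINT x|lborel. indicator {a<..<b} x *\<^sub>R F x) = 0" if ab: "- c < a" "b < c" for a b
  proof -
    define \<alpha> where "\<alpha> n x = B (real n * x + (- real n * a)) * B ((- real n) * x + real n * b)" for n x
    have bd: "\<bar>\<alpha> n x\<bar> \<le> 1" for n x
      unfolding \<alpha>_def abs_mult using B(4,5) by (intro mult_le_one) auto
    have lim: "(\<lambda>n. \<alpha> n x) \<longlonglongrightarrow> indicator {a<..<b} x" for x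
    proof (cases "x \<in> {a<..<b}")
      case True
      obtain N :: nat where N: "1 / (x - a) < real N" "1 / (b - x) < real N"
        using reals_Archimedean2[of "max (1 / (x - a)) (1 / (b - x))"] by auto
      have "\<alpha> n x = 1" if "N \<le> n" for n
      proof -
        have "1 / (x - a) < real n" "1 / (b - x) < real n" using N that by linarith+
        then have "1 \<le> real n * (x - a)" "1 \<le> real n * (b - x)"
          using True by (auto simp: field_simps)
        then show ?thesis unfolding \<alpha>_def by (subst (1 2) B(3)) (auto simp: algebra_simps)
      qed
      then have "\<forall>\<^sub>F n in sequentially. \<alpha> n x = 1" using eventually_sequentially by blast
      then show ?thesis using True by (simp add: tendsto_eventually)
    next
      case False
      then have "real n * (x - a) \<le> 0 \<or> real n * (b - x) \<le> 0" for n
        by (auto intro: mult_nonneg_nonpos)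
      then have "\<alpha> n x = 0" for n
        using B(2)[of "real n * (x - a)"] B(2)[of "real n * (b - x)"] unfolding \<alpha>_def
        by (fastforce simp: algebra_simps)
      then show ?thesis using False by simp
    qed
    have am [measurable]: "\<alpha> n \<in> borel_measurable borel" for n unfolding \<alpha>_def by measurable
    have "(\<lambda>n. LINT x|lborel. \<alpha> n x *\<^sub>R F x) \<longlonglongrightarrow> (LINT x|lborel. indicator {a<..<b} x *\<^sub>R F x)"
    proof (rule integral_dominated_convergence[where w = "\<lambda>x. norm (F x)"])
      show "AE x in lborel. (\<lambda>n. \<alpha> n x *\<^sub>R F x) \<longlonglongrightarrow> indicator {a<..<b} x *\<^sub>R F x"
        by (intro AE_I2 tendsto_scaleR lim tendsto_const)
      show "AE x in lborel. norm (\<alpha> n x *\<^sub>R F x) \<le> norm (F x)" for n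
        using bd by (intro AE_I2) (simp add: mult_left_le_one_le)
    qed (use F in auto)
    moreover have "(LINT x|lborel. \<alpha> n x *\<^sub>R F x) = 0" for n
    proof (rule test[OF _ ab])
      show "smooth_real (\<alpha> n)"
        unfolding \<alpha>_def[abs_def] by (intro smooth_real_mult smooth_real_affine B(1))
      fix t assume "t \<notin> {a..b}"
      then have "real n * (t - a) \<le> 0 \<or> real n * (b - t) \<le> 0" by (auto intro: mult_nonneg_nonpos)
      then show "\<alpha> n t = 0"
        using B(2)[of "real n * (t - a)"] B(2)[of "real n * (b - t)"] unfolding \<alpha>_def
        by (fastforce simp: algebra_simps)
    qed
    ultimately have "(\<lambda>n. 0) \<longlonglongrightarrow> (LINT x|lborel. indicator {a<..<b} x *\<^sub>R F x)" by simp
    then show ?thesis by (simp only: LIMSEQ_const_iff)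
  qed
  \<comment> \<open>Test functions keep away from the ends -c and c; intervals touching them are
    exhausted from inside.\<close>
  have ivl: "(LINT x|lborel. indicator {a<..<b} x *\<^sub>R F x) = 0" if ab: "- c \<le> a" "b \<le> c" for a b
  proof -
    have lim: "(\<lambda>n. indicat_real {a + 1 / real (Suc n)<..<b - 1 / real (Suc n)} x) \<longlonglongrightarrow> indicator {a<..<b} x" for x
    proof (cases "x \<in> {a<..<b}")
      case True
      obtain N :: nat where N: "1 / (x - a) < real N" "1 / (b - x) < real N"
        using reals_Archimedean2[of "max (1 / (x - a)) (1 / (b - x))"] by auto
      have "indicat_real {a + 1 / real (Suc n)<..<b - 1 / real (Suc n)} x = 1" if "N \<le> n" for n
      proof -
        have "1 / (x - a) < real (Suc n)" "1 / (b - x) < real (Suc n)" using N that by linarith+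
        then have "1 / real (Suc n) < x - a" "1 / real (Suc n) < b - x"
          using True by (auto simp: field_simps)
        then show ?thesis by (auto simp: indicator_def)
      qed
      then have "\<forall>\<^sub>F n in sequentially. indicat_real {a + 1 / real (Suc n)<..<b - 1 / real (Suc n)} x = 1"
        using eventually_sequentially by blast
      then show ?thesis using True by (simp add: tendsto_eventually)
    next
      case False
      have "indicat_real {a + 1 / real (Suc n)<..<b - 1 / real (Suc n)} x = 0" for n
      proof -
        have "1 / real (Suc n) > 0" by simp
        then have "x \<notin> {a + 1 / real (Suc n)<..<b - 1 / real (Suc n)}"
          using False unfolding greaterThanLessThan_iff by linarith
        then show ?thesis by simp
      qed
      then show ?thesis using False by simp
    qed
    have "(\<lambda>n. LINT x|lborel. indicat_real {a + 1 / real (Suc n)<..<b - 1 / real (Suc n)} x *\<^sub>R F x)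
        \<longlonglongrightarrow> (LINT x|lborel. indicator {a<..<b} x *\<^sub>R F x)"
    proof (rule integral_dominated_convergence[where w = "\<lambda>x. norm (F x)"])
      show "AE x in lborel. (\<lambda>n. indicat_real {a + 1 / real (Suc n)<..<b - 1 / real (Suc n)} x *\<^sub>R F x)
          \<longlonglongrightarrow> indicator {a<..<b} x *\<^sub>R F x"
        by (intro AE_I2 tendsto_scaleR lim tendsto_const)
    qed (use F in \<open>auto simp: indicator_def\<close>)
    moreover have "(LINT x|lborel. indicat_real {a + 1 / real (Suc n)<..<b - 1 / real (Suc n)} x *\<^sub>R F x) = 0" for n
    proof -
      have "1 / real (Suc n) > 0" by simp
      then show ?thesis by (intro closed_ivl) (use ab in linarith)+
    qed
    ultimately have "(\<lambda>n. 0) \<longlonglongrightarrow> (LINT x|lborel. indicator {a<..<b} x *\<^sub>R F x)" by simp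
    then show ?thesis by (simp only: LIMSEQ_const_iff)
  qed
  have "AE x in lborel. indicator {- c<..<c} x *\<^sub>R F x = 0"
  proof (rule AE_eq_0_if_integral_intervals_eq_0)
    show "integrable lborel (\<lambda>x. indicator {- c<..<c} x *\<^sub>R F x)"
      using F by (intro integrable_mult_indicator) auto
    show "(LINT x|lborel. indicator {- c<..<c} x *\<^sub>R F x) = 0" by (rule ivl) auto
    fix a b
    have "indicat_real {a<..<b} x * indicat_real {- c<..<c} x = indicat_real {max a (- c)<..<min b c} x" for x
      by (auto simp: indicator_def)
    then show "(LINT x:{a<..<b}|lborel. indicator {- c<..<c} x *\<^sub>R F x) = 0"
      unfolding set_lebesgue_integral_def scaleR_scaleR using ivl[of "max a (- c)" "min b c"] by simp
  qed
  then show ?thesis by eventually_elim (auto simp: indicator_def split: if_splits)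
qed

text \<open>The test function in \<open>weak\<close> is a smooth trapezoid, rising just after p and
  falling just before q. Its derivative is the difference of two approximate identities, so letting
  n tend to infinity bounds the distance of the values of \<open>\<phi>\<close> at p and q by the
  integral of the norm of \<open>\<gamma>\<close> between them. Only rational p and q are assumed,
  since the identity will be available only up to countably many null sets; continuity covers the
  other points.\<close>

lemma length_le_of_weak_derivative:
  fixes \<phi> \<gamma> :: "real \<Rightarrow> complex" and B \<beta> :: "real \<Rightarrow> real"
  assumes B: "\<And>t. (B has_real_derivative \<beta> t) (at t)" "continuous_on UNIV \<beta>" "\<And>t. 0 \<le> \<beta> t"
      "\<And>t. t \<notin> {0..1} \<Longrightarrow> \<beta> t = 0" "\<And>t. t \<le> 0 \<Longrightarrow> B t = 0" "\<And>t. 1 \<le> t \<Longrightarrow> B t = 1"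
      "\<And>t. 0 \<le> B t" "\<And>t. B t \<le> 1"
    and int: "integrable lborel \<phi>" "integrable lborel \<gamma>"
    and cont: "\<And>t. 0 < t \<Longrightarrow> t < s \<Longrightarrow> isCont \<phi> t"
    and weak: "\<And>(p::rat) (q::rat) n. 0 < p \<Longrightarrow> p < q \<Longrightarrow> of_rat q < s \<Longrightarrow> 1 \<le> real n * (of_rat q - of_rat p) \<Longrightarrow>
      (LINT y|lborel. (real n * \<beta> (real n * (y - of_rat p) + 0) - real n * \<beta> (real n * (y - of_rat q) + 1)) *\<^sub>R \<phi> y
         + (B (real n * (y - of_rat p) + 0) - B (real n * (y - of_rat q) + 1)) *\<^sub>R \<gamma> y) = 0"
    and pq: "0 < p" "p \<le> q" "q < s"
  shows "length_le \<phi> p q (LINT y|lborel. norm (\<gamma> y))"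
proof -
  define I where "I a b = (LINT y|lborel. indicator {a<..b} y *\<^sub>R norm (\<gamma> y))" for a b :: real
  have ni: "integrable lborel (\<lambda>y. indicator A y *\<^sub>R norm (\<gamma> y))" if "A \<in> sets borel" for A
    using int(2) that by (intro integrable_mult_indicator) auto
  have I_mono: "I a b \<le> I a' b'" if "a' \<le> a" "b \<le> b'" for a b a' b'
    unfolding I_def by (intro integral_mono ni) (use that in \<open>auto simp: indicator_def\<close>)
  have [measurable]: "\<beta> \<in> borel_measurable borel" "B \<in> borel_measurable borel"
    using B(2) DERIV_continuous_on[OF has_field_derivative_at_within[OF B(1)]]
      borel_measurable_continuous_onI by auto
  obtain K where K: "\<And>t. \<bar>\<beta> t\<bar> \<le> K" using bounded_real_of_vanishing_outside[OF B(2,4)] by metis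
  have rat: "dist (\<phi> (of_rat q)) (\<phi> (of_rat p)) \<le> I (of_rat p) (of_rat q)"
    if p: "0 < p" and pq: "p < q" and q: "of_rat q < s" for p q :: rat
  proof -
    define P Q where "P = (of_rat p :: real)" and "Q = (of_rat q :: real)"
    have PQ: "0 < P" "P < Q" "Q < s" using p pq q by (auto simp: P_def Q_def of_rat_less)
    define k where "k a d n y = real n * \<beta> (real n * (y - a) + d)" for a d n y
    have k_int: "integrable lborel (\<lambda>y. k a d n y *\<^sub>R \<phi> y)" for a d n
      unfolding k_def by (rule integrable_bounded_scaleR[OF int(1), where K = "real n * K"])
        (auto simp: abs_mult intro!: mult_left_mono K)
    have lim: "(\<lambda>n. LINT y|lborel. k a d n y *\<^sub>R \<phi> y) \<longlonglongrightarrow> \<phi> a" if "0 < a" "a < s" "0 \<le> d" "d \<le> 1" for a d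
      unfolding k_def by (rule approximate_identity[OF B(1-4) _ int(1) cont]) (use B(5)[of 0] B(6)[of 1] that in auto)
    have "(\<lambda>n. dist (LINT y|lborel. k Q 1 n y *\<^sub>R \<phi> y) (LINT y|lborel. k P 0 n y *\<^sub>R \<phi> y)) \<longlonglongrightarrow> dist (\<phi> Q) (\<phi> P)"
      by (intro tendsto_dist lim) (use PQ in auto)
    moreover obtain N :: nat where N: "1 / (Q - P) < real N" using reals_Archimedean2 by blast
    have "dist (LINT y|lborel. k Q 1 n y *\<^sub>R \<phi> y) (LINT y|lborel. k P 0 n y *\<^sub>R \<phi> y) \<le> I P Q" if "N \<le> n" for n
    proof -
      have "1 / (Q - P) < real n" using N that by linarith
      then have n: "1 \<le> real n * (Q - P)" using PQ by (simp add: field_simps)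
      \<comment> \<open>The condition \<open>n\<close> makes the rise end before the fall begins, so
        \<open>H\<close> vanishes off the interval.\<close>
      define H where "H y = B (real n * (y - P) + 0) - B (real n * (y - Q) + 1)" for y
      have H1: "\<bar>H y\<bar> \<le> 1" for y
        using B(7,8)[of "real n * (y - P) + 0"] B(7,8)[of "real n * (y - Q) + 1"] unfolding H_def by linarith
      have H0: "H y = 0" if "y \<notin> {P<..Q}" for y
      proof (cases "y \<le> P")
        case True
        have "real n * (y - P) \<le> 0" using True by (simp add: mult_nonneg_nonpos)
        moreover have "real n * (y - Q) + 1 \<le> 0"
        proof -
          have "real n * (y - Q) = real n * (y - P) - real n * (Q - P)" by (simp add: algebra_simps)
          then show ?thesis using n \<open>real n * (y - P) \<le> 0\<close> by linarith
        qed
        ultimately show ?thesis using B(5) by (simp add: H_def)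
      next
        case False
        then have y: "Q < y" using that by auto
        then have "0 \<le> real n * (y - Q)" by simp
        moreover have "1 \<le> real n * (y - P)"
        proof -
          have "real n * (y - P) = real n * (y - Q) + real n * (Q - P)" by (simp add: algebra_simps)
          then show ?thesis using n \<open>0 \<le> real n * (y - Q)\<close> by linarith
        qed
        ultimately show ?thesis using B(6) by (simp add: H_def)
      qed
      have H_int: "integrable lborel (\<lambda>y. H y *\<^sub>R \<gamma> y)"
        by (rule integrable_bounded_scaleR[OF int(2) _ H1]) (simp add: H_def[abs_def])
      have "(LINT y|lborel. (k P 0 n y - k Q 1 n y) *\<^sub>R \<phi> y + H y *\<^sub>R \<gamma> y) = 0"
        using weak[OF p pq q, of n] n unfolding k_def H_def P_def Q_def by simp
      moreover have "(LINT y|lborel. (k P 0 n y - k Q 1 n y) *\<^sub>R \<phi> y + H y *\<^sub>R \<gamma> y) =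
          (LINT y|lborel. k P 0 n y *\<^sub>R \<phi> y) - (LINT y|lborel. k Q 1 n y *\<^sub>R \<phi> y) + (LINT y|lborel. H y *\<^sub>R \<gamma> y)"
        using k_int H_int by (simp add: scaleR_diff_left)
      ultimately have "(LINT y|lborel. k Q 1 n y *\<^sub>R \<phi> y) - (LINT y|lborel. k P 0 n y *\<^sub>R \<phi> y) = (LINT y|lborel. H y *\<^sub>R \<gamma> y)"
        by (simp add: algebra_simps)
      then have "dist (LINT y|lborel. k Q 1 n y *\<^sub>R \<phi> y) (LINT y|lborel. k P 0 n y *\<^sub>R \<phi> y) = norm (LINT y|lborel. H y *\<^sub>R \<gamma> y)"
        by (simp add: dist_norm)
      also have "\<dots> \<le> (LINT y|lborel. norm (H y *\<^sub>R \<gamma> y))" by (rule integral_norm_bound)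
      also have "\<dots> \<le> I P Q"
        unfolding I_def
      proof (rule integral_mono)
        show "integrable lborel (\<lambda>y. norm (H y *\<^sub>R \<gamma> y))" using H_int by (rule integrable_norm)
        show "norm (H y *\<^sub>R \<gamma> y) \<le> indicator {P<..Q} y *\<^sub>R norm (\<gamma> y)" for y
          using H0[of y] H1[of y] by (cases "y \<in> {P<..Q}") (auto simp: mult_left_le_one_le)
      qed (rule ni, simp)
      finally show ?thesis .
    qed
    ultimately show ?thesis
      unfolding P_def Q_def by (intro LIMSEQ_le_const2[where x = "dist _ _"]) auto
  qed
  have real: "dist (\<phi> b) (\<phi> a) \<le> I a b" if ab: "p \<le> a" "a < b" "b \<le> q" for a b
  proof (rule field_le_epsilon)
    fix e :: real assume e: "e > 0"
    define \<delta> where "\<delta> = (b - a) / 2"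
    have cab: "isCont \<phi> a" "isCont \<phi> b" using cont ab pq by auto
    obtain d1 where d1: "d1 > 0" "\<forall>y. dist y a < d1 \<longrightarrow> dist (\<phi> y) (\<phi> a) < e / 2"
      using cab(1) e unfolding continuous_at_eps_delta by (meson half_gt_zero)
    obtain d2 where d2: "d2 > 0" "\<forall>y. dist y b < d2 \<longrightarrow> dist (\<phi> y) (\<phi> b) < e / 2"
      using cab(2) e unfolding continuous_at_eps_delta by (meson half_gt_zero)
    \<comment> \<open>The rational points approximate \<open>a\<close> and \<open>b\<close> from
      inside and on different sides of the midpoint, so the integral between them is at most
      \<open>I a b\<close>.\<close>
    have "a < min (a + d1) ((a + b) / 2)" using d1 ab by auto
    then obtain u where u: "a < of_rat u" "of_rat u < min (a + d1) ((a + b) / 2)" using of_rat_dense by blast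
    have "max (b - d2) ((a + b) / 2) < b" using d2 ab by auto
    then obtain v where v: "max (b - d2) ((a + b) / 2) < of_rat v" "of_rat v < b" using of_rat_dense by blast
    have "(0::real) < of_rat u" using u(1) ab pq by linarith
    then have "0 < u" by (simp only: zero_less_of_rat_iff)
    moreover have "real_of_rat u < of_rat v" using u v by simp
    then have "u < v" by (simp only: of_rat_less)
    ultimately have "dist (\<phi> (of_rat v)) (\<phi> (of_rat u)) \<le> I (of_rat u) (of_rat v)"
      using v ab pq by (intro rat) auto
    also have "\<dots> \<le> I a b" using u v by (intro I_mono) auto
    finally have 1: "dist (\<phi> (of_rat v)) (\<phi> (of_rat u)) \<le> I a b" .
    have 2: "dist (\<phi> (of_rat u)) (\<phi> a) < e / 2" using d1 u by (auto simp: dist_real_def)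
    have 3: "dist (\<phi> (of_rat v)) (\<phi> b) < e / 2" using d2 v by (auto simp: dist_real_def)
    show "dist (\<phi> b) (\<phi> a) \<le> I a b + e"
      using 1 2 3 dist_triangle[of "\<phi> b" "\<phi> a" "\<phi> (of_rat v)"] dist_triangle[of "\<phi> (of_rat v)" "\<phi> a" "\<phi> (of_rat u)"]
      by (simp add: dist_commute)
  qed
  \<comment> \<open>The majorant for \<open>length_le_lipschitz\<close>.\<close>
  define J where "J t = (LINT y|lborel. indicator {..t} y *\<^sub>R norm (\<gamma> y))" for t :: real
  have J: "J b - J a = I a b" if "a \<le> b" for a b
  proof -
    have "J b - J a = (LINT y|lborel. indicator {..b} y *\<^sub>R norm (\<gamma> y) - indicator {..a} y *\<^sub>R norm (\<gamma> y))"
      unfolding J_def by (rule Bochner_Integration.integral_diff[symmetric]; rule ni; simp)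
    also have "\<dots> = I a b"
      unfolding I_def using that by (intro Bochner_Integration.integral_cong) (auto simp: indicator_def)
    finally show ?thesis .
  qed
  have I0: "0 \<le> I a b" for a b unfolding I_def by (intro Bochner_Integration.integral_nonneg) auto
  have "length_le \<phi> p q (J q - J p)"
  proof (rule length_le_lipschitz)
    fix a b assume ab: "p \<le> a" "a \<le> b" "b \<le> q"
    show "dist (\<phi> a) (\<phi> b) \<le> J b - J a"
    proof (cases "a = b")
      case False
      then show ?thesis using real[of a b] J[of a b] ab by (simp add: dist_commute)
    qed simp
  next
    show "mono_on {p..q} J"
    proof (rule mono_onI)
      fix a b :: real assume "a \<le> b"
      then show "J a \<le> J b" using J[of a b] I0[of a b] by simp
    qed
  qed (rule pq)
  moreover have "J q - J p \<le> (LINT y|lborel. norm (\<gamma> y))"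
    unfolding J[OF pq(2)] I_def
  proof (rule integral_mono)
    show "indicator {p<..q} y *\<^sub>R norm (\<gamma> y) \<le> norm (\<gamma> y)" for y by (simp add: indicator_def)
  qed (use int ni in auto)
  ultimately show ?thesis by (rule length_le_mono)
qed

text \<open>The bound \<open>m x\<close> is the integral of the norm of the weak derivative along
  the entire vertical line, so it does not depend on p and q, and Fubini makes it
  integrable.\<close>

lemma vertical_length_bound:
  fixes \<Phi> g :: "complex \<Rightarrow> complex"
  assumes cont: "continuous_on (ball 0 1) \<Phi>" and ai: "\<Phi> absolutely_integrable_on ball 0 1"
    and gi: "g absolutely_integrable_on ball 0 1" and weak: "weak_partial_derivative (ball 0 1) \<i> \<Phi> g"
  shows "\<exists>m. integrable lborel m \<and> (\<forall>x. 0 \<le> m x) \<and> (AE x in lborel. \<forall>p q. 0 < p \<and> p \<le> q \<and> x\<^sup>2 + q\<^sup>2 < 1 \<longrightarrow>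
    length_le (\<lambda>y. \<Phi> (Complex x y)) p q (m x))"
proof -
  define f where "f z = indicator (ball 0 1) z *\<^sub>R \<Phi> z" for z
  have fm: "f \<in> borel_measurable borel"
    unfolding f_def[abs_def] by (intro borel_measurable_continuous_on_indicator cont) auto
  have "integrable lebesgue f" using ai unfolding set_integrable_def f_def[abs_def] .
  then have f: "integrable lborel f" using fm integrable_completion[of f lborel] by simp
  have g0: "integrable lebesgue (\<lambda>z. indicator (ball 0 1) z *\<^sub>R g z)" using gi unfolding set_integrable_def .
  obtain g' where g'm: "g' \<in> borel_measurable lborel" and g'ae: "AE z in lborel. indicator (ball 0 1) z *\<^sub>R g z = g' z"
    using completion_ex_borel_measurable_complex[OF borel_measurable_integrable[OF g0]] by blast
  have "integrable lebesgue g'"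
    using g0 by (rule integrable_cong_AE_imp)
      (use g'm AE_completion[OF g'ae] in \<open>auto intro: measurable_completion simp: eq_commute\<close>)
  then have g': "integrable lborel g'" using g'm integrable_completion[of g' lborel] by simp
  have gm: "set_borel_measurable lebesgue (ball 0 1) g"
    using borel_measurable_integrable[OF g0] by (simp add: set_borel_measurable_def)
  obtain B \<beta> :: "real \<Rightarrow> real" where Bsm: "smooth_real B"
      and B: "\<And>t. (B has_real_derivative \<beta> t) (at t)" "\<And>t. 0 \<le> \<beta> t" "\<And>t. t \<le> 0 \<Longrightarrow> B t = 0" "\<And>t. 1 \<le> t \<Longrightarrow> B t = 1"
      "\<And>t. t \<notin> {0..1} \<Longrightarrow> \<beta> t = 0" "\<And>t. 0 \<le> B t" "\<And>t. B t \<le> 1"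
    using smooth_step_exists by metis
  have \<beta>c: "continuous_on UNIV \<beta>" by (rule smooth_real_continuous[OF smooth_real_derivative[OF B(1) Bsm]])
  obtain K where K: "\<And>t. \<bar>\<beta> t\<bar> \<le> K" using bounded_real_of_vanishing_outside[OF \<beta>c B(5)] by metis
  note [measurable] = \<beta>c[THEN borel_measurable_continuous_onI] smooth_real_continuous[OF Bsm, THEN borel_measurable_continuous_onI]
  define H where "H p q n y = B (real n * (y - p) + 0) - B (real n * (y - q) + 1)" for p q :: real and n y
  define H' where "H' p q n y = real n * \<beta> (real n * (y - p) + 0) - real n * \<beta> (real n * (y - q) + 1)" for p q :: real and n y
  define F where "F p q n x = (LINT y|lborel. H' p q n y *\<^sub>R f (Complex x y) + H p q n y *\<^sub>R g' (Complex x y))" for p q n x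
  have F_int: "integrable lborel (F p q n)" for p q n
  proof -
    have "\<bar>H p q n y\<bar> \<le> 1" for y
      using B(6,7)[of "real n * (y - p) + 0"] B(6,7)[of "real n * (y - q) + 1"] unfolding H_def by linarith
    moreover have "\<bar>H' p q n y\<bar> \<le> 2 * (real n * K)" for y
    proof -
      have "\<bar>real n * \<beta> t\<bar> \<le> real n * K" for t by (simp add: abs_mult mult_left_mono K)
      from this[of "real n * (y - p) + 0"] this[of "real n * (y - q) + 1"] show ?thesis unfolding H'_def by linarith
    qed
    moreover have "H p q n \<in> borel_measurable borel" "H' p q n \<in> borel_measurable borel"
      unfolding H_def[abs_def] H'_def[abs_def] by measurable
    ultimately have "integrable lborel (\<lambda>z. H' p q n (Im z) *\<^sub>R f z + H p q n (Im z) *\<^sub>R g' z)"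
      by (intro Bochner_Integration.integrable_add integrable_bounded_scaleR[OF f] integrable_bounded_scaleR[OF g']) auto
    from lborel_pair.integrable_fst'[OF integrable_complex_pair(1)[OF this]]
    show ?thesis unfolding F_def[abs_def] by simp
  qed
  \<comment> \<open>Points with abscissa below c in absolute value and ordinate between p and q lie
    in the disk, because 0 < p and c^2 + q^2 < 1.\<close>
  have ae: "AE x in lborel. \<bar>x\<bar> < c \<longrightarrow> F p q n x = 0"
    if *: "0 < p" "p < q" "1 \<le> real n * (q - p)" "c\<^sup>2 + q\<^sup>2 < 1" for p q c n
  proof (rule AE_eq_0_if_test_integrals_eq_0[OF F_int])
    fix \<alpha> a b assume \<alpha>: "smooth_real \<alpha>" "- c < a" "b < c" "\<And>t. t \<notin> {a..b} \<Longrightarrow> \<alpha> t = 0"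
    show "(LINT x|lborel. \<alpha> x *\<^sub>R F p q n x) = 0"
      unfolding F_def
    proof (rule weak_derivative_product_test[OF weak f f_def g' g'ae gm \<alpha>(1) \<alpha>(4)])
      have "smooth_real (\<lambda>y. B (real n * y + (- real n * p)) + (-1) * B (real n * y + (1 - real n * q)))"
        by (intro smooth_real_add smooth_real_mult smooth_real_const smooth_real_affine Bsm)
      then show "smooth_real (H p q n)" unfolding H_def[abs_def] by (simp add: algebra_simps)
      show "(H p q n has_real_derivative H' p q n t) (at t)" for t
        unfolding H_def[abs_def] H'_def
        by (rule derivative_eq_intros DERIV_chain2[OF B(1)] refl | simp)+
      show "H p q n t = 0" if "t \<notin> {p..q}" for t
      proof (cases "t < p")
        case True
        then have "real n * (t - p) \<le> 0" by (simp add: mult_nonneg_nonpos)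
        moreover have "real n * (t - q) = real n * (t - p) - real n * (q - p)" by (simp add: algebra_simps)
        ultimately show ?thesis using *(3) B(3) by (simp add: H_def)
      next
        case False
        then have "0 \<le> real n * (t - q)" using that by simp
        moreover have "real n * (t - p) = real n * (t - q) + real n * (q - p)" by (simp add: algebra_simps)
        ultimately show ?thesis using *(3) B(4) by (simp add: H_def)
      qed
      show "cbox (Complex a p) (Complex b q) \<subseteq> ball 0 1"
      proof
        fix z assume "z \<in> cbox (Complex a p) (Complex b q)"
        then have z: "a \<le> Re z" "Re z \<le> b" "p \<le> Im z" "Im z \<le> q" by (auto simp: in_cbox_complex_iff)
        have "(Re z)\<^sup>2 \<le> c\<^sup>2" by (rule power2_le_iff_abs_le[THEN iffD2]) (use z \<alpha> in auto)
        moreover have "(Im z)\<^sup>2 \<le> q\<^sup>2" using z * by (intro power_mono) auto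
        ultimately have "(norm z)\<^sup>2 < 1" using * by (simp add: cmod_power2)
        then show "z \<in> ball 0 1" by (simp add: power_less_one_iff abs_square_less_1)
      qed
    qed
  qed
  \<comment> \<open>One null set serves all rational rectangles and all n; the rectangles exhaust
    the upper half-disk.\<close>
  have ae_rat: "AE x in lborel. \<forall>(p::rat) (q::rat) (c::rat) n. 0 < p \<longrightarrow> p < q \<longrightarrow>
      1 \<le> real n * (of_rat q - of_rat p) \<longrightarrow> (of_rat c)\<^sup>2 + (of_rat q)\<^sup>2 < (1::real) \<longrightarrow>
      \<bar>x\<bar> < of_rat c \<longrightarrow> F (of_rat p) (of_rat q) n x = 0"
    unfolding AE_all_countable
  proof (intro allI)
    fix p q c :: rat and n
    show "AE x in lborel. 0 < p \<longrightarrow> p < q \<longrightarrow>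
      1 \<le> real n * (of_rat q - of_rat p) \<longrightarrow> (of_rat c)\<^sup>2 + (of_rat q)\<^sup>2 < (1::real) \<longrightarrow>
      \<bar>x\<bar> < of_rat c \<longrightarrow> F (of_rat p) (of_rat q) n x = 0"
    proof (cases "0 < p \<and> p < q \<and> 1 \<le> real n * (of_rat q - of_rat p) \<and> (of_rat c)\<^sup>2 + (of_rat q)\<^sup>2 < (1::real)")
      case True
      then have "AE x in lborel. \<bar>x\<bar> < of_rat c \<longrightarrow> F (of_rat p) (of_rat q) n x = 0"
        by (intro ae) (auto simp: of_rat_less)
      then show ?thesis by eventually_elim auto
    qed auto
  qed
  define m where "m x = (LINT y|lborel. norm (g' (Complex x y)))" for x
  have mi: "integrable lborel m"
    using lborel_pair.integrable_fst'[OF integrable_complex_pair(1)[OF integrable_norm[OF g']]] unfolding m_def[abs_def] by simp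
  have aef: "AE x in lborel. integrable lborel (\<lambda>y. f (Complex x y))"
    using lborel_pair.AE_integrable_fst'[OF integrable_complex_pair(1)[OF f]] by simp
  have aeg: "AE x in lborel. integrable lborel (\<lambda>y. g' (Complex x y))"
    using lborel_pair.AE_integrable_fst'[OF integrable_complex_pair(1)[OF g']] by simp
  have "AE x in lborel. \<forall>p q. 0 < p \<and> p \<le> q \<and> x\<^sup>2 + q\<^sup>2 < 1 \<longrightarrow> length_le (\<lambda>y. \<Phi> (Complex x y)) p q (m x)"
    using ae_rat aef aeg
  proof eventually_elim
    case (elim x)
    show ?case
    proof (intro allI impI)
      fix p q :: real assume pq: "0 < p \<and> p \<le> q \<and> x\<^sup>2 + q\<^sup>2 < 1"
      \<comment> \<open>The height at which the vertical line leaves the disk.\<close>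
      define s where "s = sqrt (1 - x\<^sup>2)"
      have s_iff: "t < s \<longleftrightarrow> x\<^sup>2 + t\<^sup>2 < 1" if "0 < t" for t
        using that real_less_rsqrt[of t "1 - x\<^sup>2"] real_sqrt_less_iff[of "t\<^sup>2" "1 - x\<^sup>2"]
        unfolding s_def by (auto simp: real_sqrt_abs algebra_simps)
      have inball: "Complex x t \<in> ball 0 1" if "0 < t" "t < s" for t
        using s_iff[OF that(1)] that(2) by (simp add: cmod_def)
      have "length_le (\<lambda>y. f (Complex x y)) p q (LINT y|lborel. norm (g' (Complex x y)))"
      proof (rule length_le_of_weak_derivative[OF B(1) \<beta>c B(2) B(5) B(3) B(4) B(6) B(7) elim(2,3)])
        show "isCont (\<lambda>y. f (Complex x y)) t" if t: "0 < t" "t < s" for t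
        proof -
          have "isCont \<Phi> (Complex x t)"
            using cont inball[OF t] by (simp add: continuous_on_eq_continuous_at)
          have "\<forall>\<^sub>F z in nhds (Complex x t). z \<in> ball 0 1"
            by (rule eventually_nhds_in_open[OF open_ball inball[OF t]])
          then have "\<forall>\<^sub>F z in nhds (Complex x t). f z = \<Phi> z"
            by eventually_elim (simp add: f_def)
          then have cf: "isCont f (Complex x t)" using \<open>isCont \<Phi> (Complex x t)\<close> by (simp add: isCont_cong)
          have "isCont (\<lambda>y. Complex x y) t" unfolding Complex_eq by (intro continuous_intros)
          then show ?thesis using cf by (rule isCont_o2)
        qed
        fix p q :: rat and n
        assume r: "0 < p" "p < q" "of_rat q < s" "1 \<le> real n * (of_rat q - of_rat p)"
        have "real_of_rat q > 0" using r by simp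
        then have "x\<^sup>2 + (of_rat q)\<^sup>2 < 1" using s_iff r(3) by blast
        \<comment> \<open>This leaves room for a rational half-width c such that the rectangle up to
          height q contains the abscissa \<open>x\<close> and still fits into the disk.\<close>
        then have "\<bar>x\<bar> < sqrt (1 - (of_rat q)\<^sup>2)"
          by (intro real_less_rsqrt) (simp add: algebra_simps)
        then obtain c where c: "\<bar>x\<bar> < of_rat c" "of_rat c < sqrt (1 - (of_rat q)\<^sup>2)" using of_rat_dense by blast
        have "(of_rat c)\<^sup>2 + (of_rat q)\<^sup>2 < (1::real)"
        proof -
          have "0 \<le> real_of_rat c" using c(1) by linarith
          then have "sqrt ((real_of_rat c)\<^sup>2) < sqrt (1 - (real_of_rat q)\<^sup>2)"
            using c(2) by (simp only: real_sqrt_abs abs_of_nonneg)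
          then show ?thesis unfolding real_sqrt_less_iff by linarith
        qed
        then show "(LINT y|lborel. (real n * \<beta> (real n * (y - of_rat p) + 0) - real n * \<beta> (real n * (y - of_rat q) + 1)) *\<^sub>R f (Complex x y)
         + (B (real n * (y - of_rat p) + 0) - B (real n * (y - of_rat q) + 1)) *\<^sub>R g' (Complex x y)) = 0"
          using elim(1) r c(1) unfolding F_def H_def H'_def by blast
      qed (use pq s_iff in auto)
      then show "length_le (\<lambda>y. \<Phi> (Complex x y)) p q (m x)"
        unfolding m_def
      proof (rule length_le_cong)
        fix t assume "t \<in> {p..q}"
        then have "0 < t" "t < s" using pq s_iff[of q] by auto
        then show "\<Phi> (Complex x t) = f (Complex x t)" using inball by (simp add: f_def)
      qed
    qed
  qed
  then show ?thesis using mi unfolding m_def by (intro exI[of _ m]) (auto simp: m_def[abs_def])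
qed

section \<open>The parametrization\<close>

text \<open>Every component of the complement of a Jordan curve has the entire curve as frontier. A
  component inside the curve puts \<open>J\<close> into the closure of \<Omega>; the opposite
  inclusion holds for the inside of any closed set.\<close>

lemma Jordan_domain_frontier:
  assumes "Jordan_domain \<Omega>" "\<Omega> \<noteq> {}"
  shows "open \<Omega>" and "\<exists>\<phi>. boundary_parametrization \<Omega> \<phi>"
proof -
  obtain J f g where J: "homeomorphism (sphere (0::complex) 1) J f g" "\<Omega> = inside J"
    using assms(1) unfolding Jordan_domain_def Jordan_curve_set_def by blast
  have "compact J"
    using homeomorphism_image1[OF J(1)] homeomorphism_cont1[OF J(1)] compact_continuous_image compact_sphere by metis
  then have cl: "closed J" by (rule compact_imp_closed)
  show op: "open \<Omega>" unfolding J(2) by (rule open_inside[OF cl])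
  obtain p where p: "p \<in> inside J" using assms(2) J(2) by blast
  define T where "T = connected_component_set (- J) p"
  have pJ: "p \<notin> J" using p by (simp add: inside_def)
  then have "T \<in> components (- J)" unfolding T_def by (intro componentsI) simp
  then have fT: "frontier T = J"
    by (intro Jordan_Brouwer_frontier[of J 0 1]) (use J(1) homeomorphic_sym homeomorphic_def in \<open>auto, blast\<close>)
  have "T \<subseteq> inside J" using p inside_same_component unfolding T_def by fastforce
  then have "J \<subseteq> closure (inside J)" using fT closure_mono[of T "inside J"] by (auto simp: frontier_def)
  moreover have "J \<inter> inside J = {}" using inside_no_overlap by blast
  ultimately have "J \<subseteq> frontier \<Omega>" unfolding J(2) frontier_def using interior_subset by blast
  moreover have "frontier \<Omega> \<subseteq> J" unfolding J(2) by (rule frontier_inside_subset[OF cl])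
  ultimately have "frontier \<Omega> = J" by blast
  then show "\<exists>\<phi>. boundary_parametrization \<Omega> \<phi>" using J(1) unfolding boundary_parametrization_def by blast
qed

lemma extension_image_ball:
  assumes "open \<Omega>" "boundary_parametrization \<Omega> \<phi>" "homeomorphism (cball 0 1) (closure \<Omega>) \<Phi> \<Psi>"
    and "\<forall>z\<in>sphere 0 1. \<Phi> z = \<phi> z"
  shows "\<Phi> ` ball 0 1 = \<Omega>"
proof -
  have inj: "inj_on \<Phi> (cball 0 1)" using assms(3) unfolding homeomorphism_def inj_on_def by metis
  have "\<Phi> ` sphere 0 1 = frontier \<Omega>"
    using assms(2,4) unfolding boundary_parametrization_def homeomorphism_def by (metis image_cong)
  moreover have "\<Phi> ` cball 0 1 = closure \<Omega>" using assms(3) by (rule homeomorphism_image1)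
  moreover have "\<Phi> ` (cball 0 1 - sphere 0 1) = \<Phi> ` cball 0 1 - \<Phi> ` sphere 0 1"
    by (rule inj_on_image_set_diff[OF inj]) auto
  moreover have "cball 0 1 - sphere 0 1 = ball (0::complex) 1" by auto
  moreover have "closure \<Omega> - frontier \<Omega> = \<Omega>"
    using assms(1) interior_subset[of \<Omega>] closure_subset[of \<Omega>] by (auto simp: frontier_def interior_open)
  ultimately show ?thesis by metis
qed

text \<open>Unlike the internal distance to \<open>x\<close> itself, this is obviously an open condition on \<open>x\<close>.\<close>

definition internally_far :: "complex set \<Rightarrow> complex \<Rightarrow> real \<Rightarrow> complex \<Rightarrow> bool" where
  "internally_far \<Omega> z K x \<longleftrightarrow> (\<exists>e>0. \<forall>q\<in>\<Omega> \<inter> ball x e. \<not> joinable \<Omega> K z q)"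

lemma internally_far_antimono:
  "internally_far \<Omega> z K x \<Longrightarrow> K' \<le> K \<Longrightarrow> internally_far \<Omega> z K' x"
  unfolding internally_far_def using joinable_mono by blast

lemma open_internally_far: "open {x. internally_far \<Omega> z K x}"
  unfolding open_contains_ball
proof safe
  fix x assume "internally_far \<Omega> z K x"
  then obtain e where e: "e > 0" "\<forall>q\<in>\<Omega> \<inter> ball x e. \<not> joinable \<Omega> K z q"
    unfolding internally_far_def by blast
  have "internally_far \<Omega> z K y" if "y \<in> ball x (e / 2)" for y
  proof -
    have "ball y (e / 2) \<subseteq> ball x e"
    proof
      fix q assume "q \<in> ball y (e / 2)"
      then show "q \<in> ball x e" using that dist_triangle[of x q y] by simp
    qed
    then show ?thesis unfolding internally_far_def using e by (intro exI[of _ "e / 2"]) auto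
  qed
  then show "\<exists>e>0. ball x e \<subseteq> {x. internally_far \<Omega> z K x}" using e(1) by (intro exI[of _ "e / 2"]) auto
qed

text \<open>If no boundary point were far, each would be joined to \<open>\<Phi> 0\<close> within 2K
  + 11, and passing through \<open>\<Phi> 0\<close> would bound the internal diameter.\<close>

lemma internally_far_boundary_point:
  assumes op: "open \<Omega>" and par: "boundary_parametrization \<Omega> \<phi>" and hom: "homeomorphism (cball 0 1) (closure \<Omega>) \<Phi> \<Psi>"
    and eq: "\<forall>z\<in>sphere 0 1. \<Phi> z = \<phi> z" and inf: "internal_diameter \<Omega> = \<infinity>"
  shows "\<exists>u\<in>sphere 0 1. internally_far \<Omega> (\<Phi> 0) K (\<phi> u)"
proof (rule ccontr)
  assume "\<not> ?thesis"
  then have near: "\<exists>q\<in>\<Omega> \<inter> ball (\<phi> u) e. joinable \<Omega> K (\<Phi> 0) q" if "u \<in> sphere 0 1" "e > 0" for u e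
    using that unfolding internally_far_def by blast
  have im: "\<Phi> ` ball 0 1 = \<Omega>" by (rule extension_image_ball[OF op par hom eq])
  define L where "L = 2 * K + 11"
  have join: "joinable (insert x \<Omega>) L (\<Phi> 0) x" if x: "x \<in> frontier \<Omega>" for x
  proof -
    obtain u where u: "u \<in> sphere 0 1" "x = \<phi> u"
      using par x unfolding boundary_parametrization_def homeomorphism_def by blast
    then have xu: "x = \<Phi> u" using eq by simp
    have "joinable (insert (\<Phi> u) \<Omega>) (2 * K + 11) (\<Phi> 0) (\<Phi> u)"
    proof (rule joinable_boundary_point[OF hom im])
      fix e :: real assume "e > 0"
      then show "\<exists>q\<in>\<Omega> \<inter> ball (\<Phi> u) e. joinable \<Omega> K (\<Phi> 0) q" using near[OF u(1)] u(2) xu by simp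
    qed (use u in simp)
    then show ?thesis by (simp add: xu L_def)
  qed
  have "internal_dist \<Omega> x y \<le> ennreal (L + L)" if "x \<in> frontier \<Omega>" "y \<in> frontier \<Omega>" for x y
  proof (rule joinable_Un_internal_dist, rule joinable_trans)
    show "joinable (\<Omega> \<union> {x, y}) L x (\<Phi> 0)"
      by (rule joinable_sym, rule joinable_mono[OF join[OF that(1)]]) auto
    show "joinable (\<Omega> \<union> {x, y}) L (\<Phi> 0) y"
      by (rule joinable_mono[OF join[OF that(2)]]) auto
  qed
  then have "internal_diameter \<Omega> \<le> ennreal (L + L)"
    unfolding internal_diameter_def by (intro SUP_least) auto
  then show False using inf by (simp add: top_unique)
qed

text \<open>\<open>P\<close> is a line of slope 7/8 plus weighted ramps \<open>k n\<close>, each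
  rising from 0 to 1 across its interval. The weights sum to 1/4, exactly what the line loses over
  the length 2, so the endpoints are fixed; the line keeps \<open>P\<close> strictly increasing. The
  intervals may overlap or nest, because the ramps are simply added. For |x| at most 1/8, |P x| is
  at most 15/64.\<close>

lemma expanding_homeomorphism_interval:
  fixes a b :: "nat \<Rightarrow> real"
  assumes ab: "\<And>n. a n < b n" "\<And>n. - 1 / 8 < a n" "\<And>n. b n < 1 / 8"
  shows "\<exists>P. continuous_on {- 1..1} P \<and> strict_mono_on {- 1..1} P \<and> P (- 1) = - 1 \<and> P 1 = (1::real) \<and>
     (\<forall>n. (1/2) ^ n / 8 \<le> P (b n) - P (a n)) \<and> (\<forall>x. \<bar>x\<bar> \<le> 1 / 8 \<longrightarrow> \<bar>P x\<bar> < 1 / 2)"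
proof -
  define c :: "nat \<Rightarrow> real" where "c n = (1/2) ^ n / 8" for n
  define k where "k n x = max 0 (min 1 ((x - a n) / (b n - a n)))" for n x
  define s where "s x = (\<Sum>n. c n * k n x)" for x
  define P where "P x = x - (x + 1) / 8 + s x" for x
  have c0: "c n > 0" for n by (simp add: c_def)
  have c_sums: "c sums (1 / 4)"
    using sums_divide[OF geometric_sums[of "1/2::real"], of 8] by (simp add: c_def[abs_def])
  have k01: "0 \<le> k n x" "k n x \<le> 1" for n x by (auto simp: k_def)
  have k_mono: "k n x \<le> k n y" if "x \<le> y" for n x y
  proof -
    have "(x - a n) / (b n - a n) \<le> (y - a n) / (b n - a n)"
      using that ab(1)[of n] by (intro divide_right_mono) auto
    then show ?thesis by (auto simp: k_def)
  qed
  have ck: "norm (c n * k n x) \<le> c n" for n x using c0[of n] k01[of n x] by (simp add: mult_left_le)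
  have sm: "summable (\<lambda>n. c n * k n x)" for x
    by (rule summable_comparison_test'[OF sums_summable[OF c_sums], of 0]) (use ck in auto)
  have s0: "0 \<le> s x" for x unfolding s_def using c0 k01 by (intro suminf_nonneg sm) (simp add: less_imp_le)
  have s1: "s x \<le> 1 / 4" for x
  proof -
    have "s x \<le> suminf c"
      unfolding s_def using ck by (intro suminf_le sm sums_summable[OF c_sums]) (simp add: abs_le_iff)
    then show ?thesis using sums_unique[OF c_sums] by simp
  qed
  have s_diff: "c n * (k n y - k n x) \<le> s y - s x" if "x \<le> y" for n x y
  proof -
    have d: "0 \<le> c i * k i y - c i * k i x" for i
      using k_mono[OF that, of i] c0[of i] by (simp add: mult_left_mono)
    have sd: "summable (\<lambda>i. c i * k i y - c i * k i x)" by (intro summable_diff sm)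
    have "(\<Sum>i\<in>{n}. c i * k i y - c i * k i x) \<le> (\<Sum>i. c i * k i y - c i * k i x)"
      by (rule sum_le_suminf[OF sd]) (use d in auto)
    also have "\<dots> = s y - s x" unfolding s_def by (rule suminf_diff[symmetric]) (rule sm)+
    finally show ?thesis by (simp add: right_diff_distrib)
  qed
  have s_mono: "s x \<le> s y" if "x \<le> y" for x y
  proof -
    have "0 \<le> c 0 * (k 0 y - k 0 x)" using k_mono[OF that] c0 by (simp add: less_imp_le)
    then show ?thesis using s_diff[OF that, of 0] by linarith
  qed
  have s_cont: "continuous_on UNIV s"
  proof (rule uniform_limit_theorem)
    show "uniform_limit UNIV (\<lambda>n x. \<Sum>i<n. c i * k i x) s sequentially"
      unfolding s_def by (rule Weierstrass_m_test[OF ck sums_summable[OF c_sums]])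
    show "\<forall>\<^sub>F n in sequentially. continuous_on UNIV (\<lambda>x. \<Sum>i<n. c i * k i x)"
      unfolding k_def using ab(1) by (intro always_eventually allI continuous_intros) (auto simp: less_imp_neq[symmetric])
  qed simp
  have P_diff: "7 / 8 * (y - x) \<le> P y - P x" if "x \<le> y" for x y
    using s_mono[OF that] by (simp add: P_def field_simps)
  have k_lo: "k n x = 0" if "x \<le> a n" for n x
  proof -
    have "(x - a n) / (b n - a n) \<le> 0" using that ab(1)[of n] by (intro divide_nonpos_pos) auto
    then show ?thesis by (simp add: k_def)
  qed
  have k_hi: "k n x = 1" if "b n \<le> x" for n x
  proof -
    have "1 \<le> (x - a n) / (b n - a n)" using that ab(1)[of n] by simp
    then show ?thesis by (simp add: k_def)
  qed
  show ?thesis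
  proof (intro exI conjI allI impI)
    show "continuous_on {- 1..1} P"
      unfolding P_def by (intro continuous_intros continuous_on_subset[OF s_cont]) auto
    show "strict_mono_on {- 1..1} P"
    proof (rule strict_mono_onI)
      fix x y :: real assume "x < y"
      then have "0 < 7 / 8 * (y - x)" by simp
      then show "P x < P y" using P_diff[of x y] \<open>x < y\<close> by linarith
    qed
    have "k n (- 1) = 0" for n using ab(2)[of n] by (intro k_lo) auto
    then show "P (- 1) = - 1" by (simp add: P_def s_def)
    have "k n 1 = 1" for n using ab(3)[of n] by (intro k_hi) auto
    then show "P 1 = 1" using sums_unique[OF c_sums] by (simp add: P_def s_def)
    show "(1/2) ^ n / 8 \<le> P (b n) - P (a n)" for n
    proof -
      have "c n \<le> s (b n) - s (a n)"
        using s_diff[of "a n" "b n" n] ab(1)[of n] k_lo[of "a n" n] k_hi[of n "b n"] by simp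
      moreover have "0 \<le> 7 / 8 * (b n - a n)" using ab(1)[of n] by simp
      moreover have "P (b n) - P (a n) = 7 / 8 * (b n - a n) + (s (b n) - s (a n))"
        by (simp add: P_def field_simps)
      ultimately show ?thesis unfolding c_def by linarith
    qed
    show "\<bar>P x\<bar> < 1 / 2" if "\<bar>x\<bar> \<le> 1 / 8" for x
      using that s0[of x] s1[of x] unfolding P_def abs_less_iff by (auto simp: abs_le_iff field_simps)
  qed
qed

text \<open>Parametrized by the abscissa, so that \<open>upper_arc x\<close> is the upper end of the
  vertical segment over \<open>x\<close>.\<close>

definition upper_arc :: "real \<Rightarrow> complex" where
  "upper_arc x = Complex x (sqrt (1 - x\<^sup>2))"

lemma upper_arc_simps: "Re (upper_arc x) = x" "Im (upper_arc x) = sqrt (1 - x\<^sup>2)"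
  by (simp_all add: upper_arc_def)

lemma continuous_on_upper_arc: "continuous_on S upper_arc"
  unfolding upper_arc_def Complex_eq by (intro continuous_intros)

lemma upper_arc_sphere: "\<bar>x\<bar> \<le> 1 \<Longrightarrow> upper_arc x \<in> sphere 0 1"
  by (simp add: upper_arc_def cmod_def abs_square_le_1)

lemma upper_arc_Im_nonneg: "\<bar>x\<bar> \<le> 1 \<Longrightarrow> 0 \<le> Im (upper_arc x)"
  by (simp add: upper_arc_def abs_square_le_1)

lemma upper_arc_Re: "z \<in> sphere 0 1 \<Longrightarrow> 0 \<le> Im z \<Longrightarrow> upper_arc (Re z) = z"
proof -
  assume z: "z \<in> sphere 0 1" "0 \<le> Im z"
  then have "(Re z)\<^sup>2 + (Im z)\<^sup>2 = 1" by (simp add: cmod_def)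
  then have "1 - (Re z)\<^sup>2 = (Im z)\<^sup>2" by simp
  then show ?thesis using z(2) by (simp add: upper_arc_def complex_eq_iff)
qed

text \<open>\<open>P\<close> acts on abscissas of the upper half-circle and the lower half stays
  fixed; the definitions agree at -1 and 1, the fixed endpoints of \<open>P\<close>. Compactness
  supplies continuity of the inverse.\<close>

lemma sphere_homeomorphism_upper_arc:
  assumes P: "continuous_on {- 1..1} P" "strict_mono_on {- 1..1} P" "P (- 1) = - 1" "P 1 = (1::real)"
  shows "\<exists>T T'. homeomorphism (sphere 0 1) (sphere 0 1) T T' \<and> (\<forall>x\<in>{- 1..1}. T (upper_arc x) = upper_arc (P x))"
proof -
  define T where "T z = (if 0 \<le> Im z then upper_arc (P (Re z)) else z)" for z
  have Re1: "Re z \<in> {- 1..1}" if "z \<in> sphere 0 1" for z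
    using that abs_Re_le_cmod[of z] by (auto simp: abs_le_iff)
  have P1: "P x \<in> {- 1..1}" if "x \<in> {- 1..1}" for x
    using strict_mono_onD[OF P(2), of "- 1" x] strict_mono_onD[OF P(2), of x 1] P(3,4) that
    by (cases "x = - 1"; cases "x = 1") auto
  have surjP: "\<exists>x\<in>{- 1..1}. P x = y" if "y \<in> {- 1..1}" for y
    using IVT'[of P "- 1" y 1] P that by auto
  have T_Im: "0 \<le> Im (T z) \<longleftrightarrow> 0 \<le> Im z" if "z \<in> sphere 0 1" for z
    using P1[OF Re1[OF that]] upper_arc_Im_nonneg[of "P (Re z)"] by (auto simp: T_def abs_le_iff)
  have cont: "continuous_on (sphere 0 1) T"
  proof -
    have "continuous_on ((sphere 0 1 \<inter> {z. Im z \<ge> 0}) \<union> (sphere 0 1 \<inter> {z. Im z \<le> 0}))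
        (\<lambda>z. if 0 \<le> Im z then upper_arc (P (Re z)) else z)"
    proof (rule continuous_on_cases)
      show "closed (sphere 0 1 \<inter> {z. Im z \<ge> 0})" "closed (sphere 0 1 \<inter> {z. Im z \<le> 0})"
        by (auto intro!: closed_Int closed_halfspace_Im_ge closed_halfspace_Im_le)
      have "continuous_on (sphere 0 1 \<inter> {z. 0 \<le> Im z}) (\<lambda>z. P (Re z))"
        by (rule continuous_on_compose2[OF P(1)]) (use Re1 in \<open>auto intro!: continuous_intros\<close>)
      then show "continuous_on (sphere 0 1 \<inter> {z. 0 \<le> Im z}) (\<lambda>z. upper_arc (P (Re z)))"
        by (rule continuous_on_compose2[OF continuous_on_upper_arc[of UNIV]]) auto
      show "\<forall>z. z \<in> sphere 0 1 \<inter> {z. 0 \<le> Im z} \<and> \<not> 0 \<le> Im z \<or> z \<in> sphere 0 1 \<inter> {z. Im z \<le> 0} \<and> 0 \<le> Im z \<longrightarrow>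
          upper_arc (P (Re z)) = z"
      proof (intro allI impI)
        fix z assume "z \<in> sphere 0 1 \<inter> {z. 0 \<le> Im z} \<and> \<not> 0 \<le> Im z \<or> z \<in> sphere 0 1 \<inter> {z. Im z \<le> 0} \<and> 0 \<le> Im z"
        then have z: "z \<in> sphere 0 1" "Im z = 0" by auto
        then have "\<bar>Re z\<bar> = 1" by (simp add: cmod_def)
        then have "P (Re z) = Re z" using P(3,4) by (auto simp: abs_if split: if_splits)
        then show "upper_arc (P (Re z)) = z" using upper_arc_Re z by simp
      qed
    qed (rule continuous_on_id)
    moreover have "(sphere 0 1 \<inter> {z. Im z \<ge> 0}) \<union> (sphere 0 1 \<inter> {z. Im z \<le> 0}) = sphere 0 1" by auto
    ultimately show ?thesis unfolding T_def[abs_def] by simp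
  qed
  have inj: "inj_on T (sphere 0 1)"
  proof (rule inj_onI)
    fix z w assume zw: "z \<in> sphere 0 1" "w \<in> sphere 0 1" "T z = T w"
    show "z = w"
    proof (cases "0 \<le> Im z")
      case True
      then have w: "0 \<le> Im w" using T_Im zw by metis
      have "P (Re z) = P (Re w)" using zw(3) True w upper_arc_simps(1) unfolding T_def by metis
      then have "Re z = Re w"
        using strict_mono_on_imp_inj_on[OF P(2)] Re1 zw by (auto dest: inj_onD)
      then show ?thesis using upper_arc_Re zw True w by metis
    next
      case False
      then have "\<not> 0 \<le> Im w" using T_Im zw by metis
      then show ?thesis using False zw(3) by (simp add: T_def)
    qed
  qed
  have surj: "T ` sphere 0 1 = sphere 0 1"
  proof
    show "T ` sphere 0 1 \<subseteq> sphere 0 1"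
      using P1 Re1 upper_arc_sphere by (fastforce simp: T_def abs_le_iff)
    show "sphere 0 1 \<subseteq> T ` sphere 0 1"
    proof
      fix w assume w: "w \<in> sphere (0::complex) 1"
      show "w \<in> T ` sphere 0 1"
      proof (cases "0 \<le> Im w")
        case True
        obtain x where x: "x \<in> {- 1..1}" "P x = Re w" using surjP[OF Re1[OF w]] by blast
        then have "T (upper_arc x) = w" "upper_arc x \<in> sphere 0 1"
          using upper_arc_Im_nonneg[of x] upper_arc_Re[OF w True] upper_arc_sphere[of x]
          by (auto simp: T_def upper_arc_simps abs_le_iff)
        then show ?thesis by (metis imageI)
      next
        case False
        then have "T w = w" by (simp add: T_def)
        then show ?thesis using w by (metis imageI)
      qed
    qed
  qed
  obtain T' where "homeomorphism (sphere 0 1) (sphere 0 1) T T'"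
    using homeomorphism_compact[OF compact_sphere cont surj inj] by blast
  moreover have "T (upper_arc x) = upper_arc (P x)" if "x \<in> {- 1..1}" for x
    using that upper_arc_Im_nonneg[of x] by (auto simp: T_def upper_arc_simps abs_le_iff)
  ultimately show ?thesis by blast
qed

text \<open>Compactness collects the far points for all K near one point of the circle, rotation
  brings it to \<i>, openness turns the points into intervals of abscissas, and the stretching map
  makes the intervals long enough.\<close>

lemma internally_far_parametrization:
  assumes par0: "boundary_parametrization \<Omega> \<phi>0"
    and far: "\<And>K. \<exists>u\<in>sphere 0 1. internally_far \<Omega> z K (\<phi>0 u)"
  shows "\<exists>\<phi> a b. boundary_parametrization \<Omega> \<phi> \<and> (\<forall>n. - 1 / 2 < a n \<and> b n < 1 / 2 \<and> (1/2) ^ n / 8 \<le> b n - a n \<and>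
    (\<forall>x\<in>{a n..b n}. internally_far \<Omega> z (8 * 2 ^ n * real n) (\<phi> (upper_arc x))))"
proof -
  obtain \<psi>0 where \<psi>0: "homeomorphism (sphere 0 1) (frontier \<Omega>) \<phi>0 \<psi>0"
    using par0 unfolding boundary_parametrization_def by blast
  have cont0: "continuous_on (sphere 0 1) \<phi>0" using \<psi>0 homeomorphism_cont1 by blast
  obtain u where u: "\<And>n::nat. u n \<in> sphere 0 1" "\<And>n. internally_far \<Omega> z (real n) (\<phi>0 (u n))"
  proof -
    have "\<forall>n. \<exists>v. v \<in> sphere 0 1 \<and> internally_far \<Omega> z (real n) (\<phi>0 v)" using far by blast
    then show ?thesis using that by metis
  qed
  obtain w r where w: "w \<in> sphere 0 1" "strict_mono r" "(u \<circ> r) \<longlonglongrightarrow> w"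
    using compact_imp_seq_compact[OF compact_sphere, of "0::complex" 1] u(1) unfolding seq_compact_def by blast
  have w1: "norm w = 1" using w(1) by simp
  \<comment> \<open>This rotation takes \<i> to \<open>w\<close>.\<close>
  define rot where "rot v = - \<i> * w * v" for v
  define \<phi>1 where "\<phi>1 v = \<phi>0 (rot v)" for v
  have "homeomorphism (sphere 0 1) (sphere 0 1) rot (\<lambda>v. \<i> * cnj w * v)"
  proof (rule homeomorphismI)
    have "w * cnj w = 1" using w1 by (simp add: complex_norm_square[symmetric])
    then show "\<i> * cnj w * rot v = v" "rot (\<i> * cnj w * v) = v" for v
      by (simp_all add: rot_def algebra_simps)
  qed (use w1 in \<open>auto simp: rot_def norm_mult intro!: continuous_intros\<close>)
  from homeomorphism_compose[OF this \<psi>0]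
  obtain \<psi>1 where \<psi>1: "homeomorphism (sphere 0 1) (frontier \<Omega>) \<phi>1 \<psi>1"
    unfolding \<phi>1_def[abs_def] comp_def by blast
  have cont1: "continuous_on (sphere 0 1) \<phi>1" using \<psi>1 homeomorphism_cont1 by blast
  \<comment> \<open>A far point close to the accumulation point lies, after rotation, close to \<i>,
    hence on the upper half-circle with small abscissa. Indices increase along the subsequence, so
    it is far enough for the given \<open>K\<close>.\<close>
  have near: "\<exists>x. \<bar>x\<bar> < 1 / 8 \<and> internally_far \<Omega> z K (\<phi>1 (upper_arc x))" for K
  proof -
    have "\<forall>\<^sub>F n in sequentially. dist ((u \<circ> r) n) w < 1 / 8" using w(3) by (rule tendstoD) simp
    moreover have "\<forall>\<^sub>F n in sequentially. K \<le> real n"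
      using filterlim_real_sequentially unfolding filterlim_at_top by blast
    ultimately have "\<forall>\<^sub>F n in sequentially. dist ((u \<circ> r) n) w < 1 / 8 \<and> K \<le> real n" by (rule eventually_conj)
    then obtain n where n: "dist (u (r n)) w < 1 / 8" "K \<le> real n" by (auto simp: eventually_sequentially)
    define v where "v = \<i> * cnj w * u (r n)"
    have "w * cnj w = 1" using w1 by (simp add: complex_norm_square[symmetric])
    then have rv: "rot v = u (r n)" by (simp add: rot_def v_def algebra_simps)
    have v1: "v \<in> sphere 0 1" using w1 u(1)[of "r n"] by (simp add: v_def norm_mult)
    have "v - \<i> = \<i> * cnj w * (u (r n) - w)" using \<open>w * cnj w = 1\<close> by (simp add: v_def algebra_simps)
    then have "norm (v - \<i>) < 1 / 8" using n(1) w1 by (simp add: norm_mult dist_norm)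
    then have re: "\<bar>Re v\<bar> < 1 / 8" and im: "\<bar>Im v - 1\<bar> < 1 / 8"
      using abs_Re_le_cmod[of "v - \<i>"] abs_Im_le_cmod[of "v - \<i>"] by auto
    have "0 \<le> Im v" using im by linarith
    then have "upper_arc (Re v) = v" by (rule upper_arc_Re[OF v1])
    moreover have "K \<le> real (r n)" using n(2) seq_suble[OF w(2), of n] by linarith
    then have "internally_far \<Omega> z K (\<phi>1 v)"
      unfolding \<phi>1_def rv using u(2) internally_far_antimono by blast
    ultimately show ?thesis using re by (intro exI[of _ "Re v"]) simp
  qed
  have "\<exists>a b. a < b \<and> - 1 / 8 < a \<and> b < 1 / 8 \<and> (\<forall>x\<in>{a..b}. internally_far \<Omega> z K (\<phi>1 (upper_arc x)))" for K
  proof -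
    obtain x where x: "\<bar>x\<bar> < 1 / 8" "internally_far \<Omega> z K (\<phi>1 (upper_arc x))" using near by blast
    have "continuous_on {- 1 / 8<..<1 / 8} (\<lambda>x. \<phi>1 (upper_arc x))"
    proof (rule continuous_on_compose2[OF cont1 continuous_on_upper_arc])
      show "upper_arc ` {- 1 / 8<..<1 / 8} \<subseteq> sphere 0 1" using upper_arc_sphere by (auto simp: abs_le_iff)
    qed
    then have "open ((\<lambda>x. \<phi>1 (upper_arc x)) -` {x. internally_far \<Omega> z K x} \<inter> {- 1 / 8<..<1 / 8})"
      using open_internally_far continuous_on_open_vimage[OF open_greaterThanLessThan] by blast
    moreover have "x \<in> (\<lambda>x. \<phi>1 (upper_arc x)) -` {x. internally_far \<Omega> z K x} \<inter> {- 1 / 8<..<1 / 8}"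
      using x by (auto simp: abs_less_iff)
    ultimately obtain e where e: "e > 0"
      "cball x e \<subseteq> (\<lambda>x. \<phi>1 (upper_arc x)) -` {x. internally_far \<Omega> z K x} \<inter> {- 1 / 8<..<1 / 8}"
      unfolding open_contains_cball by blast
    have sub: "{x - e..x + e} \<subseteq> (\<lambda>x. \<phi>1 (upper_arc x)) -` {x. internally_far \<Omega> z K x} \<inter> {- 1 / 8<..<1 / 8}"
      using e(2) by (simp add: cball_eq_atLeastAtMost)
    have "- 1 / 8 < x - e" "x + e < 1 / 8"
      using subsetD[OF sub, of "x - e"] subsetD[OF sub, of "x + e"] e(1) by auto
    moreover have "\<forall>y\<in>{x - e..x + e}. internally_far \<Omega> z K (\<phi>1 (upper_arc y))" using sub by auto
    ultimately show ?thesis using e(1) by (intro exI[of _ "x - e"] exI[of _ "x + e"]) auto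
  qed
  then have "\<forall>n. \<exists>a b. a < b \<and> - 1 / 8 < a \<and> b < 1 / 8 \<and>
      (\<forall>x\<in>{a..b}. internally_far \<Omega> z (8 * 2 ^ n * real n) (\<phi>1 (upper_arc x)))" by blast
  then obtain a b where ab: "\<And>n. a n < b n" "\<And>n. - 1 / 8 < a n" "\<And>n. b n < 1 / 8"
      "\<And>n x. x \<in> {a n..b n} \<Longrightarrow> internally_far \<Omega> z (8 * 2 ^ n * real n) (\<phi>1 (upper_arc x))"
    by metis
  obtain P where P: "continuous_on {- 1..1} P" "strict_mono_on {- 1..1} P" "P (- 1) = - 1" "P 1 = (1::real)"
      "\<And>n. (1/2) ^ n / 8 \<le> P (b n) - P (a n)" "\<And>x. \<bar>x\<bar> \<le> 1 / 8 \<Longrightarrow> \<bar>P x\<bar> < 1 / 2"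
    using expanding_homeomorphism_interval[of a b, OF ab(1-3)] by metis
  obtain T T' where T: "homeomorphism (sphere 0 1) (sphere 0 1) T T'" "\<And>x. x \<in> {- 1..1} \<Longrightarrow> T (upper_arc x) = upper_arc (P x)"
    using sphere_homeomorphism_upper_arc[OF P(1-4)] by blast
  \<comment> \<open>The inverse \<open>T'\<close> precedes \<open>\<phi>1\<close>: the new
    parametrization takes at abscissa P y the value of \<open>\<phi>1\<close> at y, so it spends the
    interval from P (a n) to P (b n) on the far points.\<close>
  have "homeomorphism (sphere 0 1) (frontier \<Omega>) (\<phi>1 \<circ> T') (T \<circ> \<psi>1)"
    by (rule homeomorphism_compose[OF homeomorphism_symD[OF T(1)] \<psi>1])
  then have "boundary_parametrization \<Omega> (\<phi>1 \<circ> T')" unfolding boundary_parametrization_def by blast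
  moreover have "- 1 / 2 < P (a n)" "P (b n) < 1 / 2" for n
  proof -
    have "\<bar>a n\<bar> \<le> 1 / 8" "\<bar>b n\<bar> \<le> 1 / 8" using ab(1-3)[of n] by linarith+
    then have "\<bar>P (a n)\<bar> < 1 / 2" "\<bar>P (b n)\<bar> < 1 / 2" using P(6) by auto
    then show "- 1 / 2 < P (a n)" "P (b n) < 1 / 2" by linarith+
  qed
  moreover have "internally_far \<Omega> z (8 * 2 ^ n * real n) ((\<phi>1 \<circ> T') (upper_arc x))"
    if x: "x \<in> {P (a n)..P (b n)}" for n x
  proof -
    have "continuous_on {a n..b n} P" using ab(2,3)[of n] by (intro continuous_on_subset[OF P(1)]) auto
    then obtain y where y: "y \<in> {a n..b n}" "P y = x"
      using IVT'[of P "a n" x "b n"] x ab(1)[of n] by auto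
    have y1: "y \<in> {- 1..1}" using y(1) ab(2,3)[of n] by auto
    then have "upper_arc y \<in> sphere 0 1" by (intro upper_arc_sphere) (auto simp: abs_le_iff)
    then have "T' (upper_arc x) = upper_arc y"
      using T(2)[OF y1] y(2) homeomorphism_apply1[OF T(1)] by metis
    then show ?thesis using ab(4)[OF y(1)] by simp
  qed
  ultimately show ?thesis using P(5) by (intro exI[of _ "\<phi>1 \<circ> T'"] exI[of _ "\<lambda>n. P (a n)"] exI[of _ "\<lambda>n. P (b n)"]) blast
qed

text \<open>Travel from \<open>z\<close> to the image of a fixed horizontal segment at cost at most
  \<open>C\<close>, then up the image of a vertical segment at cost at most \<open>m x\<close>. This
  comes arbitrarily close to the boundary point over \<open>x\<close>, which therefore cannot be far
  at the level of the total cost.\<close>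

lemma W11_extension_internal_bound:
  assumes op: "open \<Omega>" and par: "boundary_parametrization \<Omega> \<phi>" and ext: "homeomorphic_W11_extension \<Omega> \<phi> \<Phi>"
    and z: "z \<in> \<Omega>"
  shows "\<exists>m C. integrable lborel m \<and> (\<forall>x. 0 \<le> m x) \<and> 0 \<le> C \<and>
     (AE x in lborel. \<bar>x\<bar> < 1 / 2 \<longrightarrow> (\<forall>K. internally_far \<Omega> z K (\<phi> (upper_arc x)) \<longrightarrow> K < C + m x))"
proof -
  obtain \<Psi> where hom: "homeomorphism (cball 0 1) (closure \<Omega>) \<Phi> \<Psi>" and eq: "\<forall>z\<in>sphere 0 1. \<Phi> z = \<phi> z"
    and W: "sobolev_W11 (ball 0 1) \<Phi>"
    using ext unfolding homeomorphic_W11_extension_def by blast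
  have im: "\<Phi> ` ball 0 1 = \<Omega>" by (rule extension_image_ball[OF op par hom eq])
  have cont: "continuous_on (cball 0 1) \<Phi>" using hom by (rule homeomorphism_cont1)
  have cb: "continuous_on (ball 0 1) \<Phi>" by (rule continuous_on_subset[OF cont]) auto
  have "\<i> \<in> Basis" by (simp add: Basis_complex_def)
  then obtain g where g: "g absolutely_integrable_on ball 0 1" "weak_partial_derivative (ball 0 1) \<i> \<Phi> g"
    using W unfolding sobolev_W11_def by blast
  have ai: "\<Phi> absolutely_integrable_on ball 0 1" using W unfolding sobolev_W11_def by blast
  obtain m where m: "integrable lborel m" "\<forall>x. 0 \<le> m x" "AE x in lborel. \<forall>p q. 0 < p \<and> p \<le> q \<and> x\<^sup>2 + q\<^sup>2 < 1 \<longrightarrow>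
      length_le (\<lambda>y. \<Phi> (Complex x y)) p q (m x)"
    using vertical_length_bound[OF cb ai g] by blast
  have con: "connected \<Omega>" unfolding im[symmetric]
    by (intro connected_continuous_image cb convex_connected) auto
  \<comment> \<open>The height 1/4 is positive, as the bound on vertical segments demands, and keeps
    the segment over the abscissas from -1/2 to 1/2 in a compact part of the disk.\<close>
  define S where "S = (\<lambda>x. \<Phi> (Complex x (1/4))) ` {- 1/2..1/2}"
  have quarter: "Complex x (1/4) \<in> ball 0 1" if "x \<in> {- 1/2..1/2}" for x
  proof -
    have "x\<^sup>2 \<le> (1/2)\<^sup>2" by (rule power2_le_iff_abs_le[THEN iffD2]) (use that in \<open>auto simp: abs_le_iff\<close>)
    then show ?thesis by (simp add: cmod_def power2_eq_square)
  qed
  have "continuous_on {- 1/2..1/2} (\<lambda>x. \<Phi> (Complex x (1/4)))"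
    by (rule continuous_on_compose2[OF cb]) (use quarter in \<open>auto simp: Complex_eq intro!: continuous_intros\<close>)
  then have "compact S" unfolding S_def by (intro compact_continuous_image) auto
  moreover have "S \<subseteq> \<Omega>" unfolding S_def using quarter im by blast
  ultimately obtain C where C: "\<And>q. q \<in> S \<Longrightarrow> joinable \<Omega> C z q"
    using joinable_bounded_on_compact[OF op con _ _ z] by metis
  have "\<Phi> (Complex 0 (1/4)) \<in> S" unfolding S_def by (rule imageI) simp
  then have C0: "0 \<le> C" using C joinable_nonneg by blast
  have "AE x in lborel. \<bar>x\<bar> < 1 / 2 \<longrightarrow> (\<forall>K. internally_far \<Omega> z K (\<phi> (upper_arc x)) \<longrightarrow> K < C + m x)"
    using m(3)
  proof eventually_elim
    case (elim x)
    show ?case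
    proof (intro allI impI)
      fix K assume x: "\<bar>x\<bar> < 1 / 2" and far: "internally_far \<Omega> z K (\<phi> (upper_arc x))"
      define s where "s = sqrt (1 - x\<^sup>2)"
      have "\<bar>x\<bar>\<^sup>2 < (1/2)\<^sup>2" using x by (intro power_strict_mono) auto
      then have x2: "x\<^sup>2 < 1 / 4" by (simp add: power2_eq_square)
      have s: "1 / 4 < s" unfolding s_def by (rule real_less_rsqrt) (use x2 in \<open>simp add: power2_eq_square\<close>)
      have s2: "x\<^sup>2 + q\<^sup>2 < 1" if "1 / 4 \<le> q" "q < s" for q
      proof -
        have "q\<^sup>2 < s\<^sup>2" using that by (intro power_strict_mono) auto
        then show ?thesis using x2 by (simp add: s_def)
      qed
      have ax: "upper_arc x \<in> sphere 0 1" using x by (intro upper_arc_sphere) auto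
      obtain e where e: "e > 0" "\<forall>q\<in>\<Omega> \<inter> ball (\<phi> (upper_arc x)) e. \<not> joinable \<Omega> K z q"
        using far unfolding internally_far_def by blast
      have "\<phi> (upper_arc x) = \<Phi> (upper_arc x)" using eq ax by simp
      moreover obtain d where d: "d > 0" "\<And>v. v \<in> cball 0 1 \<Longrightarrow> dist v (upper_arc x) < d \<Longrightarrow> dist (\<Phi> v) (\<Phi> (upper_arc x)) < e"
        using cont ax e(1) unfolding continuous_on_iff by (metis sphere_cball subsetD)
      \<comment> \<open>High enough that the image of the endpoint falls within \<open>e\<close> of
        the boundary point, yet strictly inside the disk and not below the starting height.\<close>
      define q where "q = max (1 / 4) (s - d / 2)"
      have q: "1 / 4 \<le> q" "q < s" "s - q < d" using s d(1) by (auto simp: q_def max_def)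
      have inb: "Complex x t \<in> ball 0 1" if "1 / 4 \<le> t" "t < s" for t using s2[OF that] by (simp add: cmod_def)
      have "Complex x q - upper_arc x = of_real (q - s) * \<i>"
        by (simp add: upper_arc_def s_def complex_eq_iff)
      then have "dist (Complex x q) (upper_arc x) = \<bar>q - s\<bar>" by (simp add: dist_norm norm_mult del: of_real_diff)
      then have "dist (\<Phi> (Complex x q)) (\<Phi> (upper_arc x)) < e"
        using q inb[OF q(1,2)] by (intro d(2)) auto
      ultimately have "\<Phi> (Complex x q) \<in> ball (\<phi> (upper_arc x)) e" by (simp add: dist_commute)
      moreover have "\<Phi> (Complex x q) \<in> \<Omega>" using inb[OF q(1,2)] im by blast
      ultimately have nj: "\<not> joinable \<Omega> K z (\<Phi> (Complex x q))" using e(2) by blast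
      have "joinable \<Omega> (m x) (\<Phi> (Complex x (1/4))) (\<Phi> (Complex x q))"
      proof (rule joinable_interval)
        show "continuous_on {1/4..q} (\<lambda>y. \<Phi> (Complex x y))"
          by (rule continuous_on_compose2[OF cb]) (use inb q in \<open>auto simp: Complex_eq intro!: continuous_intros\<close>)
        show "(\<lambda>y. \<Phi> (Complex x y)) ` {1/4..q} \<subseteq> \<Omega>" using inb q im by fastforce
        show "length_le (\<lambda>y. \<Phi> (Complex x y)) (1/4) q (m x)"
          using elim[rule_format, of "1/4" q] q s2 by auto
      qed (rule q)
      moreover have "joinable \<Omega> C z (\<Phi> (Complex x (1/4)))"
      proof (rule C)
        have "x \<in> {- 1/2..1/2}" using x by (auto simp: abs_less_iff)
        then show "\<Phi> (Complex x (1/4)) \<in> S" unfolding S_def by blast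
      qed
      ultimately have "joinable \<Omega> (C + m x) z (\<Phi> (Complex x q))" using joinable_trans by blast
      then show "K < C + m x" using nj joinable_mono by (metis not_le_imp_less order_refl)
    qed
  qed
  then show ?thesis using m(1,2) C0 by blast
qed

theorem theorem1p6:
  fixes \<Omega> :: "complex set"
  assumes "Jordan_domain \<Omega>"
    and "internal_diameter \<Omega> = \<infinity>"
  shows "\<exists>\<phi>. boundary_parametrization \<Omega> \<phi> \<and>
    \<not> (\<exists>\<Phi>. homeomorphic_W11_extension \<Omega> \<phi> \<Phi>)"
proof (rule ccontr)
  assume "\<not> ?thesis"
  then have ext: "\<And>\<phi>. boundary_parametrization \<Omega> \<phi> \<Longrightarrow> \<exists>\<Phi>. homeomorphic_W11_extension \<Omega> \<phi> \<Phi>" by blast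
  \<comment> \<open>The inside of a curve is not assumed nonempty; an empty frontier would make the
    supremum 0.\<close>
  have ne: "\<Omega> \<noteq> {}"
  proof
    assume "\<Omega> = {}"
    then have "internal_diameter \<Omega> = 0" by (simp add: internal_diameter_def bot_ennreal)
    then show False using assms(2) by simp
  qed
  note op = Jordan_domain_frontier(1)[OF assms(1) ne]
  obtain \<phi>0 where par0: "boundary_parametrization \<Omega> \<phi>0" using Jordan_domain_frontier(2)[OF assms(1) ne] by blast
  obtain \<Phi>0 \<Psi>0 where hom0: "homeomorphism (cball 0 1) (closure \<Omega>) \<Phi>0 \<Psi>0" and eq0: "\<forall>z\<in>sphere 0 1. \<Phi>0 z = \<phi>0 z"
    using ext[OF par0] unfolding homeomorphic_W11_extension_def by blast
  \<comment> \<open>The base point comes from this first extension and is kept for the second one,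
    which is compared with it through connectedness of \<Omega>.\<close>
  define z where "z = \<Phi>0 0"
  have z: "z \<in> \<Omega>" using extension_image_ball[OF op par0 hom0 eq0] unfolding z_def by force
  have "\<exists>u\<in>sphere 0 1. internally_far \<Omega> z K (\<phi>0 u)" for K
    unfolding z_def by (rule internally_far_boundary_point[OF op par0 hom0 eq0 assms(2)])
  from internally_far_parametrization[OF par0 this]
  obtain \<phi> a b where par: "boundary_parametrization \<Omega> \<phi>" and ab: "\<And>n. - 1 / 2 < a n" "\<And>n. b n < 1 / 2"
      "\<And>n. (1/2) ^ n / 8 \<le> b n - a n"
      "\<And>n x. x \<in> {a n..b n} \<Longrightarrow> internally_far \<Omega> z (8 * 2 ^ n * real n) (\<phi> (upper_arc x))"
    by blast
  obtain \<Phi> where "homeomorphic_W11_extension \<Omega> \<phi> \<Phi>" using ext[OF par] by blast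
  from W11_extension_internal_bound[OF op par this z]
  obtain m C where m: "integrable lborel m" "\<forall>x. 0 \<le> m x" "0 \<le> C"
      "AE x in lborel. \<bar>x\<bar> < 1 / 2 \<longrightarrow> (\<forall>K. internally_far \<Omega> z K (\<phi> (upper_arc x)) \<longrightarrow> K < C + m x)"
    by blast
  \<comment> \<open>On an interval of length at least 2^-n/8 the function \<open>m\<close> exceeds
    8n2^n - C, so its integral is at least n minus a fraction of C. The case distinction makes this
    lower bound for \<open>m\<close> nonnegative, so that the interval may be longer.\<close>
  have bound: "real n - C \<le> integral\<^sup>L lborel m" for n
  proof (cases "C \<le> real n")
    case True
    define K where "K = 8 * 2 ^ n * real n - C"
    have "1 \<le> (2::real) ^ n" by simp
    then have pow: "1 \<le> 8 * (2::real) ^ n" by linarith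
    have "1 * real n \<le> 8 * 2 ^ n * real n" by (intro mult_right_mono pow) auto
    then have K0: "0 \<le> K" using True unfolding K_def by simp
    have "0 < (1/2 :: real) ^ n / 8" by simp
    then have "a n \<le> b n" using ab(3)[of n] by linarith
    have "(1/2) ^ n / 8 * K \<le> (b n - a n) * K" using ab(3) K0 by (rule mult_right_mono)
    also have "\<dots> = (LINT x|lborel. indicator {a n..b n} x * K)" using \<open>a n \<le> b n\<close> by simp
    also have "\<dots> \<le> integral\<^sup>L lborel m"
    proof (rule integral_mono_AE)
      show "integrable lborel (\<lambda>x. indicator {a n..b n} x * K)" 
        by (intro integrable_mult_left integrable_real_indicator) (auto simp: emeasure_lborel_Icc_eq)
      show "AE x in lborel. indicator {a n..b n} x * K \<le> m x"
        using m(4)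
      proof eventually_elim
        case (elim x)
        show ?case
        proof (cases "x \<in> {a n..b n}")
          case True
          have "\<bar>x\<bar> < 1 / 2" using True ab(1)[of n] ab(2)[of n] by (auto simp: abs_less_iff)
          then have "8 * 2 ^ n * real n < C + m x" using elim ab(4)[OF True] by blast
          then show ?thesis using True by (simp add: K_def)
        qed (use m(2) in simp)
      qed
    qed (rule m(1))
    finally have "(1/2) ^ n / 8 * K \<le> integral\<^sup>L lborel m" .
    moreover have "(1/2) ^ n / 8 * K = real n - (1/2) ^ n / 8 * C"
      by (simp add: K_def field_simps power_divide)
    moreover have "(1/2) ^ n / 8 * C \<le> 1 * C"
      using power_le_one[of "1/2::real" n] m(3) by (intro mult_right_mono) auto
    ultimately show ?thesis by linarith
  next
    case False
    moreover have "0 \<le> integral\<^sup>L lborel m" using m(2) by (intro Bochner_Integration.integral_nonneg) auto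
    ultimately show ?thesis by simp
  qed
  obtain n :: nat where "integral\<^sup>L lborel m + C < real n" using reals_Archimedean2 by blast
  then show False using bound[of n] by linarith
qed

end
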